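(* Fix $\kappa\in(0,\infty)$. Let $(\Lambda_n)_{n\in\mathbb{N}}$ be a weak* convergent sequence in $\mathcal{P}(\mathfrak{C})$ with limit $\Lambda\in\mathcal{P}(\mathfrak{C})$ and, for each $n$, let $\nu_n$ be a minimizer of $J_{\Lambda_n,\kappa}$ over $\mathcal{M}_+(\Omega)$, where $J_{\Lambda,\kappa}(\nu):=\int_{\mathfrak{C}}\mathrm{HK}_\kappa^2(\mu,\nu)\,d\Lambda(\mu)$. Then the sequence $(\nu_n)_{n\in\mathbb{N}}$ is weak* pre-compact and each (weak* ) cluster point $\nu$ belongs to $\mathfrak{C}$ and is a minimizer of $J_{\Lambda,\kappa}$ over $\mathcal{M}_+(\Omega)$.
   Context: $\Omega \subset \mathbb{R}^d$ is a compact convex set with non-empty interior. $\mathcal{M}_+(\Omega)$ denotes the non-negative Radon measures on $\Omega$ with the weak* topology (duality with continuous functions), and $\|\mu\| = \mu(\Omega)$. For $\kappa\in(0,\infty)$ and $\mu,\nu\in\mathcal{M}_+(\Omega)$ the Hellinger--Kantorovich distance is $$\mathrm{HK}_\kappa^2(\mu,\nu) := \inf_{\gamma\in\mathcal{M}_+(\Omega\times\Omega)} \int \hat c_\kappa\,d\gamma + \mathrm{KL}(P_1\gamma|\mu)+\mathrm{KL}(P_2\gamma|\nu),$$ where $P_1\gamma,P_2\gamma$ are the two marginals of $\gamma$, $\hat c_\kappa(x,y) = -2\log\cos(|x-y|/\kappa)$ if $|x-y|\le\kappa\pi/2$ (with $-\log 0=+\infty$) and $+\infty$ otherwise, and $\mathrm{KL}(\mu|\nu)=\int\varphi(d\mu/d\nu)\,d\nu$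 if $\mu\ll\nu$, $\mu\ge0$, and $+\infty$ otherwise, with $\varphi(s)=s\log s-s+1$ for $s>0$, $\varphi(0)=1$. It is known that $\mathrm{HK}_\kappa$ metrizes the weak* topology on $\mathcal{M}_+(\Omega)$. Fix $M\in(0,\infty)$ and let $\mathfrak{C} := \{\mu\in\mathcal{M}_+(\Omega) : \|\mu\|\le M\}$, a compact metrizable space in the weak* topology, equipped with its Borel $\sigma$-algebra; $\mathcal{P}(\mathfrak{C})$ is the set of Borel probability measures on $\mathfrak{C}$, with weak* convergence defined by duality with continuous functions on $\mathfrak{C}$. *)

theory Defs
  imports "HOL-Probability.Probability"
begin

section \<open>Measures on a topological space and their weak* topology\<close>

definition borel_of :: "'a topology \<Rightarrow> 'a measure" where
  "borel_of X = sigma (topspace X) {U. openin X U}"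

lemma space_borel_of [simp]: "space (borel_of X) = topspace X"
  and sets_borel_of: "sets (borel_of X) = sigma_sets (topspace X) {U. openin X U}"
proof -
  have "{U. openin X U} \<subseteq> Pow (topspace X)"
    using openin_subset by blast
  then show "space (borel_of X) = topspace X"
    and "sets (borel_of X) = sigma_sets (topspace X) {U. openin X U}"
    by (simp_all add: borel_of_def)
qed

lemma sets_borel_of_top_of_set: "sets (borel_of (top_of_set S)) = sets (restrict_space borel S)"
proof -
  have "sets (restrict_space borel S) = {id -` A \<inter> S |A. A \<in> sigma_sets UNIV {U. open U}}"
    by (auto simp: sets_restrict_space borel_def)
  also have "\<dots> = sigma_sets S {id -` A \<inter> S |A. A \<in> {U. open U}}"
    by (rule sigma_sets_vimage_commute) simp
  also have "{id -` A \<inter> S |A. A \<in> {U. open U}} = (\<inter>) S ` {U. open U}"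
    by auto
  finally have "sets (restrict_space borel S) = sigma_sets S ((\<inter>) S ` {U. open U})" .
  moreover have "{U. openin (top_of_set S) U} = (\<inter>) S ` {U. open U}"
    by (auto simp: openin_open)
  ultimately show ?thesis
    by (simp add: sets_borel_of)
qed

text \<open>
  The set $\mathcal{M}_+(X)$. It is only used for compact metrizable \<open>X\<close>, where every finite
  Borel measure is Radon.
\<close>

definition nonneg_measures :: "'a topology \<Rightarrow> 'a measure set" where
  "nonneg_measures X = {\<mu>. sets \<mu> = sets (borel_of X) \<and> finite_measure \<mu>}"

definition prob_measures :: "'a topology \<Rightarrow> 'a measure set" where
  "prob_measures X = {\<mu> \<in> nonneg_measures X. prob_space \<mu>}"

text \<open>
  The coarsest topology on $\mathcal{M}_+(X)$ for which \<open>\<mu> \<mapsto> \<integral> f d\<mu>\<close> is continuous for every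
  continuous \<open>f\<close>. As \<open>X\<close> is compact in all uses, such an \<open>f\<close> is bounded.
\<close>

definition weak_star :: "'a topology \<Rightarrow> 'a measure topology" where
  "weak_star X = topology_generated_by
     {{\<mu> \<in> nonneg_measures X. (\<integral>x. f x \<partial>\<mu>) \<in> U} | f U.
        continuous_map X euclideanreal f \<and> open U}"

lemma topspace_weak_star [simp]: "topspace (weak_star X) = nonneg_measures X"
proof -
  have "\<exists>f U. nonneg_measures X = {\<mu> \<in> nonneg_measures X. (\<integral>x. f x \<partial>\<mu>) \<in> U} \<and>
      continuous_map X euclideanreal f \<and> open U"
    by (rule exI[of _ "\<lambda>_. 0"], rule exI[of _ UNIV]) auto
  then show ?thesis
    unfolding weak_star_def topology_generated_by_topspace by blast
qed

lemma limitin_weak_star_iff: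
  assumes "\<And>i. \<mu> i \<in> nonneg_measures X"
  shows "limitin (weak_star X) \<mu> \<nu> F \<longleftrightarrow> \<nu> \<in> nonneg_measures X \<and>
    (\<forall>f. continuous_map X euclideanreal f \<longrightarrow> ((\<lambda>i. \<integral>x. f x \<partial>\<mu> i) \<longlongrightarrow> (\<integral>x. f x \<partial>\<nu>)) F)"
    (is "?L \<longleftrightarrow> ?R")
proof
  assume L: ?L
  have \<nu>: "\<nu> \<in> nonneg_measures X"
    using limitin_topspace[OF L] by simp
  have "((\<lambda>i. \<integral>x. f x \<partial>\<mu> i) \<longlongrightarrow> (\<integral>x. f x \<partial>\<nu>)) F" if f: "continuous_map X euclideanreal f" for f
  proof (rule topological_tendstoI)
    fix U :: "real set" assume U: "open U" "(\<integral>x. f x \<partial>\<nu>) \<in> U"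
    have "openin (weak_star X) {\<mu> \<in> nonneg_measures X. (\<integral>x. f x \<partial>\<mu>) \<in> U}"
      unfolding weak_star_def using f U by (intro topology_generated_by_Basis) blast
    from limitinD[OF L this] show "\<forall>\<^sub>F i in F. (\<integral>x. f x \<partial>\<mu> i) \<in> U"
      using U \<nu> by (auto elim: eventually_mono)
  qed
  with \<nu> show ?R by blast
next
  assume R: ?R
  have "\<nu> \<in> U \<longrightarrow> (\<forall>\<^sub>F i in F. \<mu> i \<in> U)"
    if "generate_topology_on {{\<mu> \<in> nonneg_measures X. (\<integral>x. f x \<partial>\<mu>) \<in> U} | f U.
        continuous_map X euclideanreal f \<and> open U} U" for U
    using that
  proof induction
    case (UN K)
    show ?case
    proof
      assume "\<nu> \<in> \<Union>K"
      then obtain k where k: "k \<in> K" "\<nu> \<in> k" by blast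
      with UN.IH have "\<forall>\<^sub>F i in F. \<mu> i \<in> k" by blast
      then show "\<forall>\<^sub>F i in F. \<mu> i \<in> \<Union>K"
        by (rule eventually_mono) (use k in blast)
    qed
  next
    case (Basis s)
    then obtain f V where s: "s = {\<mu> \<in> nonneg_measures X. (\<integral>x. f x \<partial>\<mu>) \<in> V}"
      "continuous_map X euclideanreal f" "open V" by blast
    with R have lim: "((\<lambda>i. \<integral>x. f x \<partial>\<mu> i) \<longlongrightarrow> (\<integral>x. f x \<partial>\<nu>)) F" by blast
    show ?case
    proof
      assume "\<nu> \<in> s"
      then have "(\<integral>x. f x \<partial>\<nu>) \<in> V" using s(1) by blast
      with lim s(3) have "\<forall>\<^sub>F i in F. (\<integral>x. f x \<partial>\<mu> i) \<in> V"
        by (rule topological_tendstoD)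
      then show "\<forall>\<^sub>F i in F. \<mu> i \<in> s"
        by (rule eventually_mono) (use s(1) assms in blast)
    qed
  qed (auto intro: eventually_conj)
  then have "\<forall>U. openin (weak_star X) U \<and> \<nu> \<in> U \<longrightarrow> (\<forall>\<^sub>F i in F. \<mu> i \<in> U)"
    unfolding weak_star_def openin_topology_generated_by_iff by blast
  with R show ?L
    unfolding limitin_def topspace_weak_star by blast
qed

definition cluster_point :: "'a topology \<Rightarrow> (nat \<Rightarrow> 'a) \<Rightarrow> 'a \<Rightarrow> bool" where
  "cluster_point X s x \<longleftrightarrow>
     x \<in> topspace X \<and> (\<forall>U. openin X U \<and> x \<in> U \<longrightarrow> (\<exists>\<^sub>F n in sequentially. s n \<in> U))"

text \<open>Pre-compactness: the closure of the range (in the whole space \<open>X\<close>) is compact.\<close>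

definition precompact_seq :: "'a topology \<Rightarrow> (nat \<Rightarrow> 'a) \<Rightarrow> bool" where
  "precompact_seq X s \<longleftrightarrow> range s \<subseteq> topspace X \<and> compactin X (X closure_of range s)"


section \<open>The Hellinger--Kantorovich distance\<close>

definition KL_fun :: "real \<Rightarrow> real" where
  "KL_fun s = (if s = 0 then 1 else s * ln s - s + 1)"

text \<open>
  For finite measures on the same \<open>\<sigma>\<close>-algebra. \<open>absolutely_continuous \<nu> \<mu>\<close> means $\mu \ll \nu$,
  and \<open>RN_deriv \<nu> \<mu>\<close> is $d\mu/d\nu$, which is then finite almost everywhere. \<open>KL_fun\<close> is
  non-negative on the non-negative reals, so \<open>ennreal\<close> truncates nothing.
\<close>

definition KL :: "'a measure \<Rightarrow> 'a measure \<Rightarrow> ennreal" where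
  "KL \<mu> \<nu> =
     (if absolutely_continuous \<nu> \<mu>
      then \<integral>\<^sup>+ x. ennreal (KL_fun (enn2real (RN_deriv \<nu> \<mu> x))) \<partial>\<nu>
      else \<infinity>)"

text \<open>
  The boundary case $|x-y| = \kappa\pi/2$ has cost $-2\log 0 = +\infty$ and is therefore
  put into the second branch (\<open>ln 0 = 0\<close> in HOL).
\<close>

definition HK_cost :: "real \<Rightarrow> 'a::euclidean_space \<Rightarrow> 'a \<Rightarrow> ennreal" where
  "HK_cost \<kappa> x y =
     (if norm (x - y) < \<kappa> * pi / 2 then ennreal (- 2 * ln (cos (norm (x - y) / \<kappa>))) else \<infinity>)"

definition HK_sq ::
  "real \<Rightarrow> 'a::euclidean_space set \<Rightarrow> 'a measure \<Rightarrow> 'a measure \<Rightarrow> ennreal" where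
  "HK_sq \<kappa> \<Omega> \<mu> \<nu> =
     (INF \<gamma> \<in> nonneg_measures (top_of_set (\<Omega> \<times> \<Omega>)).
        (\<integral>\<^sup>+ (x, y). HK_cost \<kappa> x y \<partial>\<gamma>)
        + KL (distr \<gamma> (borel_of (top_of_set \<Omega>)) fst) \<mu>
        + KL (distr \<gamma> (borel_of (top_of_set \<Omega>)) snd) \<nu>)"


section \<open>The barycenter functional\<close>

definition mass_ball :: "'a::euclidean_space set \<Rightarrow> real \<Rightarrow> 'a measure set" where
  "mass_ball \<Omega> M = {\<mu> \<in> nonneg_measures (top_of_set \<Omega>). measure \<mu> \<Omega> \<le> M}"

definition mass_ball_topology :: "'a::euclidean_space set \<Rightarrow> real \<Rightarrow> 'a measure topology" where
  "mass_ball_topology \<Omega> M = subtopology (weak_star (top_of_set \<Omega>)) (mass_ball \<Omega> M)"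

definition HK_functional ::
  "real \<Rightarrow> 'a::euclidean_space set \<Rightarrow> 'a measure measure \<Rightarrow> 'a measure \<Rightarrow> ennreal" where
  "HK_functional \<kappa> \<Omega> \<Lambda> \<nu> = (\<integral>\<^sup>+ \<mu>. HK_sq \<kappa> \<Omega> \<mu> \<nu> \<partial>\<Lambda>)"

definition HK_minimizer ::
  "real \<Rightarrow> 'a::euclidean_space set \<Rightarrow> 'a measure measure \<Rightarrow> 'a measure \<Rightarrow> bool" where
  "HK_minimizer \<kappa> \<Omega> \<Lambda> \<nu> \<longleftrightarrow>
     \<nu> \<in> nonneg_measures (top_of_set \<Omega>) \<and>
     (\<forall>\<nu>' \<in> nonneg_measures (top_of_set \<Omega>). HK_functional \<kappa> \<Omega> \<Lambda> \<nu> \<le> HK_functional \<kappa> \<Omega> \<Lambda> \<nu>')"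

end

theory Submission
  imports Defs
begin

text \<open>
  The heart is a modulus of continuity of \<open>HK\<^sup>2(\<mu>, \<nu>)\<close> in \<open>\<nu>\<close> that is uniform over all \<open>\<mu>\<close> of bounded mass
  and refers only to finitely many integrals \<open>\<integral> \<theta> j d\<nu>\<close>, where \<open>\<theta>\<close> is a fine partition of unity. Neither
  duality nor the triangle inequality is needed: a nearly optimal plan for \<open>(\<mu>, \<nu>)\<close> is truncated to
  bounded cost, where the cost is uniformly continuous, and its second marginal is then mixed locally
  with weights \<open>\<theta> j\<close>, which turns it into a plan for \<open>(\<mu>, \<nu>')\<close>; by Jensen's inequality the entropy is controlled
  by the integrals \<open>\<integral> \<theta> j d\<nu>\<close> and \<open>\<integral> \<theta> j d\<nu>'\<close>. By symmetry \<open>\<mu> \<mapsto> HK\<^sup>2(\<mu>, \<nu>)\<close> is weak* continuous as well.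

  Replacing \<open>\<nu>\<close> by \<open>s\<^sup>2 \<nu>\<close> with \<open>s < 1\<close> shows that a minimizer has mass at most \<open>M\<close>, so all minimizers lie in
  the weak* compact mass ball. If \<open>\<nu>\<close> is a cluster point, then \<open>J\<^bsub>\<Lambda>\<^sub>n\<^esub>(\<nu>) \<le> J\<^bsub>\<Lambda>\<^sub>n\<^esub>(\<nu>\<^sub>n) + \<epsilon> \<le> J\<^bsub>\<Lambda>\<^sub>n\<^esub>(\<nu>') + \<epsilon>\<close> for
  infinitely many \<open>n\<close> and every competitor \<open>\<nu>'\<close>, and the outer terms converge.
\<close>

section \<open>Relative entropy\<close>

text \<open>Two singularities shape the estimates: the slope \<open>ln\<close> of the entropy is
  unbounded at density 0, and the cost tends to infinity as the distance approaches
  \<open>\<kappa> * pi / 2\<close>. Hence removing mass has a price, and costs are compared only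
  where they are bounded. A third obstacle is a cell that carries a little mass of \<nu> and none of
  \<nu>': plan mass heading there has no place to go. It is discarded, and the superlinear growth of
  \<open>s * ln s\<close> bounds its amount. The constants are interlocked, so their order of choice
  matters: entropy slope \<open>K\<close>, cost level \<open>L\<close>, tangent point
  \<open>b\<close>, cell size \<delta>, and last the tolerance \<tau>, which depends on the number
  of cells.

  Uniformity in \<mu> is what lets \<open>\<nu>s n\<close> and \<open>\<Lambda>s n\<close> vary
  together: \<nu> is compared with \<open>\<nu>s n\<close> under the integral, while the measure is
  kept fixed. The factor \<open>s\<^sup>2\<close> reflects the cone geometry of the distance, where
  a mass is a squared radius and \<open>s\<close> is the geometric mean of the masses 1 and
  \<open>s\<^sup>2\<close>.\<close>

lemma KL_fun_ge_tangent:
  assumes "s \<ge> 0" "b > 0"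
  shows "1 - b + s * ln b \<le> KL_fun s"
\<comment> \<open>The left side is the tangent line of \<open>KL_fun\<close> at \<open>b\<close>,
  with its terms collected so that it is visibly affine in \<open>s\<close>. The convexity arguments
  below go through it.\<close>
proof (cases "s = 0")
  case False
  with assms have s: "s > 0" by simp
  have "ln (b / s) \<le> b / s - 1"
    using s assms by (intro ln_le_minus_one) simp
  then have "s * ln (b / s) \<le> b - s"
    using s by (simp add: field_simps)
  then have "s * ln b - s * ln s \<le> b - s"
    using s assms by (simp add: ln_div right_diff_distrib)
  with s show ?thesis by (simp add: KL_fun_def)
qed (use assms in \<open>simp add: KL_fun_def\<close>)

lemma KL_fun_nonneg: "s \<ge> 0 \<Longrightarrow> KL_fun s \<ge> 0"
  using KL_fun_ge_tangent[of s 1] by simp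

lemma KL_fun_pos: "s > 0 \<Longrightarrow> KL_fun s = s * ln s - s + 1"
  by (simp add: KL_fun_def)

lemma KL_fun_eq: "KL_fun s = s * ln s - s + 1"
  by (simp add: KL_fun_def)

lemma measurable_KL_fun [measurable]: "KL_fun \<in> borel_measurable borel"
  unfolding KL_fun_def[abs_def] by measurable

text \<open>\<open>KL_fun\<close> has slope \<open>ln\<close>, which is at least \<open>-K\<close>
  above \<open>exp (- K)\<close>; there the tangent at \<open>a\<close> suffices. Below that
  threshold the tangent at \<open>exp (- K)\<close> is used, and the surcharge
  \<open>exp (- K) + K * exp (- K)\<close> pays for its offset and for the slope times
  \<open>a\<close>.\<close>

lemma KL_fun_le_add:
  assumes "a \<ge> 0" "h \<ge> 0" "K \<ge> 0"
  shows "KL_fun a \<le> KL_fun (a + h) + (1 + K) * exp (- K) + K * h"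
proof (cases "a \<ge> exp (- K)")
  case True
  then have a: "a > 0" using exp_gt_zero[of "-K"] by linarith
  have "1 - a + (a + h) * ln a \<le> KL_fun (a + h)"
    using a assms by (intro KL_fun_ge_tangent) auto
  moreover have "- K \<le> ln a"
    using True a by (metis ln_ge_iff)
  then have "h * (- K) \<le> h * ln a"
    using assms by (intro mult_left_mono) auto
  moreover have "0 \<le> (1 + K) * exp (- K)" using assms by simp
  ultimately show ?thesis
    using a by (simp add: KL_fun_pos algebra_simps)
next
  case False
  have "1 - exp (- K) + (a + h) * ln (exp (- K)) \<le> KL_fun (a + h)"
    using assms by (intro KL_fun_ge_tangent) auto
  moreover have "K * a \<le> K * exp (- K)"
    using False assms by (intro mult_left_mono) auto
  moreover have "KL_fun a \<le> 1"
  proof (cases "a = 0")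
    case False2: False
    with assms have "a > 0" by simp
    moreover have "ln a \<le> 0"
      using \<open>a > 0\<close> False assms by (smt (verit) exp_le_one_iff ln_le_zero_iff)
    ultimately show ?thesis
      using assms by (smt (verit) KL_fun_pos mult_nonneg_nonpos)
  qed (simp add: KL_fun_def)
  ultimately show ?thesis by (simp add: algebra_simps)
qed

lemma KL_density_eq:
  assumes "finite_measure \<nu>" and [measurable]: "f \<in> borel_measurable \<nu>"
    and "\<And>x. 0 \<le> f x"
  shows "KL (density \<nu> (\<lambda>x. ennreal (f x))) \<nu> = (\<integral>\<^sup>+x. ennreal (KL_fun (f x)) \<partial>\<nu>)"
proof -
  interpret finite_measure \<nu> by fact
  have "AE x in \<nu>. ennreal (f x) = RN_deriv \<nu> (density \<nu> (\<lambda>x. ennreal (f x))) x"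
    by (rule RN_deriv_unique) auto
  then have eq: "AE x in \<nu>. RN_deriv \<nu> (density \<nu> (\<lambda>x. ennreal (f x))) x = ennreal (f x)"
    by (auto elim!: eventually_mono)
  have "(\<integral>\<^sup>+x. ennreal (KL_fun (enn2real (RN_deriv \<nu> (density \<nu> (\<lambda>x. ennreal (f x))) x))) \<partial>\<nu>)
      = (\<integral>\<^sup>+x. ennreal (KL_fun (f x)) \<partial>\<nu>)"
    by (intro nn_integral_cong_AE) (use eq assms(3) in \<open>auto elim!: eventually_mono\<close>)
  moreover have "absolutely_continuous \<nu> (density \<nu> (\<lambda>x. ennreal (f x)))"
    by (rule absolutely_continuousI_density) simp
  ultimately show ?thesis by (simp add: KL_def)
qed

lemma KL_finite_density:
  assumes "finite_measure \<nu>" "finite_measure \<mu>" "sets \<mu> = sets \<nu>" "KL \<mu> \<nu> < \<infinity>"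
  obtains f where "f \<in> borel_measurable \<nu>" "\<And>x. 0 \<le> f x" "\<mu> = density \<nu> (\<lambda>x. ennreal (f x))"
proof -
  interpret finite_measure \<nu> by fact
  interpret \<mu>: finite_measure \<mu> by fact
  have ac: "absolutely_continuous \<nu> \<mu>"
    using assms(4) by (auto simp: KL_def split: if_splits)
  show ?thesis
  proof (rule that[of "\<lambda>x. enn2real (RN_deriv \<nu> \<mu> x)"])
    have "AE x in \<nu>. RN_deriv \<nu> \<mu> x \<noteq> \<infinity>"
      by (rule RN_deriv_finite) (use ac assms \<mu>.sigma_finite_measure_axioms in auto)
    then have "AE x in \<nu>. RN_deriv \<nu> \<mu> x = ennreal (enn2real (RN_deriv \<nu> \<mu> x))"
      by (auto elim!: eventually_mono simp: top.not_eq_extremum)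
    then have "density \<nu> (RN_deriv \<nu> \<mu>) = density \<nu> (\<lambda>x. ennreal (enn2real (RN_deriv \<nu> \<mu> x)))"
      by (intro density_cong) auto
    with density_RN_deriv[OF ac assms(3)]
    show "\<mu> = density \<nu> (\<lambda>x. ennreal (enn2real (RN_deriv \<nu> \<mu> x)))" by simp
  qed auto
qed

text \<open>The order of the measures is tested on the set where the claimed order of the densities
  fails; as the measures are finite, the two integrals over this set can be subtracted.\<close>

lemma finite_measure_density_le:
  assumes "finite_measure \<nu>" and [measurable]: "f \<in> borel_measurable \<nu>" "g \<in> borel_measurable \<nu>"
    and "finite_measure (density \<nu> f)"
    and le: "\<And>A. A \<in> sets \<nu> \<Longrightarrow> emeasure (density \<nu> f) A \<le> emeasure (density \<nu> g) A"
    and fin: "finite_measure (density \<nu> g)"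
  shows "AE x in \<nu>. f x \<le> (g x :: ennreal)"
proof -
  interpret finite_measure \<nu> by fact
  define A where "A = {x \<in> space \<nu>. g x < f x}"
  have [measurable]: "A \<in> sets \<nu>" unfolding A_def by measurable
  have le': "(\<integral>\<^sup>+x. f x * indicator A x \<partial>\<nu>) \<le> (\<integral>\<^sup>+x. g x * indicator A x \<partial>\<nu>)"
    using le[of A] by (simp add: emeasure_density)
  have fg: "(\<integral>\<^sup>+x. g x * indicator A x \<partial>\<nu>) \<noteq> \<infinity>"
    using finite_measure.emeasure_finite[OF fin, of A] by (simp add: emeasure_density)
  have "(\<integral>\<^sup>+x. (f x - g x) * indicator A x \<partial>\<nu>)
      = (\<integral>\<^sup>+x. f x * indicator A x - g x * indicator A x \<partial>\<nu>)"
    by (intro nn_integral_cong) (auto simp: indicator_def)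
  also have "\<dots> = (\<integral>\<^sup>+x. f x * indicator A x \<partial>\<nu>) - (\<integral>\<^sup>+x. g x * indicator A x \<partial>\<nu>)"
    by (rule nn_integral_diff) (use fg in \<open>auto simp: A_def indicator_def\<close>)
  also have "\<dots> = 0"
    using le' fg by (simp add: diff_eq_0_iff_ennreal top.not_eq_extremum le_less_trans)
  finally have "AE x in \<nu>. (f x - g x) * indicator A x = 0"
    by (subst (asm) nn_integral_0_iff_AE) auto
  then show ?thesis
    using AE_space by eventually_elim (auto simp: A_def indicator_def not_less split: if_splits dest: ennreal_minus_eq_0)
qed

text \<open>This is \<open>KL_fun_le_add\<close> integrated against \<mu>, with \<open>a\<close> the
  density of \<beta> and \<open>h\<close> the density of the removed part. \<open>K\<close> stays
  free: a large \<open>K\<close> makes the term proportional to the mass of \<mu> small, and then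
  the removed mass has to be small compared with \<open>1 / K\<close>.\<close>

lemma KL_restrict:
  assumes fin: "finite_measure \<mu>" "finite_measure \<alpha>" "finite_measure \<beta>"
    and sets: "sets \<alpha> = sets \<mu>" "sets \<beta> = sets \<mu>"
    and le: "\<And>A. A \<in> sets \<mu> \<Longrightarrow> emeasure \<beta> A \<le> emeasure \<alpha> A"
    and K: "K \<ge> 0"
  shows "KL \<beta> \<mu> \<le> KL \<alpha> \<mu> + ennreal ((1 + K) * exp (- K)) * emeasure \<mu> (space \<mu>)
      + ennreal K * (emeasure \<alpha> (space \<mu>) - emeasure \<beta> (space \<mu>))"
proof (cases "KL \<alpha> \<mu> < \<infinity>")
  case True
  interpret finite_measure \<mu> by fact
  obtain f where f [measurable]: "f \<in> borel_measurable \<mu>" and f0: "\<And>x. 0 \<le> f x"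
    and \<alpha>: "\<alpha> = density \<mu> (\<lambda>x. ennreal (f x))"
    using KL_finite_density[OF fin(1) fin(2) sets(1) True] by metis
  have ac: "absolutely_continuous \<mu> \<beta>"
    unfolding absolutely_continuous_def
  proof
    fix A assume A: "A \<in> null_sets \<mu>"
    have "absolutely_continuous \<mu> \<alpha>"
      unfolding \<alpha> by (rule absolutely_continuousI_density) simp
    with A have "emeasure \<alpha> A = 0"
      by (auto simp: absolutely_continuous_def)
    with le[of A] A have "emeasure \<beta> A = 0" by auto
    with A sets show "A \<in> null_sets \<beta>" by auto
  qed
  \<comment> \<open>The minimum differs from the Radon-Nikodym derivative only on a null set, and it
    makes \<open>h x \<le> f x\<close> true for every \<open>x\<close>.\<close>
  define h where "h = (\<lambda>x. min (enn2real (RN_deriv \<mu> \<beta> x)) (f x))"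
  have h [measurable]: "h \<in> borel_measurable \<mu>" unfolding h_def by measurable
  have h0: "0 \<le> h x" "h x \<le> f x" for x using f0 by (auto simp: h_def)
  have \<beta>RN: "\<beta> = density \<mu> (RN_deriv \<mu> \<beta>)"
    using density_RN_deriv[OF ac sets(2)] by simp
  have "AE x in \<mu>. RN_deriv \<mu> \<beta> x \<le> ennreal (f x)"
    by (rule finite_measure_density_le) (use fin le in \<open>auto simp flip: \<alpha> \<beta>RN\<close>)
  then have "AE x in \<mu>. RN_deriv \<mu> \<beta> x = ennreal (h x)"
  proof eventually_elim
    case (elim x)
    then have "RN_deriv \<mu> \<beta> x < \<top>" by (metis ennreal_less_top le_less_trans)
    moreover have "enn2real (RN_deriv \<mu> \<beta> x) \<le> f x"
      using elim f0 by (metis enn2real_ennreal enn2real_mono ennreal_less_top)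
    ultimately show ?case by (simp add: h_def min_def)
  qed
  then have \<beta>: "\<beta> = density \<mu> (\<lambda>x. ennreal (h x))"
    by (subst \<beta>RN, intro density_cong) auto
  have split: "emeasure \<alpha> (space \<mu>) - emeasure \<beta> (space \<mu>) = (\<integral>\<^sup>+x. ennreal (f x - h x) \<partial>\<mu>)"
  proof -
    have "emeasure \<alpha> (space \<mu>) = (\<integral>\<^sup>+x. ennreal (f x) \<partial>\<mu>)" "emeasure \<beta> (space \<mu>) = (\<integral>\<^sup>+x. ennreal (h x) \<partial>\<mu>)"
      by (simp_all add: \<alpha> \<beta> emeasure_density cong: nn_integral_cong)
    moreover have "(\<integral>\<^sup>+x. ennreal (f x - h x) \<partial>\<mu>) = (\<integral>\<^sup>+x. ennreal (f x) - ennreal (h x) \<partial>\<mu>)"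
      using h0 by (intro nn_integral_cong) (simp add: ennreal_minus)
    moreover have "\<dots> = (\<integral>\<^sup>+x. ennreal (f x) \<partial>\<mu>) - (\<integral>\<^sup>+x. ennreal (h x) \<partial>\<mu>)"
      by (rule nn_integral_diff)
        (use h0 finite_measure.emeasure_finite[OF fin(3), of "space \<mu>"] in
          \<open>auto simp: \<open>emeasure \<beta> (space \<mu>) = _\<close> intro!: ennreal_leI\<close>)
    ultimately show ?thesis by simp
  qed
  have "KL \<beta> \<mu> = (\<integral>\<^sup>+x. ennreal (KL_fun (h x)) \<partial>\<mu>)"
    using KL_density_eq[OF fin(1) h h0(1)] by (simp flip: \<beta>)
  also have "\<dots> \<le> (\<integral>\<^sup>+x. ennreal (KL_fun (f x)) + ennreal ((1 + K) * exp (- K))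
      + ennreal K * ennreal (f x - h x) \<partial>\<mu>)"
  proof (rule nn_integral_mono)
    fix x
    have "KL_fun (h x) \<le> KL_fun (f x) + (1 + K) * exp (- K) + K * (f x - h x)"
      using KL_fun_le_add[of "h x" "f x - h x" K] h0[of x] K by simp
    then have "ennreal (KL_fun (h x)) \<le> ennreal (KL_fun (f x) + (1 + K) * exp (- K) + K * (f x - h x))"
      by (rule ennreal_leI)
    also have "\<dots> = ennreal (KL_fun (f x)) + ennreal ((1 + K) * exp (- K)) + ennreal K * ennreal (f x - h x)"
      using h0[of x] K f0[of x] by (simp add: ennreal_mult KL_fun_nonneg)
    finally show "ennreal (KL_fun (h x)) \<le> \<dots>" .
  qed
  also have "\<dots> = (\<integral>\<^sup>+x. ennreal (KL_fun (f x)) \<partial>\<mu>) + ennreal ((1 + K) * exp (- K)) * emeasure \<mu> (space \<mu>)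
      + ennreal K * (\<integral>\<^sup>+x. ennreal (f x - h x) \<partial>\<mu>)"
    by (simp add: nn_integral_add nn_integral_cmult)
  also have "(\<integral>\<^sup>+x. ennreal (KL_fun (f x)) \<partial>\<mu>) = KL \<alpha> \<mu>"
    unfolding \<alpha> by (rule KL_density_eq[symmetric]) (use fin f0 in auto)
  finally show ?thesis by (simp add: split)
qed (simp add: not_less top_unique)

text \<open>Jensen's inequality in each cell: the tangent at the cell average
  \<open>b = G j / n j\<close> is integrated against \<open>\<theta> j\<close> times \<nu>. The
  second conclusion is absolute continuity as seen by a cell; it excludes the case in which a
  division by \<open>n j = 0\<close> would hide mass.\<close>

lemma KL_ge_sum:
  fixes \<theta> :: "'i \<Rightarrow> 'a \<Rightarrow> real"
  assumes fin: "finite_measure \<nu>" "finite_measure \<alpha>" "sets \<alpha> = sets \<nu>" "KL \<alpha> \<nu> < \<infinity>"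
    and J: "finite J" and [measurable]: "\<And>j. j \<in> J \<Longrightarrow> \<theta> j \<in> borel_measurable \<nu>"
    and \<theta>0: "\<And>j x. 0 \<le> \<theta> j x" and \<theta>1: "\<And>x. x \<in> space \<nu> \<Longrightarrow> (\<Sum>j\<in>J. \<theta> j x) = 1"
    and n: "\<And>j. j \<in> J \<Longrightarrow> n j = (\<integral>x. \<theta> j x \<partial>\<nu>)" and G: "\<And>j. j \<in> J \<Longrightarrow> G j = (\<integral>x. \<theta> j x \<partial>\<alpha>)"
  shows "ennreal (\<Sum>j\<in>J. n j * KL_fun (G j / n j)) \<le> KL \<alpha> \<nu>"
    and "\<And>j. j \<in> J \<Longrightarrow> n j = 0 \<Longrightarrow> G j = 0"
proof -
  interpret finite_measure \<nu> by fact
  obtain f where f [measurable]: "f \<in> borel_measurable \<nu>" and f0: "\<And>x. 0 \<le> f x"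
    and \<alpha>: "\<alpha> = density \<nu> (\<lambda>x. ennreal (f x))"
    using KL_finite_density[OF fin] by metis
  have KL: "KL \<alpha> \<nu> = (\<integral>\<^sup>+x. ennreal (KL_fun (f x)) \<partial>\<nu>)"
    unfolding \<alpha> by (rule KL_density_eq) (use fin f0 in auto)
  have \<theta>_le: "\<theta> j x \<le> 1" if "j \<in> J" "x \<in> space \<nu>" for j x
    using member_le_sum[of j J "\<lambda>j. \<theta> j x"] \<theta>0 \<theta>1 J that by auto
  have int\<theta>: "integrable \<nu> (\<theta> j)" if "j \<in> J" for j
    by (rule integrable_const_bound[of _ 1]) (use that \<theta>0 \<theta>_le in auto)
  have "(\<integral>\<^sup>+x. ennreal (f x) \<partial>\<nu>) = emeasure \<alpha> (space \<nu>)"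
    by (simp add: \<alpha> emeasure_density cong: nn_integral_cong)
  also have "\<dots> < \<infinity>"
    using finite_measure.emeasure_finite[OF fin(2)] by (simp add: top.not_eq_extremum)
  finally have intf: "integrable \<nu> f"
    using f0 by (intro integrableI_nonneg) auto
  have intK: "integrable \<nu> (\<lambda>x. KL_fun (f x))"
    using fin(4) f0 by (intro integrableI_nonneg) (auto simp: KL KL_fun_nonneg)
  have int2: "integrable \<nu> (\<lambda>x. \<theta> j x * f x)" "integrable \<nu> (\<lambda>x. \<theta> j x * KL_fun (f x))" if "j \<in> J" for j
  proof -
    show "integrable \<nu> (\<lambda>x. \<theta> j x * f x)"
      by (rule Bochner_Integration.integrable_bound[OF intf])
        (use that \<theta>_le \<theta>0 f0 in \<open>auto simp: abs_mult intro!: mult_left_le_one_le\<close>)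
    show "integrable \<nu> (\<lambda>x. \<theta> j x * KL_fun (f x))"
      by (rule Bochner_Integration.integrable_bound[OF intK])
        (use that \<theta>_le \<theta>0 f0 in \<open>auto simp: abs_mult KL_fun_nonneg intro!: mult_left_le_one_le\<close>)
  qed
  have G': "G j = (\<integral>x. \<theta> j x * f x \<partial>\<nu>)" if "j \<in> J" for j
    using that f0 by (simp add: G \<alpha> integral_real_density mult.commute)
  show "G j = 0" if j: "j \<in> J" "n j = 0" for j
  proof -
    have "AE x in \<nu>. \<theta> j x = 0"
      using j int\<theta> \<theta>0 by (simp add: n integral_nonneg_eq_0_iff_AE)
    then have "(\<integral>x. \<theta> j x * f x \<partial>\<nu>) = (\<integral>x. 0 \<partial>\<nu>)"
      using j by (intro integral_cong_AE) auto
    then show ?thesis using j G' by simp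
  qed
  have le: "n j * KL_fun (G j / n j) \<le> (\<integral>x. \<theta> j x * KL_fun (f x) \<partial>\<nu>)" if j: "j \<in> J" for j
  proof -
    have G0: "0 \<le> G j" and n0: "0 \<le> n j"
      using j f0 \<theta>0 by (auto simp: G' n)
    show ?thesis
    proof (cases "n j = 0")
      case True
      then show ?thesis
        using f0 \<theta>0 by (auto intro!: integral_nonneg_AE simp: KL_fun_nonneg)
    next
      case False
      show ?thesis
      \<comment> \<open>At average 0 there is no tangent, but then \<open>f\<close> vanishes almost
        everywhere on the cell and the value \<open>KL_fun 0 = 1\<close> integrates to
        \<open>n j\<close>.\<close>
      proof (cases "G j = 0")
        case True
        have "(\<integral>x. \<theta> j x * f x \<partial>\<nu>) = 0" using True j G' by simp
        then have "AE x in \<nu>. \<theta> j x * f x = 0"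
          using j int2(1)[OF j] \<theta>0 f0 by (simp add: integral_nonneg_eq_0_iff_AE)
        then have "AE x in \<nu>. \<theta> j x * KL_fun (f x) = \<theta> j x"
          by eventually_elim (auto simp: KL_fun_def)
        then have "(\<integral>x. \<theta> j x * KL_fun (f x) \<partial>\<nu>) = n j"
          using j by (subst n) (auto intro!: integral_cong_AE)
        then show ?thesis using True by (simp add: KL_fun_def)
      next
        case False2: False
        define b where "b = G j / n j"
        have b: "b > 0" using False False2 G0 n0 by (simp add: b_def)
        have "n j * KL_fun b = n j * (1 - b) + G j * ln b"
        proof -
          have "n j * (b * ln b) = G j * ln b" using False by (simp add: b_def)
          with b show ?thesis by (simp add: KL_fun_pos algebra_simps)
        qed
        also have "\<dots> = (\<integral>x. \<theta> j x * (1 - b) + \<theta> j x * f x * ln b \<partial>\<nu>)"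
          using j int\<theta> int2 by (simp add: n G')
        also have "\<dots> \<le> (\<integral>x. \<theta> j x * KL_fun (f x) \<partial>\<nu>)"
        proof (rule integral_mono)
          fix x
          have "\<theta> j x * (1 - b + f x * ln b) \<le> \<theta> j x * KL_fun (f x)"
            using KL_fun_ge_tangent[of "f x" b] b f0 \<theta>0 by (intro mult_left_mono) auto
          then show "\<theta> j x * (1 - b) + \<theta> j x * f x * ln b \<le> \<theta> j x * KL_fun (f x)"
            by (simp add: algebra_simps)
        qed (use j int\<theta> int2 in auto)
        finally show ?thesis by (simp add: b_def)
      qed
    qed
  qed
  have "(\<Sum>j\<in>J. n j * KL_fun (G j / n j)) \<le> (\<Sum>j\<in>J. \<integral>x. \<theta> j x * KL_fun (f x) \<partial>\<nu>)"
    by (rule sum_mono) (rule le)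
  also have "\<dots> = (\<integral>x. (\<Sum>j\<in>J. \<theta> j x * KL_fun (f x)) \<partial>\<nu>)"
    using int2 by (simp add: Bochner_Integration.integral_sum)
  also have "\<dots> = (\<integral>x. KL_fun (f x) \<partial>\<nu>)"
    by (intro Bochner_Integration.integral_cong) (auto simp: \<theta>1 simp flip: sum_distrib_right)
  finally have "ennreal (\<Sum>j\<in>J. n j * KL_fun (G j / n j)) \<le> ennreal (\<integral>x. KL_fun (f x) \<partial>\<nu>)"
    by (rule ennreal_leI)
  also have "\<dots> = KL \<alpha> \<nu>"
    unfolding KL using intK f0 by (simp add: nn_integral_eq_integral KL_fun_nonneg)
  finally show "ennreal (\<Sum>j\<in>J. n j * KL_fun (G j / n j)) \<le> KL \<alpha> \<nu>" .
qed

text \<open>The tangent at the mean is averaged over the points. A vanishing mean has no tangent,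
  but it forces every point of positive weight to be 0.\<close>

lemma KL_fun_convex_sum:
  fixes w s :: "'i \<Rightarrow> real"
  assumes "finite J" "\<And>j. j \<in> J \<Longrightarrow> 0 \<le> w j" "(\<Sum>j\<in>J. w j) = 1" "\<And>j. j \<in> J \<Longrightarrow> 0 \<le> s j"
  shows "KL_fun (\<Sum>j\<in>J. w j * s j) \<le> (\<Sum>j\<in>J. w j * KL_fun (s j))"
proof -
  define b where "b = (\<Sum>j\<in>J. w j * s j)"
  have b0: "b \<ge> 0" using assms by (auto simp: b_def intro!: sum_nonneg)
  show ?thesis
  proof (cases "b = 0")
    case True
    then have "\<forall>j\<in>J. w j * s j = 0"
      using assms by (simp add: b_def sum_nonneg_eq_0_iff)
    then have "(\<Sum>j\<in>J. w j * KL_fun (s j)) = (\<Sum>j\<in>J. w j)"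
      by (intro sum.cong) (auto simp: KL_fun_def)
    with True assms(3) show ?thesis by (simp add: b_def KL_fun_def)
  next
    case False
    with b0 have b: "b > 0" by simp
    have "KL_fun b = (1 - b) * (\<Sum>j\<in>J. w j) + b * ln b"
      using b assms(3) by (simp add: KL_fun_pos)
    also have "\<dots> = (\<Sum>j\<in>J. w j * (1 - b + s j * ln b))"
      by (subst (2) b_def) (simp add: algebra_simps sum.distrib sum_distrib_left sum_distrib_right sum_subtractf)
    also have "\<dots> \<le> (\<Sum>j\<in>J. w j * KL_fun (s j))"
      using assms b by (intro sum_mono mult_left_mono KL_fun_ge_tangent) auto
    finally show ?thesis by (simp add: b_def)
  qed
qed

text \<open>Counterpart of \<open>KL_ge_sum\<close>: at each point the density is an average of the
  \<open>s j\<close> with weights \<open>\<theta> j x\<close>, so convexity applies pointwise. With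
  \<open>s j = G j / n' j\<close> both bounds become sums of the same shape, and only
  \<open>n\<close> and \<open>n'\<close> remain to be compared.\<close>

lemma KL_le_sum:
  fixes \<theta> :: "'i \<Rightarrow> 'a \<Rightarrow> real"
  assumes fin: "finite_measure \<nu>"
    and J: "finite J" and [measurable]: "\<And>j. j \<in> J \<Longrightarrow> \<theta> j \<in> borel_measurable \<nu>"
    and \<theta>0: "\<And>j x. 0 \<le> \<theta> j x" and \<theta>1: "\<And>x. x \<in> space \<nu> \<Longrightarrow> (\<Sum>j\<in>J. \<theta> j x) = 1"
    and n: "\<And>j. j \<in> J \<Longrightarrow> n j = (\<integral>x. \<theta> j x \<partial>\<nu>)" and s: "\<And>j. j \<in> J \<Longrightarrow> 0 \<le> s j"
  shows "KL (density \<nu> (\<lambda>x. ennreal (\<Sum>j\<in>J. \<theta> j x * s j))) \<nu> \<le> ennreal (\<Sum>j\<in>J. n j * KL_fun (s j))"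
proof -
  interpret finite_measure \<nu> by fact
  have \<theta>_le: "\<theta> j x \<le> 1" if "j \<in> J" "x \<in> space \<nu>" for j x
    using member_le_sum[of j J "\<lambda>j. \<theta> j x"] \<theta>0 \<theta>1 J that by auto
  have int\<theta>: "integrable \<nu> (\<theta> j)" if "j \<in> J" for j
    by (rule integrable_const_bound[of _ 1]) (use that \<theta>0 \<theta>_le in auto)
  have "KL (density \<nu> (\<lambda>x. ennreal (\<Sum>j\<in>J. \<theta> j x * s j))) \<nu>
      = (\<integral>\<^sup>+x. ennreal (KL_fun (\<Sum>j\<in>J. \<theta> j x * s j)) \<partial>\<nu>)"
    by (rule KL_density_eq) (use fin \<theta>0 s in \<open>auto intro!: sum_nonneg\<close>)
  also have "\<dots> \<le> (\<integral>\<^sup>+x. ennreal (\<Sum>j\<in>J. \<theta> j x * KL_fun (s j)) \<partial>\<nu>)"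
    using J \<theta>0 \<theta>1 s by (intro nn_integral_mono ennreal_leI KL_fun_convex_sum) auto
  also have "\<dots> = ennreal (\<integral>x. (\<Sum>j\<in>J. \<theta> j x * KL_fun (s j)) \<partial>\<nu>)"
    using J \<theta>0 s int\<theta> by (intro nn_integral_eq_integral) (auto intro!: AE_I2 sum_nonneg simp: KL_fun_nonneg)
  also have "(\<integral>x. (\<Sum>j\<in>J. \<theta> j x * KL_fun (s j)) \<partial>\<nu>) = (\<Sum>j\<in>J. n j * KL_fun (s j))"
    using int\<theta> by (simp add: n)
  finally show ?thesis .
qed

text \<open>For \<open>n > 0\<close> the term equals \<open>G * ln G - G * ln n - G + n\<close>, so
  replacing \<open>n\<close> by \<open>n'\<close> changes it by the difference of the masses plus
  \<open>G\<close> times the difference of their logarithms. If \<open>n' = 0\<close>, the factor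
  \<open>n'\<close> makes the left side 0; the mass \<open>G\<close> is then invisible here and has
  to be accounted for elsewhere.\<close>

lemma KL_fun_perspective_le:
  fixes n n' G \<tau> :: real
  assumes "0 \<le> n" "0 \<le> n'" "0 \<le> G" "n = 0 \<Longrightarrow> G = 0" "\<bar>n - n'\<bar> \<le> \<tau>"
    and ln: "0 < n \<Longrightarrow> 0 < n' \<Longrightarrow> \<bar>ln n - ln n'\<bar> \<le> \<tau>"
  shows "n' * KL_fun (G / n') \<le> n * KL_fun (G / n) + \<tau> + \<tau> * G"
proof -
  have \<tau>: "0 \<le> \<tau>" using assms by linarith
  have ge0: "0 \<le> n * KL_fun (G / n)" using assms by (simp add: KL_fun_nonneg)
  have eq: "n * KL_fun (G / n) = G * ln G - G * ln n - G + n" if "n > 0" for n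
    using that \<open>0 \<le> G\<close>
    by (cases "G = 0") (auto simp: KL_fun_def ln_div algebra_simps)
  consider "n' = 0" | "n' > 0" "n = 0" | "n' > 0" "n > 0" using assms by linarith
  then show ?thesis
  proof cases
    case 1 then show ?thesis using ge0 \<tau> assms by simp
  next
    case 2 then show ?thesis using ge0 \<tau> assms by (simp add: KL_fun_def)
  next
    case 3
    have "G * (ln n - ln n') \<le> G * \<tau>" using ln[OF 3(2,1)] assms(3) by (intro mult_left_mono) auto
    with 3 assms show ?thesis by (simp add: eq algebra_simps)
  qed
qed

text \<open>The tangent at \<open>b\<close>, multiplied by \<open>n\<close>. Read as a bound on
  \<open>G\<close> it is a uniform integrability estimate: dividing by \<open>ln b\<close> makes the
  entropy part small for large \<open>b\<close>, and afterwards a small \<open>n\<close> makes the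
  rest small.\<close>

lemma KL_fun_perspective_ge:
  assumes "0 \<le> n" "0 \<le> G" "n = 0 \<Longrightarrow> G = 0" "b > 0"
  shows "G * ln b \<le> n * KL_fun (G / n) + (b - 1) * n"
proof (cases "n = 0")
  case False
  have "n * (1 - b + G / n * ln b) \<le> n * KL_fun (G / n)"
    using assms by (intro mult_left_mono KL_fun_ge_tangent) auto
  with False show ?thesis by (simp add: algebra_simps)
qed (use assms in simp)

lemma mass_le_KL:
  assumes fin: "finite_measure \<mu>" "finite_measure \<alpha>" "sets \<alpha> = sets \<mu>" "KL \<alpha> \<mu> \<le> ennreal E" "E \<ge> 0"
  shows "measure \<alpha> (space \<alpha>) \<le> E + 2 * measure \<mu> (space \<mu>)"
proof -
  have lt: "KL \<alpha> \<mu> < \<infinity>" using fin(4) by (simp add: order_le_less_trans)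
  define n where "n = (\<lambda>_::unit. measure \<mu> (space \<mu>))"
  define G where "G = (\<lambda>_::unit. measure \<alpha> (space \<alpha>))"
  \<comment> \<open>A partition with one cell reduces the claim to numbers. The tangent at
    \<open>exp 1\<close> has slope 1, and \<open>exp 1 - 1 \<le> 2\<close> gives the
    constant.\<close>
  note * = KL_ge_sum[OF fin(1-3) lt, of "{()}" "\<lambda>_ _. 1" n G]
  have "ennreal (n () * KL_fun (G () / n ())) \<le> KL \<alpha> \<mu>" "n () = 0 \<Longrightarrow> G () = 0"
    using * by (auto simp: n_def G_def)
  with fin have "n () * KL_fun (G () / n ()) \<le> E"
    by (metis ennreal_le_iff order_trans)
  moreover have "G () * ln (exp 1) \<le> n () * KL_fun (G () / n ()) + (exp 1 - 1) * n ()"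
    by (rule KL_fun_perspective_ge) (use \<open>n () = 0 \<Longrightarrow> G () = 0\<close> in \<open>auto simp: n_def G_def\<close>)
  moreover have "(exp 1 - 1) * n () \<le> 2 * n ()"
    using exp_le by (intro mult_right_mono) (auto simp: n_def)
  ultimately show ?thesis by (simp add: n_def G_def)
qed

section \<open>Moving a transport plan to a nearby second marginal\<close>

text \<open>Plans live on the Borel sets of the product space, whereas Fubini's theorem speaks of
  the product \<sigma>-algebra. The two agree in the ambient space by \<open>borel_prod\<close>; as
  \<Omega> is Borel, this passes to the restrictions.\<close>

lemma sets_borel_of_prod:
  fixes \<Omega> :: "'a::euclidean_space set"
  assumes "\<Omega> \<in> sets borel"
  shows "sets (borel_of (top_of_set (\<Omega> \<times> \<Omega>)))
    = sets (borel_of (top_of_set \<Omega>) \<Otimes>\<^sub>M borel_of (top_of_set \<Omega>))"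
proof -
  let ?R = "restrict_space borel \<Omega>"
  have "sets (restrict_space borel (\<Omega> \<times> \<Omega>)) = sets (?R \<Otimes>\<^sub>M ?R)"
  proof
    have "(\<lambda>p. (fst p, snd p)) \<in> measurable (?R \<Otimes>\<^sub>M ?R) (borel \<Otimes>\<^sub>M borel)"
      by (intro measurable_Pair measurable_compose[OF measurable_fst] measurable_compose[OF measurable_snd]
            measurable_restrict_space1) auto
    then have "(\<lambda>p. p) \<in> measurable (?R \<Otimes>\<^sub>M ?R) borel"
      by (simp add: borel_prod)
    from measurable_sets[OF this] show "sets (restrict_space borel (\<Omega> \<times> \<Omega>)) \<subseteq> sets (?R \<Otimes>\<^sub>M ?R)"
      by (auto simp: sets_restrict_space space_pair_measure space_restrict_space Int_commute vimage_def)
    show "sets (?R \<Otimes>\<^sub>M ?R) \<subseteq> sets (restrict_space borel (\<Omega> \<times> \<Omega>))"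
      unfolding sets_pair_measure
    proof (rule sets.sigma_sets_subset', goal_cases)
      case 1
      show ?case
      proof safe
        fix A B assume "A \<in> sets ?R" "B \<in> sets ?R"
        then have AB: "A \<in> sets borel" "B \<in> sets borel" "A \<subseteq> \<Omega>" "B \<subseteq> \<Omega>"
          using assms by (auto simp: sets_restrict_space)
        then have "A \<times> B \<in> sets (borel \<Otimes>\<^sub>M borel)" by (intro pair_measureI)
        then have "A \<times> B \<in> sets borel" by (simp only: borel_prod)
        moreover have "A \<times> B = (\<Omega> \<times> \<Omega>) \<inter> (A \<times> B)" using AB by auto
        ultimately show "A \<times> B \<in> sets (restrict_space borel (\<Omega> \<times> \<Omega>))"
          unfolding sets_restrict_space by blast
      qed
    next
      case 2
      have "\<Omega> \<times> \<Omega> = (\<Omega> \<times> \<Omega>) \<inter> UNIV" by simp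
      then show ?case unfolding sets_restrict_space space_restrict_space by auto
    qed
  qed
  then show ?thesis
    by (simp add: sets_borel_of_top_of_set cong: sets_pair_measure_cong)
qed

lemma measurable_borel_of_top_of_set:
  "f \<in> measurable borel M \<Longrightarrow> f \<in> measurable (borel_of (top_of_set \<Omega>)) M"
  by (subst measurable_cong_sets[OF sets_borel_of_top_of_set refl]) (rule measurable_restrict_space1)

lemma measurable_HK_cost:
  fixes \<Omega> :: "'a::euclidean_space set"
  shows "(\<lambda>p. HK_cost \<kappa> (fst p) (snd p)) \<in> borel_measurable (borel_of (top_of_set \<Omega>) \<Otimes>\<^sub>M borel_of (top_of_set \<Omega>))"
proof -
  let ?N = "borel_of (top_of_set \<Omega>)"
  have [measurable]: "fst \<in> measurable (?N \<Otimes>\<^sub>M ?N) borel" "snd \<in> measurable (?N \<Otimes>\<^sub>M ?N) borel"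
    using measurable_compose[OF measurable_fst measurable_borel_of_top_of_set[OF measurable_ident]]
      measurable_compose[OF measurable_snd measurable_borel_of_top_of_set[OF measurable_ident]]
    by (simp_all add: id_def)
  show ?thesis unfolding HK_cost_def by measurable
qed

text \<open>Here \<open>\<theta>\<close> is a partition of unity. Along \<open>\<gamma>\<close>, mass arriving at \<open>y\<close> is split according to the weights
  \<open>\<theta> j y\<close> and spread out proportionally to \<open>\<theta> j \<nu>'\<close>; what arrives where \<open>\<theta> j \<nu>'\<close> vanishes is lost
  (the division by zero below).\<close>

lemma transported_plan:
  fixes \<Omega> :: "'a::euclidean_space set" and \<theta> :: "'i \<Rightarrow> 'a \<Rightarrow> real"
  defines "N \<equiv> borel_of (top_of_set \<Omega>)"
  assumes \<Omega>: "\<Omega> \<in> sets borel"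
    and \<gamma>: "\<gamma> \<in> nonneg_measures (top_of_set (\<Omega> \<times> \<Omega>))"
    and \<nu>': "\<nu>' \<in> nonneg_measures (top_of_set \<Omega>)"
    and J: "finite J" and m\<theta>: "\<And>j. j \<in> J \<Longrightarrow> \<theta> j \<in> borel_measurable N"
    and \<theta>0: "\<And>j x. 0 \<le> \<theta> j x" and \<theta>1: "\<And>x. x \<in> \<Omega> \<Longrightarrow> (\<Sum>j\<in>J. \<theta> j x) = 1"
    and n': "\<And>j. j \<in> J \<Longrightarrow> n' j = (\<integral>x. \<theta> j x \<partial>\<nu>')"
    and A: "A \<in> sets \<gamma>" and \<epsilon>: "\<epsilon> \<ge> 0"
    and cost: "\<And>x y y' j. (x, y) \<in> A \<Longrightarrow> y' \<in> \<Omega> \<Longrightarrow> j \<in> J \<Longrightarrow> \<theta> j y > 0 \<Longrightarrow> \<theta> j y' > 0 \<Longrightarrow>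
      HK_cost \<kappa> x y' \<le> HK_cost \<kappa> x y + ennreal \<epsilon>"
    and G: "\<And>j. j \<in> J \<Longrightarrow> G j = (\<integral>p. indicator A p * \<theta> j (snd p) \<partial>\<gamma>)"
  obtains \<gamma>' where "\<gamma>' \<in> nonneg_measures (top_of_set (\<Omega> \<times> \<Omega>))"
    and "(\<integral>\<^sup>+(x, y). HK_cost \<kappa> x y \<partial>\<gamma>') \<le> (\<integral>\<^sup>+(x, y). HK_cost \<kappa> x y \<partial>\<gamma>) + ennreal \<epsilon> * emeasure \<gamma> (space \<gamma>)"
    and "\<And>S. S \<in> sets N \<Longrightarrow> emeasure (distr \<gamma>' N fst) S
      = (\<integral>\<^sup>+p. indicator S (fst p) * ennreal (indicator A p * (\<Sum>j\<in>{j\<in>J. n' j \<noteq> 0}. \<theta> j (snd p))) \<partial>\<gamma>)"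
    and "distr \<gamma>' N snd = density \<nu>' (\<lambda>y. ennreal (\<Sum>j\<in>J. \<theta> j y * (G j / n' j)))"
proof -
  have s\<gamma> [measurable_cong]: "sets \<gamma> = sets (N \<Otimes>\<^sub>M N)" and "finite_measure \<gamma>"
    using \<gamma> \<Omega> by (auto simp: nonneg_measures_def sets_borel_of_prod N_def)
  have s\<nu> [measurable_cong]: "sets \<nu>' = sets N" and "finite_measure \<nu>'"
    using \<nu>' by (auto simp: nonneg_measures_def N_def)
  interpret \<gamma>: finite_measure \<gamma> by fact
  interpret \<nu>: finite_measure \<nu>' by fact
  interpret P: pair_sigma_finite \<gamma> \<nu>' ..
  have sp\<gamma>: "space \<gamma> = \<Omega> \<times> \<Omega>" using sets_eq_imp_space_eq[OF s\<gamma>] by (simp add: N_def space_pair_measure)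
  have sp\<nu>: "space \<nu>' = \<Omega>" using sets_eq_imp_space_eq[OF s\<nu>] by (simp add: N_def)
  have [measurable]: "\<And>j. j \<in> J \<Longrightarrow> \<theta> j \<in> borel_measurable N" using m\<theta> by simp
  note A [measurable]
  have \<theta>_le: "\<theta> j x \<le> 1" if "j \<in> J" "x \<in> \<Omega>" for j x
    using member_le_sum[of j J "\<lambda>j. \<theta> j x"] \<theta>0 \<theta>1 J that by auto
  have int\<theta>: "integrable \<nu>' (\<theta> j)" if "j \<in> J" for j
    by (rule \<nu>.integrable_const_bound[of _ 1]) (use that \<theta>0 \<theta>_le in \<open>auto simp: sp\<nu>\<close>)
  have intA: "integrable \<gamma> (\<lambda>p. indicator A p * \<theta> j (snd p))" if "j \<in> J" for j
    by (rule \<gamma>.integrable_const_bound[of _ 1])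
      (use that \<theta>0 \<theta>_le in \<open>auto simp: sp\<gamma> indicator_def\<close>)
  have n'0: "n' j \<ge> 0" if "j \<in> J" for j using n'[OF that] \<theta>0 by simp
  have G0: "G j \<ge> 0" if "j \<in> J" for j using G[OF that] \<theta>0 by simp
  \<comment> \<open>Density of a three-point plan for \<open>((x, y), y')\<close> with respect to
    the product of \<gamma> and \<nu>': the point \<open>x\<close> is kept, and \<open>y\<close> is
    exchanged for a point \<open>y'\<close> of a common cell. Forgetting \<open>y\<close> yields the
    new plan.\<close>
  define D where "D = (\<lambda>q :: ('a \<times> 'a) \<times> 'a. indicator A (fst q) * (\<Sum>j\<in>J. \<theta> j (snd (fst q)) * \<theta> j (snd q) / n' j))"
  define W where "W = (\<lambda>p :: 'a \<times> 'a. indicator A p * (\<Sum>j\<in>{j\<in>J. n' j \<noteq> 0}. \<theta> j (snd p)))"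
  have D0: "D q \<ge> 0" for q
    using \<theta>0 n'0 by (auto simp: D_def intro!: sum_nonneg mult_nonneg_nonneg divide_nonneg_nonneg)
  have D [measurable]: "D \<in> borel_measurable (\<gamma> \<Otimes>\<^sub>M \<nu>')" unfolding D_def by measurable
  have W0: "W p \<ge> 0" for p using \<theta>0 by (auto simp: W_def intro!: mult_nonneg_nonneg sum_nonneg)
  have W1: "W p \<le> 1" if "p \<in> space \<gamma>" for p
  proof -
    have "(\<Sum>j\<in>{j\<in>J. n' j \<noteq> 0}. \<theta> j (snd p)) \<le> (\<Sum>j\<in>J. \<theta> j (snd p))"
      using J \<theta>0 by (intro sum_mono2) auto
    also have "\<dots> = 1" using that by (intro \<theta>1) (auto simp: sp\<gamma>)
    finally show ?thesis using \<theta>0 by (auto simp: W_def indicator_def)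
  qed
  have W [measurable]: "W \<in> borel_measurable \<gamma>" unfolding W_def by measurable
  have intD: "(\<integral>\<^sup>+y'. ennreal (D (p, y')) \<partial>\<nu>') = ennreal (W p)" if "p \<in> space \<gamma>" for p
  proof -
    have "integrable \<nu>' (\<lambda>y'. D (p, y'))" using int\<theta> by (auto simp: D_def)
    then have "(\<integral>\<^sup>+y'. ennreal (D (p, y')) \<partial>\<nu>') = ennreal (\<integral>y'. D (p, y') \<partial>\<nu>')"
      by (intro nn_integral_eq_integral AE_I2 D0)
    also have "(\<integral>y'. D (p, y') \<partial>\<nu>') = indicator A p * (\<Sum>j\<in>J. \<theta> j (snd p) * n' j / n' j)"
      using int\<theta> by (simp add: D_def n')
    \<comment> \<open>\<open>n' j / n' j\<close> is 1 or, for a cell without mass, 0. This is the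
      place where mass gets lost.\<close>
    also have "(\<Sum>j\<in>J. \<theta> j (snd p) * n' j / n' j) = (\<Sum>j\<in>{j\<in>J. n' j \<noteq> 0}. \<theta> j (snd p))"
      using J by (intro sum.mono_neutral_cong_right) auto
    finally show ?thesis by (simp add: W_def)
  qed
  have intD': "(\<integral>\<^sup>+p. ennreal (D (p, y')) \<partial>\<gamma>) = ennreal (\<Sum>j\<in>J. \<theta> j y' * (G j / n' j))" for y'
  proof -
    have eq: "D (p, y') = (\<Sum>j\<in>J. (indicator A p * \<theta> j (snd p)) * (\<theta> j y' / n' j))" for p
      by (simp add: D_def sum_distrib_left mult_ac)
    have "integrable \<gamma> (\<lambda>p. D (p, y'))" unfolding eq using intA by auto
    then have "(\<integral>\<^sup>+p. ennreal (D (p, y')) \<partial>\<gamma>) = ennreal (\<integral>p. D (p, y') \<partial>\<gamma>)"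
      using D0 by (intro nn_integral_eq_integral) auto
    also have "(\<integral>p. D (p, y') \<partial>\<gamma>) = (\<Sum>j\<in>J. G j * (\<theta> j y' / n' j))"
      unfolding eq using intA by (simp add: G)
    finally show ?thesis by (simp add: mult_ac)
  qed
  define \<gamma>' where "\<gamma>' = distr (density (\<gamma> \<Otimes>\<^sub>M \<nu>') (\<lambda>q. ennreal (D q))) (N \<Otimes>\<^sub>M N) (\<lambda>q. (fst (fst q), snd q))"
  have nn: "(\<integral>\<^sup>+r. h r \<partial>\<gamma>') = (\<integral>\<^sup>+p. (\<integral>\<^sup>+y'. ennreal (D (p, y')) * h (fst p, y') \<partial>\<nu>') \<partial>\<gamma>)"
    if [measurable]: "h \<in> borel_measurable (N \<Otimes>\<^sub>M N)" for h
  proof -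
    have "(\<integral>\<^sup>+r. h r \<partial>\<gamma>') = (\<integral>\<^sup>+q. ennreal (D q) * h (fst (fst q), snd q) \<partial>(\<gamma> \<Otimes>\<^sub>M \<nu>'))"
      unfolding \<gamma>'_def by (simp add: nn_integral_distr nn_integral_density)
    also have "\<dots> = (\<integral>\<^sup>+p. (\<integral>\<^sup>+y'. ennreal (D (p, y')) * h (fst p, y') \<partial>\<nu>') \<partial>\<gamma>)"
      by (subst \<nu>.nn_integral_fst[symmetric]) auto
    finally show ?thesis .
  qed
  have s\<gamma>': "sets \<gamma>' = sets (N \<Otimes>\<^sub>M N)" by (simp add: \<gamma>'_def)
  note s\<gamma>' [measurable_cong]
  have em1: "emeasure (distr \<gamma>' N fst) S = (\<integral>\<^sup>+p. indicator S (fst p) * ennreal (W p) \<partial>\<gamma>)"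
    if S [measurable]: "S \<in> sets N" for S
  proof -
    have "emeasure (distr \<gamma>' N fst) S = (\<integral>\<^sup>+x. indicator S x \<partial>distr \<gamma>' N fst)"
      by simp
    also have "\<dots> = (\<integral>\<^sup>+r. indicator S (fst r) \<partial>\<gamma>')"
      by (subst nn_integral_distr) auto
    also have "\<dots> = (\<integral>\<^sup>+p. (\<integral>\<^sup>+y'. ennreal (D (p, y')) * indicator S (fst p) \<partial>\<nu>') \<partial>\<gamma>)"
      by (subst nn) auto
    also have "\<dots> = (\<integral>\<^sup>+p. indicator S (fst p) * ennreal (W p) \<partial>\<gamma>)"
      by (intro nn_integral_cong) (simp add: nn_integral_multc intD, simp add: mult.commute)
    finally show ?thesis .
  qed
  show ?thesis
  proof (rule that)
    have "emeasure \<gamma>' (space \<gamma>') = (\<integral>\<^sup>+p. (\<integral>\<^sup>+y'. ennreal (D (p, y')) \<partial>\<nu>') \<partial>\<gamma>)"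
      using nn[of "\<lambda>_. 1"] by simp
    also have "\<dots> = (\<integral>\<^sup>+p. ennreal (W p) \<partial>\<gamma>)" by (intro nn_integral_cong intD)
    also have "\<dots> \<le> (\<integral>\<^sup>+p. 1 \<partial>\<gamma>)" using W1 by (intro nn_integral_mono) (auto simp: ennreal_le_1)
    also have "\<dots> < \<infinity>" by (simp add: less_top[symmetric])
    finally have "finite_measure \<gamma>'" by (intro finite_measureI) simp
    then show "\<gamma>' \<in> nonneg_measures (top_of_set (\<Omega> \<times> \<Omega>))"
      using \<Omega> s\<gamma>' by (simp add: nonneg_measures_def sets_borel_of_prod N_def)
  next
    let ?c = "\<lambda>p. HK_cost \<kappa> (fst p) (snd p)"
    have [measurable]: "?c \<in> borel_measurable (N \<Otimes>\<^sub>M N)" unfolding N_def by (rule measurable_HK_cost)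
    have "(\<integral>\<^sup>+r. ?c r \<partial>\<gamma>') = (\<integral>\<^sup>+p. (\<integral>\<^sup>+y'. ennreal (D (p, y')) * HK_cost \<kappa> (fst p) y' \<partial>\<nu>') \<partial>\<gamma>)"
      by (subst nn) auto
    also have "\<dots> \<le> (\<integral>\<^sup>+p. (\<integral>\<^sup>+y'. ennreal (D (p, y')) * (?c p + ennreal \<epsilon>) \<partial>\<nu>') \<partial>\<gamma>)"
    proof (intro nn_integral_mono)
      fix p y' assume p: "p \<in> space \<gamma>" and y': "y' \<in> space \<nu>'"
      show "ennreal (D (p, y')) * HK_cost \<kappa> (fst p) y' \<le> ennreal (D (p, y')) * (?c p + ennreal \<epsilon>)"
      proof (cases "D (p, y') = 0")
        case False
        then have "p \<in> A" by (auto simp: D_def indicator_def split: if_splits)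
        \<comment> \<open>A nonzero density requires one cell that contains both the old and the new
          end point, which is the situation of the hypothesis \<open>cost\<close>.\<close>
        have "(\<Sum>j\<in>J. \<theta> j (snd p) * \<theta> j y' / n' j) \<noteq> 0"
          using False by (simp add: D_def)
        then obtain j where "j \<in> J" "\<theta> j (snd p) * \<theta> j y' / n' j \<noteq> 0"
          by (rule sum.not_neutral_contains_not_neutral)
        then have "j \<in> J" "\<theta> j (snd p) \<noteq> 0" "\<theta> j y' \<noteq> 0" by auto
        with \<open>p \<in> A\<close> have "HK_cost \<kappa> (fst p) y' \<le> ?c p + ennreal \<epsilon>"
          using y' \<theta>0 by (intro cost[of _ _ _ j]) (auto simp: sp\<nu> less_le)
        then show ?thesis by (rule mult_left_mono) simp
      qed simp
    qed
    also have "\<dots> = (\<integral>\<^sup>+p. ennreal (W p) * (?c p + ennreal \<epsilon>) \<partial>\<gamma>)"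
      by (intro nn_integral_cong) (simp add: nn_integral_multc intD)
    also have "\<dots> \<le> (\<integral>\<^sup>+p. 1 * (?c p + ennreal \<epsilon>) \<partial>\<gamma>)"
      using W1 by (intro nn_integral_mono mult_right_mono) (auto simp: ennreal_le_1)
    also have "\<dots> = (\<integral>\<^sup>+p. ?c p \<partial>\<gamma>) + ennreal \<epsilon> * emeasure \<gamma> (space \<gamma>)"
      by (simp add: nn_integral_add)
    finally show "(\<integral>\<^sup>+(x, y). HK_cost \<kappa> x y \<partial>\<gamma>') \<le> (\<integral>\<^sup>+(x, y). HK_cost \<kappa> x y \<partial>\<gamma>) + ennreal \<epsilon> * emeasure \<gamma> (space \<gamma>)"
      by (simp add: case_prod_unfold)
  next
    fix S assume "S \<in> sets N"
    then show "emeasure (distr \<gamma>' N fst) S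
      = (\<integral>\<^sup>+p. indicator S (fst p) * ennreal (indicator A p * (\<Sum>j\<in>{j\<in>J. n' j \<noteq> 0}. \<theta> j (snd p))) \<partial>\<gamma>)"
      using em1 unfolding W_def by simp
  next
    let ?s = "\<lambda>y. ennreal (\<Sum>j\<in>J. \<theta> j y * (G j / n' j))"
    show "distr \<gamma>' N snd = density \<nu>' ?s"
    proof (rule measure_eqI)
      fix S assume "S \<in> sets (distr \<gamma>' N snd)"
      then have S [measurable]: "S \<in> sets N" by simp
      have "emeasure (distr \<gamma>' N snd) S = (\<integral>\<^sup>+x. indicator S x \<partial>distr \<gamma>' N snd)"
        by simp
      also have "\<dots> = (\<integral>\<^sup>+r. indicator S (snd r) \<partial>\<gamma>')"
        by (subst nn_integral_distr) auto
      also have "\<dots> = (\<integral>\<^sup>+p. (\<integral>\<^sup>+y'. ennreal (D (p, y')) * indicator S y' \<partial>\<nu>') \<partial>\<gamma>)"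
        by (subst nn) auto
      also have "\<dots> = (\<integral>\<^sup>+y'. (\<integral>\<^sup>+p. ennreal (D (p, y')) * indicator S y' \<partial>\<gamma>) \<partial>\<nu>')"
        by (rule P.Fubini'[symmetric]) (simp add: case_prod_unfold)
      also have "\<dots> = (\<integral>\<^sup>+y'. ?s y' * indicator S y' \<partial>\<nu>')"
        by (intro nn_integral_cong) (simp add: nn_integral_multc intD')
      also have "\<dots> = emeasure (density \<nu>' ?s) S"
        by (subst emeasure_density) auto
      finally show "emeasure (distr \<gamma>' N snd) S = emeasure (density \<nu>' ?s) S" .
    qed (simp add: s\<nu>)
  qed
qed

lemma HK_sq_le:
  assumes "\<gamma> \<in> nonneg_measures (top_of_set (\<Omega> \<times> \<Omega>))"
  shows "HK_sq \<kappa> \<Omega> \<mu> \<nu> \<le> (\<integral>\<^sup>+ (x, y). HK_cost \<kappa> x y \<partial>\<gamma>)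
        + KL (distr \<gamma> (borel_of (top_of_set \<Omega>)) fst) \<mu>
        + KL (distr \<gamma> (borel_of (top_of_set \<Omega>)) snd) \<nu>"
  unfolding HK_sq_def using assms by (rule INF_lower)

lemma ennreal_diff_le_of_le_add: "a \<le> b + c \<Longrightarrow> b < \<top> \<Longrightarrow> a - b \<le> (c :: ennreal)"
  by (auto simp: ennreal_minus_le_iff)

text \<open>The plan is cut off at cost \<open>L\<close>. Lost mass \<open>h\<close> costs at most \<open>\<eta> + K h\<close> entropy per unit of
  reference mass, and \<open>b\<close> controls the mass sent where \<open>\<nu>\<close> is small and \<open>\<nu>'\<close> has none.\<close>

lemma HK_transfer:
  fixes \<Omega> :: "'a::euclidean_space set" and \<theta> :: "'i \<Rightarrow> 'a \<Rightarrow> real"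
  defines "N \<equiv> borel_of (top_of_set \<Omega>)"
  assumes \<Omega>: "\<Omega> \<in> sets borel"
    and \<mu>: "\<mu> \<in> mass_ball \<Omega> M" and \<nu>: "\<nu> \<in> mass_ball \<Omega> M" and \<nu>': "\<nu>' \<in> nonneg_measures (top_of_set \<Omega>)"
    and \<gamma>: "\<gamma> \<in> nonneg_measures (top_of_set (\<Omega> \<times> \<Omega>))"
    and E: "(\<integral>\<^sup>+(x, y). HK_cost \<kappa> x y \<partial>\<gamma>) + KL (distr \<gamma> N fst) \<mu> + KL (distr \<gamma> N snd) \<nu> \<le> ennreal E" "E \<ge> 0"
    and J: "finite J" and m\<theta>: "\<And>j. j \<in> J \<Longrightarrow> \<theta> j \<in> borel_measurable N"
    and \<theta>0: "\<And>j x. 0 \<le> \<theta> j x" and \<theta>1: "\<And>x. x \<in> \<Omega> \<Longrightarrow> (\<Sum>j\<in>J. \<theta> j x) = 1"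
    and cost: "\<And>x y y' j. HK_cost \<kappa> x y \<le> ennreal L \<Longrightarrow> x \<in> \<Omega> \<Longrightarrow> y \<in> \<Omega> \<Longrightarrow> y' \<in> \<Omega> \<Longrightarrow> j \<in> J \<Longrightarrow>
      \<theta> j y > 0 \<Longrightarrow> \<theta> j y' > 0 \<Longrightarrow> HK_cost \<kappa> x y' \<le> HK_cost \<kappa> x y + ennreal \<epsilon>"
    and n: "\<And>j. j \<in> J \<Longrightarrow> n j = (\<integral>x. \<theta> j x \<partial>\<nu>)" and n': "\<And>j. j \<in> J \<Longrightarrow> n' j = (\<integral>x. \<theta> j x \<partial>\<nu>')"
    and near: "\<And>j. j \<in> J \<Longrightarrow> \<bar>n j - n' j\<bar> \<le> \<tau>"
    and near_ln: "\<And>j. j \<in> J \<Longrightarrow> 0 < n j \<Longrightarrow> 0 < n' j \<Longrightarrow> \<bar>ln (n j) - ln (n' j)\<bar> \<le> \<tau>"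
    and par: "\<epsilon> \<ge> 0" "L > 0" "K \<ge> 0" "b > 1" "\<tau> \<ge> 0"
    and \<eta>: "\<eta> = (1 + K) * exp (- K)" and B: "B = E + 2 * M"
  shows "HK_sq \<kappa> \<Omega> \<mu> \<nu>' \<le>
    (\<integral>\<^sup>+(x, y). HK_cost \<kappa> x y \<partial>\<gamma>) + KL (distr \<gamma> N fst) \<mu> + KL (distr \<gamma> N snd) \<nu>
    + ennreal (\<epsilon> * B + 2 * \<eta> * M + 2 * K * (E / L)
      + K * ((E + \<eta> * M + K * (E / L) + (b - 1) * (\<tau> * card J)) / ln b) + \<tau> * card J + \<tau> * B)"
proof -
  let ?c = "\<lambda>p. HK_cost \<kappa> (fst p) (snd p)"
  define C where "C = (\<integral>\<^sup>+p. ?c p \<partial>\<gamma>)"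
  define K1 where "K1 = KL (distr \<gamma> N fst) \<mu>"
  define K2 where "K2 = KL (distr \<gamma> N snd) \<nu>"
  have CK: "C + K1 + K2 \<le> ennreal E" using E(1) by (simp add: C_def K1_def K2_def case_prod_unfold)
  have CE: "C \<le> ennreal E" and K1E: "K1 \<le> ennreal E" and K2E: "K2 \<le> ennreal E"
  proof -
    have "C \<le> C + K1 + K2" "K1 \<le> C + K1 + K2" "K2 \<le> C + K1 + K2"
      by (auto intro: add_increasing add_increasing2)
    with CK show "C \<le> ennreal E" "K1 \<le> ennreal E" "K2 \<le> ennreal E" by (meson order_trans)+
  qed
  have s\<gamma> [measurable_cong]: "sets \<gamma> = sets (N \<Otimes>\<^sub>M N)" and f\<gamma>: "finite_measure \<gamma>"
    using \<gamma> \<Omega> by (auto simp: nonneg_measures_def sets_borel_of_prod N_def)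
  have s\<mu> [measurable_cong]: "sets \<mu> = sets N" and f\<mu>: "finite_measure \<mu>" and \<mu>M: "measure \<mu> \<Omega> \<le> M"
    using \<mu> by (auto simp: nonneg_measures_def N_def mass_ball_def)
  have s\<nu> [measurable_cong]: "sets \<nu> = sets N" and f\<nu>: "finite_measure \<nu>" and \<nu>M: "measure \<nu> \<Omega> \<le> M"
    using \<nu> by (auto simp: nonneg_measures_def N_def mass_ball_def)
  have s\<nu>' [measurable_cong]: "sets \<nu>' = sets N" and f\<nu>': "finite_measure \<nu>'"
    using \<nu>' by (auto simp: nonneg_measures_def N_def)
  interpret \<gamma>: finite_measure \<gamma> by fact
  interpret \<mu>: finite_measure \<mu> by fact
  interpret \<nu>: finite_measure \<nu> by fact
  interpret \<nu>': finite_measure \<nu>' by fact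
  have sp\<gamma>: "space \<gamma> = \<Omega> \<times> \<Omega>" using sets_eq_imp_space_eq[OF s\<gamma>] by (simp add: N_def space_pair_measure)
  have spN: "space N = \<Omega>" by (simp add: N_def)
  have \<Omega>N [measurable]: "\<Omega> \<in> sets N" using sets.top[of N] by (simp add: spN)
  have sp\<mu>: "space \<mu> = \<Omega>" using sets_eq_imp_space_eq[OF s\<mu>] by (simp add: N_def)
  have sp\<nu>: "space \<nu> = \<Omega>" using sets_eq_imp_space_eq[OF s\<nu>] by (simp add: N_def)
  have sp\<nu>': "space \<nu>' = \<Omega>" using sets_eq_imp_space_eq[OF s\<nu>'] by (simp add: N_def)
  have [measurable]: "\<And>j. j \<in> J \<Longrightarrow> \<theta> j \<in> borel_measurable N" using m\<theta> by simp
  have [measurable]: "?c \<in> borel_measurable (N \<Otimes>\<^sub>M N)" unfolding N_def by (rule measurable_HK_cost)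
  have \<theta>_le: "\<theta> j x \<le> 1" if "j \<in> J" "x \<in> \<Omega>" for j x
    using member_le_sum[of j J "\<lambda>j. \<theta> j x"] \<theta>0 \<theta>1 J that by auto
  have M0: "M \<ge> 0" using \<mu>M measure_nonneg[of \<mu> \<Omega>] by linarith
  have \<eta>0: "\<eta> \<ge> 0" using par by (simp add: \<eta>)

  \<comment> \<open>Truncation of the plan at bounded cost\<close>
  define A where "A = {p \<in> space \<gamma>. ?c p \<le> ennreal L}"
  have A [measurable]: "A \<in> sets \<gamma>" unfolding A_def by measurable
  define q where "q = measure \<gamma> (space \<gamma> - A)"
  have q: "emeasure \<gamma> (space \<gamma> - A) = ennreal q" by (simp add: q_def \<gamma>.emeasure_eq_measure)
  \<comment> \<open>Markov's inequality: the cost is at least \<open>L\<close> on the removed set,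
    so the removed mass \<open>q\<close> is at most \<open>E / L\<close>.\<close>
  have "ennreal L * emeasure \<gamma> (space \<gamma> - A) = (\<integral>\<^sup>+p. ennreal L * indicator (space \<gamma> - A) p \<partial>\<gamma>)"
    by (subst nn_integral_cmult_indicator) auto
  also have "\<dots> \<le> C" unfolding C_def
    by (intro nn_integral_mono) (auto simp: A_def indicator_def)
  finally have "ennreal (L * q) \<le> ennreal E" using CE par by (simp add: q ennreal_mult q_def)
  then have "L * q \<le> E" using E(2) by simp
  then have qE: "q \<le> E / L" using par by (simp add: field_simps)
  have q0: "q \<ge> 0" by (simp add: q_def)

  \<comment> \<open>The entropy of the first marginal bounds the mass of the whole plan; this is the
    origin of \<open>B\<close>.\<close>
  have mono_B: "measure \<gamma> (space \<gamma>) \<le> B"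
  proof -
    have "measure (distr \<gamma> N fst) (space (distr \<gamma> N fst)) \<le> E + 2 * measure \<mu> (space \<mu>)"
    proof (rule mass_le_KL)
      show "finite_measure (distr \<gamma> N fst)" by (rule \<gamma>.finite_measure_distr) simp
    qed (use f\<mu> s\<mu> K1E E in \<open>auto simp: K1_def\<close>)
    moreover have "measure (distr \<gamma> N fst) (space (distr \<gamma> N fst)) = measure \<gamma> (space \<gamma>)"
      by (subst measure_distr) (auto simp: sp\<gamma> spN \<Omega>N intro!: arg_cong[where f = "measure \<gamma>"])
    ultimately show ?thesis using \<mu>M by (simp add: B sp\<mu>)
  qed
  have B0: "B \<ge> 0" using mono_B measure_nonneg order_trans by blast

  \<comment> \<open>Second marginal of the truncated plan. Its cell masses \<open>G j\<close> are
    all that the second marginal of the new plan will retain of it.\<close>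
  define \<alpha>2 where "\<alpha>2 = distr (density \<gamma> (\<lambda>p. ennreal (indicator A p))) N snd"
  have em\<alpha>2: "emeasure \<alpha>2 S = emeasure \<gamma> (A \<inter> (snd -` S \<inter> space \<gamma>))" if [measurable]: "S \<in> sets N" for S
  proof -
    have "snd -` S \<inter> space \<gamma> \<in> sets \<gamma>" by measurable
    then have "emeasure \<alpha>2 S = (\<integral>\<^sup>+p. indicator A p * indicator (snd -` S \<inter> space \<gamma>) p \<partial>\<gamma>)"
      by (simp add: \<alpha>2_def emeasure_distr emeasure_density ennreal_indicator)
    also have "\<dots> = (\<integral>\<^sup>+p. indicator (A \<inter> (snd -` S \<inter> space \<gamma>)) p \<partial>\<gamma>)"
      by (simp add: indicator_inter_arith)
    finally show ?thesis using \<open>snd -` S \<inter> space \<gamma> \<in> sets \<gamma>\<close> by simp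
  qed
  have f\<alpha>2: "finite_measure \<alpha>2"
    by (rule finite_measureI) (simp add: em\<alpha>2 spN \<alpha>2_def[THEN arg_cong[where f = space]] del: emeasure_density)
  have s\<alpha>2: "sets \<alpha>2 = sets N" by (simp add: \<alpha>2_def)
  define G where "G = (\<lambda>j. \<integral>x. \<theta> j x \<partial>\<alpha>2)"
  have G: "G j = (\<integral>p. indicator A p * \<theta> j (snd p) \<partial>\<gamma>)" if "j \<in> J" for j
    using that unfolding G_def \<alpha>2_def by (subst integral_distr) (auto simp: integral_density)
  have intA: "integrable \<gamma> (\<lambda>p. indicator A p * \<theta> j (snd p))" if "j \<in> J" for j
    by (rule \<gamma>.integrable_const_bound[of _ 1])
      (use that \<theta>0 \<theta>_le in \<open>auto simp: sp\<gamma> indicator_def\<close>)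
  have G0: "G j \<ge> 0" if "j \<in> J" for j using \<theta>0 by (simp add: G_def)
  have n0: "n j \<ge> 0" "n' j \<ge> 0" if "j \<in> J" for j using n[OF that] n'[OF that] \<theta>0 by auto

  have KL\<alpha>2: "KL \<alpha>2 \<nu> \<le> K2 + ennreal (\<eta> * M + K * (E / L))"
  proof -
    have "KL \<alpha>2 \<nu> \<le> K2 + ennreal ((1 + K) * exp (- K)) * emeasure \<nu> (space \<nu>)
        + ennreal K * (emeasure (distr \<gamma> N snd) (space \<nu>) - emeasure \<alpha>2 (space \<nu>))"
      unfolding K2_def
    proof (rule KL_restrict)
      show "finite_measure (distr \<gamma> N snd)" by (rule \<gamma>.finite_measure_distr) simp
      fix S assume "S \<in> sets \<nu>"
      then have [measurable]: "S \<in> sets N" by (simp add: s\<nu>)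
      show "emeasure \<alpha>2 S \<le> emeasure (distr \<gamma> N snd) S"
        by (auto simp: em\<alpha>2 emeasure_distr intro!: emeasure_mono)
    qed (use f\<nu> f\<alpha>2 s\<nu> s\<alpha>2 par in auto)
    also have "emeasure (distr \<gamma> N snd) (space \<nu>) - emeasure \<alpha>2 (space \<nu>) \<le> ennreal (E / L)"
    proof (rule ennreal_diff_le_of_le_add)
      have "emeasure (distr \<gamma> N snd) (space \<nu>) = emeasure \<gamma> (space \<gamma>)"
        by (auto simp: emeasure_distr spN sp\<gamma> sp\<nu> simp flip: spN intro!: arg_cong[where f = "emeasure \<gamma>"])
      also have "\<dots> = emeasure \<gamma> A + emeasure \<gamma> (space \<gamma> - A)"
        by (subst plus_emeasure) (auto simp: A_def intro!: arg_cong[where f = "emeasure \<gamma>"])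
      also have "emeasure \<gamma> A = emeasure \<alpha>2 (space \<nu>)"
        using sets.top[of N] by (auto simp: em\<alpha>2 spN sp\<nu> A_def sp\<gamma> intro!: arg_cong[where f = "emeasure \<gamma>"])
      finally show "emeasure (distr \<gamma> N snd) (space \<nu>) \<le> emeasure \<alpha>2 (space \<nu>) + ennreal (E / L)"
        using qE by (simp add: q ennreal_leI add_left_mono)
      show "emeasure \<alpha>2 (space \<nu>) < \<top>"
        using finite_measure.emeasure_finite[OF f\<alpha>2] by (simp add: less_top[symmetric])
    qed
    also have "emeasure \<nu> (space \<nu>) \<le> ennreal M"
      using \<nu>M by (simp add: \<nu>.emeasure_eq_measure sp\<nu> ennreal_leI)
    finally have *: "KL \<alpha>2 \<nu> \<le> K2 + ennreal ((1 + K) * exp (- K)) * ennreal M + ennreal K * ennreal (E / L)"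
      by (simp add: mult_left_mono add_left_mono add_mono)
    have "ennreal ((1 + K) * exp (- K)) * ennreal M + ennreal K * ennreal (E / L) = ennreal (\<eta> * M + K * (E / L))"
      using \<eta>0 M0 par E by (simp only: \<eta> ennreal_mult[symmetric] ennreal_plus[symmetric] mult_nonneg_nonneg divide_nonneg_pos)
    with * show ?thesis by (simp only: add.assoc)
  qed
  have "K2 + ennreal (\<eta> * M + K * (E / L)) \<le> ennreal E + ennreal (\<eta> * M + K * (E / L))"
    by (intro add_right_mono K2E)
  also have "\<dots> = ennreal (E + \<eta> * M + K * (E / L))"
    using E par \<eta>0 M0 by (simp flip: ennreal_plus add: add.assoc)
  finally have KL\<alpha>2': "KL \<alpha>2 \<nu> \<le> ennreal (E + \<eta> * M + K * (E / L))"
    using KL\<alpha>2 by (rule order_trans[rotated])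
  have lt: "KL \<alpha>2 \<nu> < \<infinity>" using KL\<alpha>2' by (simp add: order_le_less_trans)
  have sum_n: "ennreal (\<Sum>j\<in>J. n j * KL_fun (G j / n j)) \<le> KL \<alpha>2 \<nu>"
    and nG: "\<And>j. j \<in> J \<Longrightarrow> n j = 0 \<Longrightarrow> G j = 0"
    using KL_ge_sum[OF f\<nu> f\<alpha>2 _ lt J, of \<theta> n G] \<theta>0 \<theta>1 n by (auto simp: s\<alpha>2 s\<nu> G_def sp\<nu>)
  have sum_n': "(\<Sum>j\<in>J. n j * KL_fun (G j / n j)) \<le> E + \<eta> * M + K * (E / L)"
    using order_trans[OF sum_n KL\<alpha>2'] E par \<eta>0 M0 by (subst (asm) ennreal_le_iff) auto

  \<comment> \<open>Cells that \<nu>' does not charge. There \<nu> has mass at most \<tau>, so the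
    entropy bound on \<open>\<alpha>2\<close> leaves little plan mass in them.\<close>
  define bad where "bad = {j \<in> J. n' j = 0}"
  have bad: "(\<Sum>j\<in>bad. G j) \<le> (E + \<eta> * M + K * (E / L) + (b - 1) * (\<tau> * card J)) / ln b"
  proof -
    have "(\<Sum>j\<in>bad. G j) * ln b \<le> (\<Sum>j\<in>bad. n j * KL_fun (G j / n j) + (b - 1) * n j)"
      unfolding sum_distrib_right
      by (intro sum_mono KL_fun_perspective_ge) (use n0 G0 nG par in \<open>auto simp: bad_def\<close>)
    also have "\<dots> \<le> (\<Sum>j\<in>J. n j * KL_fun (G j / n j) + (b - 1) * \<tau>)"
    proof -
      have "(\<Sum>j\<in>bad. n j * KL_fun (G j / n j) + (b - 1) * n j) \<le> (\<Sum>j\<in>bad. n j * KL_fun (G j / n j) + (b - 1) * \<tau>)"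
      proof (intro sum_mono add_left_mono mult_left_mono)
        fix j assume "j \<in> bad"
        then show "n j \<le> \<tau>" using near[of j] by (auto simp: bad_def)
      qed (use par in auto)
      also have "\<dots> \<le> (\<Sum>j\<in>J. n j * KL_fun (G j / n j) + (b - 1) * \<tau>)"
        using J n0 G0 par by (intro sum_mono2) (auto simp: bad_def intro!: add_nonneg_nonneg mult_nonneg_nonneg KL_fun_nonneg)
      finally show ?thesis .
    qed
    also have "\<dots> \<le> E + \<eta> * M + K * (E / L) + (b - 1) * (\<tau> * card J)"
      using sum_n' by (simp add: sum.distrib mult_ac)
    finally show ?thesis using par by (simp add: field_simps)
  qed

  obtain \<gamma>' where \<gamma>': "\<gamma>' \<in> nonneg_measures (top_of_set (\<Omega> \<times> \<Omega>))"
    and c\<gamma>': "(\<integral>\<^sup>+(x, y). HK_cost \<kappa> x y \<partial>\<gamma>') \<le> (\<integral>\<^sup>+(x, y). HK_cost \<kappa> x y \<partial>\<gamma>) + ennreal \<epsilon> * emeasure \<gamma> (space \<gamma>)"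
    and m1: "\<And>S. S \<in> sets N \<Longrightarrow> emeasure (distr \<gamma>' N fst) S
      = (\<integral>\<^sup>+p. indicator S (fst p) * ennreal (indicator A p * (\<Sum>j\<in>{j\<in>J. n' j \<noteq> 0}. \<theta> j (snd p))) \<partial>\<gamma>)"
    and m2: "distr \<gamma>' N snd = density \<nu>' (\<lambda>y. ennreal (\<Sum>j\<in>J. \<theta> j y * (G j / n' j)))"
  proof (rule transported_plan[OF \<Omega> \<gamma> \<nu>' J, of \<theta> n' A \<epsilon> \<kappa> G, folded N_def])
    show "HK_cost \<kappa> x y' \<le> HK_cost \<kappa> x y + ennreal \<epsilon>"
      if "(x, y) \<in> A" "y' \<in> \<Omega>" "j \<in> J" "\<theta> j y > 0" "\<theta> j y' > 0" for x y y' j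
      using that by (intro cost[of x y y' j]) (auto simp: A_def sp\<gamma>)
  qed (use \<theta>0 \<theta>1 n' A par G in auto)
  have s\<gamma>' [measurable_cong]: "sets \<gamma>' = sets (N \<Otimes>\<^sub>M N)" and f\<gamma>': "finite_measure \<gamma>'"
    using \<gamma>' \<Omega> by (auto simp: nonneg_measures_def sets_borel_of_prod N_def)
  define W where "W = (\<lambda>p. indicator A p * (\<Sum>j\<in>{j\<in>J. n' j \<noteq> 0}. \<theta> j (snd p)))"
  have W0: "W p \<ge> 0" for p using \<theta>0 by (auto simp: W_def intro!: mult_nonneg_nonneg sum_nonneg)
  have [measurable]: "W \<in> borel_measurable \<gamma>" unfolding W_def by measurable
  \<comment> \<open>Every point of the plan splits into a retained part, a part cut off for its cost
    and a part sent to bad cells. Integrated, this gives the mass missing from the first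
    marginal.\<close>
  have W1: "W p + (indicator (space \<gamma> - A) p + (\<Sum>j\<in>bad. indicator A p * \<theta> j (snd p))) = 1" if "p \<in> space \<gamma>" for p
  proof -
    have "(\<Sum>j\<in>{j\<in>J. n' j \<noteq> 0}. \<theta> j (snd p)) + (\<Sum>j\<in>bad. \<theta> j (snd p)) = (\<Sum>j\<in>J. \<theta> j (snd p))"
      unfolding bad_def using J
      by (subst sum.union_disjoint[symmetric]) (auto intro!: sum.cong)
    also have "\<dots> = 1" using that by (intro \<theta>1) (auto simp: sp\<gamma>)
    finally show ?thesis using that by (auto simp: W_def indicator_def)
  qed
  have KL1: "KL (distr \<gamma>' N fst) \<mu> \<le> K1 + ennreal (\<eta> * M + K * (E / L + (\<Sum>j\<in>bad. G j)))"
  proof -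
    have "KL (distr \<gamma>' N fst) \<mu> \<le> K1 + ennreal ((1 + K) * exp (- K)) * emeasure \<mu> (space \<mu>)
        + ennreal K * (emeasure (distr \<gamma> N fst) (space \<mu>) - emeasure (distr \<gamma>' N fst) (space \<mu>))"
      unfolding K1_def
    proof (rule KL_restrict)
      show "finite_measure (distr \<gamma> N fst)" by (rule \<gamma>.finite_measure_distr) simp
      show "finite_measure (distr \<gamma>' N fst)" by (rule finite_measure.finite_measure_distr[OF f\<gamma>']) simp
      fix S assume "S \<in> sets \<mu>"
      then have [measurable]: "S \<in> sets N" by (simp add: s\<mu>)
      have W_le: "W p \<le> 1" if "p \<in> space \<gamma>" for p
        using W1[OF that] \<theta>0 sum_nonneg[of bad "\<lambda>j. indicator A p * \<theta> j (snd p)"]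
        by (smt (verit) indicator_pos_le mult_nonneg_nonneg)
      have "emeasure (distr \<gamma>' N fst) S \<le> (\<integral>\<^sup>+p. indicator S (fst p) * 1 \<partial>\<gamma>)"
        unfolding m1[OF \<open>S \<in> sets N\<close>] W_def[symmetric]
        using W_le by (intro nn_integral_mono mult_left_mono) (auto simp: ennreal_le_1 W_def)
      also have "\<dots> = (\<integral>\<^sup>+x. indicator S x \<partial>distr \<gamma> N fst)"
        by (subst nn_integral_distr) auto
      finally show "emeasure (distr \<gamma>' N fst) S \<le> emeasure (distr \<gamma> N fst) S"
        by simp
    qed (use f\<mu> s\<mu> par in auto)
    also have "emeasure (distr \<gamma> N fst) (space \<mu>) - emeasure (distr \<gamma>' N fst) (space \<mu>)
        \<le> ennreal (E / L + (\<Sum>j\<in>bad. G j))"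
    proof (rule ennreal_diff_le_of_le_add)
      have "emeasure (distr \<gamma> N fst) (space \<mu>) = emeasure \<gamma> (space \<gamma>)"
        by (auto simp: emeasure_distr spN sp\<gamma> sp\<mu> simp flip: spN intro!: arg_cong[where f = "emeasure \<gamma>"])
      also have "\<dots> = (\<integral>\<^sup>+p. 1 \<partial>\<gamma>)" by simp
      also have "\<dots> = (\<integral>\<^sup>+p. ennreal (W p) + ennreal (indicator (space \<gamma> - A) p + (\<Sum>j\<in>bad. indicator A p * \<theta> j (snd p))) \<partial>\<gamma>)"
        by (intro nn_integral_cong, subst ennreal_plus[symmetric])
          (use W0 W1 \<theta>0 in \<open>auto intro!: add_nonneg_nonneg sum_nonneg\<close>)
      also have "\<dots> = (\<integral>\<^sup>+p. ennreal (W p) \<partial>\<gamma>)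
          + (\<integral>\<^sup>+p. ennreal (indicator (space \<gamma> - A) p + (\<Sum>j\<in>bad. indicator A p * \<theta> j (snd p))) \<partial>\<gamma>)"
        by (rule nn_integral_add) (auto simp: bad_def)
      also have "(\<integral>\<^sup>+p. ennreal (W p) \<partial>\<gamma>) = emeasure (distr \<gamma>' N fst) (space \<mu>)"
        using m1[OF \<Omega>N] by (simp add: sp\<mu>) (auto intro!: nn_integral_cong simp: sp\<gamma> W_def)
      also have "(\<integral>\<^sup>+p. ennreal (indicator (space \<gamma> - A) p + (\<Sum>j\<in>bad. indicator A p * \<theta> j (snd p))) \<partial>\<gamma>)
          = ennreal (q + (\<Sum>j\<in>bad. G j))"
      proof -
        have "integrable \<gamma> (\<lambda>p. indicator (space \<gamma> - A) p + (\<Sum>j\<in>bad. indicator A p * \<theta> j (snd p)))"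
          by (intro Bochner_Integration.integrable_add Bochner_Integration.integrable_sum intA)
            (auto simp: bad_def \<gamma>.emeasure_eq_measure intro!: integrable_real_indicator)
        then have "(\<integral>\<^sup>+p. ennreal (indicator (space \<gamma> - A) p + (\<Sum>j\<in>bad. indicator A p * \<theta> j (snd p))) \<partial>\<gamma>)
          = ennreal (\<integral>p. indicator (space \<gamma> - A) p + (\<Sum>j\<in>bad. indicator A p * \<theta> j (snd p)) \<partial>\<gamma>)"
          using \<theta>0 by (intro nn_integral_eq_integral AE_I2 add_nonneg_nonneg sum_nonneg mult_nonneg_nonneg) auto
        also have "(\<integral>p. indicator (space \<gamma> - A) p + (\<Sum>j\<in>bad. indicator A p * \<theta> j (snd p)) \<partial>\<gamma>) = q + (\<Sum>j\<in>bad. G j)"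
          using intA by (subst Bochner_Integration.integral_add) (auto simp: bad_def \<gamma>.emeasure_eq_measure q_def G)
        finally show ?thesis .
      qed
      finally show "emeasure (distr \<gamma> N fst) (space \<mu>) \<le> emeasure (distr \<gamma>' N fst) (space \<mu>) + ennreal (E / L + (\<Sum>j\<in>bad. G j))"
        using qE by (simp add: ennreal_leI add_left_mono)
      show "emeasure (distr \<gamma>' N fst) (space \<mu>) < \<top>"
        using finite_measure.emeasure_finite[OF finite_measure.finite_measure_distr[OF f\<gamma>'], of fst N]
        by (simp add: less_top[symmetric])
    qed
    also have "emeasure \<mu> (space \<mu>) \<le> ennreal M"
      using \<mu>M by (simp add: \<mu>.emeasure_eq_measure sp\<mu> ennreal_leI)
    finally have *: "KL (distr \<gamma>' N fst) \<mu> \<le> K1 + ennreal ((1 + K) * exp (- K)) * ennreal M + ennreal K * ennreal (E / L + (\<Sum>j\<in>bad. G j))"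
      by (simp add: mult_left_mono add_left_mono add_mono)
    have "(\<Sum>j\<in>bad. G j) \<ge> 0" using G0 by (auto simp: bad_def intro!: sum_nonneg)
    with \<eta>0 M0 par E have "ennreal ((1 + K) * exp (- K)) * ennreal M + ennreal K * ennreal (E / L + (\<Sum>j\<in>bad. G j))
      = ennreal (\<eta> * M + K * (E / L + (\<Sum>j\<in>bad. G j)))"
      by (simp only: \<eta> ennreal_mult[symmetric] ennreal_plus[symmetric] mult_nonneg_nonneg divide_nonneg_pos add_nonneg_nonneg)
    with * show ?thesis by (simp only: add.assoc)
  qed

  \<comment> \<open>The chain consists of the upper Jensen bound for the new marginal, the
    comparison of the perspectives cell by cell, and the lower Jensen bound for the old one. The
    term \<open>\<tau> * B\<close> stems from the logarithms, since the \<open>G j\<close> add up to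
    at most the mass of the plan.\<close>
  have KL2: "KL (distr \<gamma>' N snd) \<nu>' \<le> K2 + ennreal (\<eta> * M + K * (E / L) + (\<tau> * card J + \<tau> * B))"
  proof -
    have "KL (distr \<gamma>' N snd) \<nu>' \<le> ennreal (\<Sum>j\<in>J. n' j * KL_fun (G j / n' j))"
      unfolding m2 by (rule KL_le_sum) (use f\<nu>' J \<theta>0 \<theta>1 n' n0 G0 in \<open>auto simp: sp\<nu>'\<close>)
    also have "\<dots> \<le> ennreal ((\<Sum>j\<in>J. n j * KL_fun (G j / n j)) + (\<tau> * card J + \<tau> * B))"
    proof (rule ennreal_leI)
      have "(\<Sum>j\<in>J. n' j * KL_fun (G j / n' j)) \<le> (\<Sum>j\<in>J. n j * KL_fun (G j / n j) + \<tau> + \<tau> * G j)"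
        using n0 G0 nG near near_ln by (intro sum_mono KL_fun_perspective_le) auto
      also have "\<dots> = (\<Sum>j\<in>J. n j * KL_fun (G j / n j)) + \<tau> * card J + \<tau> * (\<Sum>j\<in>J. G j)"
        by (simp add: sum.distrib sum_distrib_left mult.commute)
      also have "(\<Sum>j\<in>J. G j) \<le> B"
      proof -
        have "(\<Sum>j\<in>J. G j) = (\<integral>p. (\<Sum>j\<in>J. indicator A p * \<theta> j (snd p)) \<partial>\<gamma>)"
          using intA by (simp add: G)
        also have "\<dots> \<le> (\<integral>p. 1 \<partial>\<gamma>)"
        proof (rule integral_mono)
          fix p assume "p \<in> space \<gamma>"
          then have "(\<Sum>j\<in>J. \<theta> j (snd p)) = 1" by (intro \<theta>1) (auto simp: sp\<gamma>)
          then show "(\<Sum>j\<in>J. indicator A p * \<theta> j (snd p)) \<le> 1"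
            by (auto simp: indicator_def simp flip: sum_distrib_left)
        qed (use intA in auto)
        also have "\<dots> \<le> B" using mono_B by simp
        finally show ?thesis .
      qed
      finally show "(\<Sum>j\<in>J. n' j * KL_fun (G j / n' j)) \<le> (\<Sum>j\<in>J. n j * KL_fun (G j / n j)) + (\<tau> * card J + \<tau> * B)"
        using par by (simp add: mult_left_mono add.assoc)
    qed
    also have "\<dots> = ennreal (\<Sum>j\<in>J. n j * KL_fun (G j / n j)) + ennreal (\<tau> * card J + \<tau> * B)"
      using n0 G0 par B0 by (intro ennreal_plus sum_nonneg add_nonneg_nonneg mult_nonneg_nonneg KL_fun_nonneg) auto
    also have "\<dots> \<le> K2 + ennreal (\<eta> * M + K * (E / L)) + ennreal (\<tau> * card J + \<tau> * B)"
      by (intro add_right_mono order_trans[OF sum_n KL\<alpha>2])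
    also have "\<dots> = K2 + ennreal (\<eta> * M + K * (E / L) + (\<tau> * card J + \<tau> * B))"
      using E par \<eta>0 M0 B0 by (simp add: add.assoc ennreal_plus[symmetric] del: ennreal_plus)
    finally show ?thesis .
  qed
  have c\<gamma>'': "(\<integral>\<^sup>+(x, y). HK_cost \<kappa> x y \<partial>\<gamma>') \<le> C + ennreal (\<epsilon> * B)"
  proof -
    have "ennreal \<epsilon> * emeasure \<gamma> (space \<gamma>) \<le> ennreal \<epsilon> * ennreal B"
      using mono_B by (intro mult_left_mono) (auto simp: \<gamma>.emeasure_eq_measure ennreal_leI)
    with c\<gamma>' show ?thesis using par B0
      by (auto simp: C_def case_prod_unfold ennreal_mult intro: order_trans add_left_mono)
  qed
  define T1 where "T1 = \<eta> * M + K * (E / L + (\<Sum>j\<in>bad. G j))"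
  define T2 where "T2 = \<eta> * M + K * (E / L) + (\<tau> * card J + \<tau> * B)"
  have T0: "T1 \<ge> 0" "T2 \<ge> 0" "\<epsilon> * B \<ge> 0"
    using \<eta>0 M0 par E B0 G0 by (auto simp: T1_def T2_def bad_def intro!: add_nonneg_nonneg mult_nonneg_nonneg sum_nonneg)
  have "HK_sq \<kappa> \<Omega> \<mu> \<nu>' \<le> (\<integral>\<^sup>+(x, y). HK_cost \<kappa> x y \<partial>\<gamma>') + KL (distr \<gamma>' N fst) \<mu> + KL (distr \<gamma>' N snd) \<nu>'"
    unfolding N_def by (rule HK_sq_le) (rule \<gamma>')
  also have "\<dots> \<le> (C + ennreal (\<epsilon> * B)) + (K1 + ennreal T1) + (K2 + ennreal T2)"
    unfolding T1_def T2_def by (intro add_mono c\<gamma>'' KL1 KL2)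
  also have "\<dots> = C + K1 + K2 + ennreal (\<epsilon> * B + T1 + T2)"
    using T0 by (simp add: ac_simps)
  also have "\<dots> \<le> C + K1 + K2 + ennreal (\<epsilon> * B + 2 * \<eta> * M + 2 * K * (E / L)
      + K * ((E + \<eta> * M + K * (E / L) + (b - 1) * (\<tau> * card J)) / ln b) + \<tau> * card J + \<tau> * B)"
  proof (intro add_left_mono ennreal_leI)
    define Y where "Y = (E + \<eta> * M + K * (E / L) + (b - 1) * (\<tau> * card J)) / ln b"
    have "K * (\<Sum>j\<in>bad. G j) \<le> K * Y"
      using bad par unfolding Y_def by (intro mult_left_mono) auto
    then show "\<epsilon> * B + T1 + T2 \<le> \<epsilon> * B + 2 * \<eta> * M + 2 * K * (E / L)
      + K * ((E + \<eta> * M + K * (E / L) + (b - 1) * (\<tau> * card J)) / ln b) + \<tau> * card J + \<tau> * B"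
      unfolding T1_def T2_def Y_def[symmetric] by (simp add: algebra_simps)
  qed
  finally show ?thesis by (simp add: C_def K1_def K2_def case_prod_unfold)
qed

section \<open>Uniform weak* continuity of the Hellinger--Kantorovich distance\<close>

text \<open>Cost at most \<open>L\<close> keeps \<open>x\<close> and \<open>y\<close> within
  distance \<open>r\<close>, strictly below the critical distance; up to the midpoint
  \<open>R\<close> of the two the cost is uniformly continuous in the distance. The bound
  \<open>R - r\<close> on the displacement keeps the new distance in this range.\<close>

lemma HK_cost_modulus:
  assumes "\<kappa> > 0" "L > 0" "\<epsilon> > 0"
  obtains \<delta> where "\<delta> > 0" and "\<And>x y y' :: 'a::euclidean_space. HK_cost \<kappa> x y \<le> ennreal L \<Longrightarrow> norm (y - y') < \<delta> \<Longrightarrow>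
    HK_cost \<kappa> x y' \<le> HK_cost \<kappa> x y + ennreal \<epsilon>"
proof -
  define h where "h = (\<lambda>t. - 2 * ln (cos (t / \<kappa>)))"
  define r where "r = \<kappa> * arccos (exp (- L / 2))"
  have e: "-1 \<le> exp (- L / 2)" "0 < exp (- L / 2)" "exp (- L / 2) \<le> 1"
    using assms exp_gt_zero[of "- L / 2"] by (auto simp del: exp_gt_zero)
  have "arccos (exp (- L / 2)) < arccos 0"
    using e by (intro arccos_less_mono[THEN iffD2]) auto
  then have r: "r < \<kappa> * pi / 2" "r \<ge> 0"
    using assms arccos_lbound[OF e(1,3)] by (auto simp: r_def)
  define R where "R = (r + \<kappa> * pi / 2) / 2"
  have R: "r < R" "R < \<kappa> * pi / 2" using r(1) by (auto simp: R_def mult.commute)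
  have cos_pos: "cos (t / \<kappa>) > 0" if "0 \<le> t" "t < \<kappa> * pi / 2" for t
    using that assms by (intro cos_gt_zero_pi) (auto simp: field_simps intro: less_le_trans[of _ 0])
  have h0: "h t \<ge> 0" if "0 \<le> t" "t < \<kappa> * pi / 2" for t
    using cos_pos[OF that] by (simp add: h_def)
  have "continuous_on {0..R} h"
    unfolding h_def using cos_pos R assms by (intro continuous_intros) (auto simp: less_imp_neq[symmetric])
  then have "uniformly_continuous_on {0..R} h"
    by (intro compact_uniformly_continuous) auto
  then obtain d where d: "d > 0" "\<And>s t. s \<in> {0..R} \<Longrightarrow> t \<in> {0..R} \<Longrightarrow> dist s t < d \<Longrightarrow> dist (h s) (h t) < \<epsilon>"
    using assms unfolding uniformly_continuous_on_def by metis
  show ?thesis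
  proof (rule that[of "min d (R - r)"])
    fix x y y' :: 'a assume c: "HK_cost \<kappa> x y \<le> ennreal L" and y': "norm (y - y') < min d (R - r)"
    define t where "t = norm (x - y)"
    define t' where "t' = norm (x - y')"
    have t: "t < \<kappa> * pi / 2" and cost: "HK_cost \<kappa> x y = ennreal (h t)"
      using c by (auto simp: HK_cost_def t_def h_def top_unique split: if_splits)
    have t0: "0 \<le> t" "0 \<le> t'" by (auto simp: t_def t'_def)
    have "h t \<le> L" using c assms by (simp add: cost)
    then have "- L / 2 \<le> ln (cos (t / \<kappa>))" by (simp add: h_def)
    then have "exp (- L / 2) \<le> cos (t / \<kappa>)"
      using cos_pos[OF t0(1) t] by (metis exp_le_cancel_iff exp_ln)
    then have "arccos (cos (t / \<kappa>)) \<le> arccos (exp (- L / 2))"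
      using e by (intro arccos_le_mono[THEN iffD2]) auto
    moreover have "arccos (cos (t / \<kappa>)) = t / \<kappa>"
    proof (rule arccos_cos)
      have "t \<le> \<kappa> * pi" using t assms by (smt (verit) field_sum_of_halves mult_pos_pos pi_gt_zero)
      then show "t / \<kappa> \<le> pi" using assms by (simp add: field_simps)
    qed (use t0 assms in auto)
    ultimately have tr: "t \<le> r" using assms by (simp add: r_def field_simps)
    have tt': "\<bar>t - t'\<bar> \<le> norm (y - y')"
      unfolding t_def t'_def using norm_triangle_ineq3[of "x - y" "x - y'"] by (simp add: norm_minus_commute)
    have "dist (h t') (h t) < \<epsilon>"
      using tt' tr t0 y' R by (intro d) (auto simp: dist_real_def)
    then have "h t' \<le> h t + \<epsilon>" by (simp add: dist_real_def)
    moreover have "t' < \<kappa> * pi / 2" using tt' tr y' R by auto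
    then have "HK_cost \<kappa> x y' = ennreal (h t')" by (simp add: HK_cost_def t'_def h_def)
    ultimately show "HK_cost \<kappa> x y' \<le> HK_cost \<kappa> x y + ennreal \<epsilon>"
      using h0[OF t0(1) t] assms by (simp add: cost ennreal_leI flip: ennreal_plus)
  qed (use d R in auto)
qed

text \<open>Each function is indexed by a point of \<Omega> that is close to every point where the
  function is positive, so that a test function can be sampled at the index itself.\<close>

definition small_partition :: "'a::metric_space set \<Rightarrow> real \<Rightarrow> 'a set \<Rightarrow> ('a \<Rightarrow> 'a \<Rightarrow> real) \<Rightarrow> bool" where
  "small_partition \<Omega> \<delta> J \<theta> \<longleftrightarrow> finite J \<and> J \<subseteq> \<Omega> \<and> (\<forall>j\<in>J. continuous_on \<Omega> (\<theta> j)) \<and> (\<forall>j x. 0 \<le> \<theta> j x)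
     \<and> (\<forall>x\<in>\<Omega>. (\<Sum>j\<in>J. \<theta> j x) = 1) \<and> (\<forall>j x. \<theta> j x > 0 \<longrightarrow> dist j x < \<delta>)"

lemma small_partition_D:
  assumes "small_partition \<Omega> \<delta> J \<theta>"
  shows "finite J" "J \<subseteq> \<Omega>" "\<And>j. j \<in> J \<Longrightarrow> continuous_on \<Omega> (\<theta> j)" "\<And>j x. 0 \<le> \<theta> j x"
    "\<And>x. x \<in> \<Omega> \<Longrightarrow> (\<Sum>j\<in>J. \<theta> j x) = 1" "\<And>j x. \<theta> j x > 0 \<Longrightarrow> dist j x < \<delta>"
  using assms unfolding small_partition_def by auto

text \<open>Tent functions over a finite \<delta>-net are normalised by their sum, which is positive
  on \<Omega>. Elsewhere the sum may vanish; the quotient is then 0 and respects the conditions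
  imposed at all points.\<close>

lemma small_partition_exists:
  fixes \<Omega> :: "'a::euclidean_space set"
  assumes "compact \<Omega>" "\<delta> > 0"
  obtains J \<theta> where "small_partition \<Omega> \<delta> J \<theta>"
proof -
  obtain J where J: "finite J" "J \<subseteq> \<Omega>" "\<Omega> \<subseteq> (\<Union>j\<in>J. ball j \<delta>)"
    using compactE_image[OF assms(1), of \<Omega> "\<lambda>j. ball j \<delta>"] assms(2) by (metis (no_types, lifting) UN_iff centre_in_ball open_ball subsetI)
  define h where "h = (\<lambda>j x :: 'a. max 0 (\<delta> - dist j x))"
  define s where "s = (\<lambda>x. \<Sum>j\<in>J. h j x)"
  have h0: "h j x \<ge> 0" for j x by (simp add: h_def)
  have s: "s x > 0" if x: "x \<in> \<Omega>" for x
  proof -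
    obtain j where j: "j \<in> J" "dist j x < \<delta>" using J x by auto
    then have "h j x > 0" by (simp add: h_def)
    moreover have "h j x \<le> s x" unfolding s_def using J j h0 by (intro member_le_sum) auto
    ultimately show ?thesis by linarith
  qed
  have "small_partition \<Omega> \<delta> J (\<lambda>j x. h j x / s x)"
    unfolding small_partition_def
  proof (intro conjI ballI allI impI)
    show "continuous_on \<Omega> (\<lambda>x. h j x / s x)" for j
      using s unfolding h_def s_def by (intro continuous_intros) (auto simp: less_imp_neq[symmetric])
    show "h j x / s x \<ge> 0" for j x using h0 by (simp add: s_def sum_nonneg)
    show "(\<Sum>j\<in>J. h j x / s x) = 1" if "x \<in> \<Omega>" for x
      using s[OF that] by (simp add: s_def flip: sum_divide_distrib)
    show "dist j x < \<delta>" if "h j x / s x > 0" for j x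
      using that by (cases "dist j x = \<delta>") (auto simp: h_def max_def split: if_splits)
  qed (use J in auto)
  then show ?thesis by (rule that)
qed

lemma measurable_borel_of_continuous_on:
  fixes f :: "'a::euclidean_space \<Rightarrow> real"
  assumes "continuous_on \<Omega> f"
  shows "f \<in> borel_measurable (borel_of (top_of_set \<Omega>))"
  using borel_measurable_continuous_on_restrict[OF assms]
  by (subst measurable_cong_sets[OF sets_borel_of_top_of_set refl])

lemma KL_zero: "finite_measure \<mu> \<Longrightarrow> KL (density \<mu> (\<lambda>_. 0)) \<mu> = emeasure \<mu> (space \<mu>)"
  using KL_density_eq[of \<mu> "\<lambda>_. 0"] by (simp add: KL_fun_def)

text \<open>The zero plan is admissible and pays \<open>KL_fun 0 = 1\<close> per unit of mass on
  either side. This makes the distance finite and bounds it on a mass ball.\<close>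

lemma HK_sq_le_mass:
  fixes \<Omega> :: "'a::euclidean_space set"
  assumes "\<Omega> \<in> sets borel" "\<mu> \<in> nonneg_measures (top_of_set \<Omega>)" "\<nu> \<in> nonneg_measures (top_of_set \<Omega>)"
  shows "HK_sq \<kappa> \<Omega> \<mu> \<nu> \<le> emeasure \<mu> \<Omega> + emeasure \<nu> \<Omega>"
proof -
  let ?N = "borel_of (top_of_set \<Omega>)"
  define \<gamma> where "\<gamma> = null_measure (borel_of (top_of_set (\<Omega> \<times> \<Omega>)))"
  have s [measurable_cong]: "sets \<gamma> = sets (?N \<Otimes>\<^sub>M ?N)"
    using assms by (simp add: \<gamma>_def sets_borel_of_prod)
  have \<gamma>: "\<gamma> \<in> nonneg_measures (top_of_set (\<Omega> \<times> \<Omega>))"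
    by (auto simp: nonneg_measures_def \<gamma>_def intro!: finite_measureI)
  have sp: "space \<mu> = \<Omega>" "space \<nu> = \<Omega>" and sets: "sets \<mu> = sets ?N" "sets \<nu> = sets ?N"
    using assms sets_eq_imp_space_eq[of \<mu> ?N] sets_eq_imp_space_eq[of \<nu> ?N] by (auto simp: nonneg_measures_def)
  have zero: "distr \<gamma> ?N f = density \<rho> (\<lambda>_. 0)" if "sets \<rho> = sets ?N" "f \<in> measurable \<gamma> ?N" for f \<rho>
  proof (rule measure_eqI)
    fix S assume S: "S \<in> sets (distr \<gamma> ?N f)"
    with that have "f -` S \<inter> space \<gamma> \<in> sets \<gamma>" by (auto intro: measurable_sets)
    with S that show "emeasure (distr \<gamma> ?N f) S = emeasure (density \<rho> (\<lambda>_. 0)) S"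
      by (simp add: emeasure_distr emeasure_density \<gamma>_def)
  qed (use that in auto)
  have "HK_sq \<kappa> \<Omega> \<mu> \<nu> \<le> (\<integral>\<^sup>+ (x, y). HK_cost \<kappa> x y \<partial>\<gamma>) + KL (distr \<gamma> ?N fst) \<mu> + KL (distr \<gamma> ?N snd) \<nu>"
    by (rule HK_sq_le[OF \<gamma>])
  also have "distr \<gamma> ?N fst = density \<mu> (\<lambda>_. 0)" by (rule zero) (use sets in auto)
  also have "distr \<gamma> ?N snd = density \<nu> (\<lambda>_. 0)" by (rule zero) (use sets in auto)
  also have "(\<integral>\<^sup>+ (x, y). HK_cost \<kappa> x y \<partial>\<gamma>) = 0"
    by (rule nn_integral_zero') (auto intro!: AE_I[of _ _ "space \<gamma>"] simp: \<gamma>_def)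
  finally show ?thesis using assms by (auto simp: KL_zero sp nonneg_measures_def)
qed

lemma HK_cost_commute: "HK_cost \<kappa> x y = HK_cost \<kappa> y x"
  by (simp add: HK_cost_def norm_minus_commute)

lemma HK_sq_commute_le:
  fixes \<Omega> :: "'a::euclidean_space set"
  assumes "\<Omega> \<in> sets borel"
  shows "HK_sq \<kappa> \<Omega> \<nu> \<mu> \<le> HK_sq \<kappa> \<Omega> \<mu> \<nu>"
  unfolding HK_sq_def[of _ _ \<mu> \<nu>]
proof (rule INF_greatest)
  let ?N = "borel_of (top_of_set \<Omega>)"
  fix \<gamma> assume \<gamma>: "\<gamma> \<in> nonneg_measures (top_of_set (\<Omega> \<times> \<Omega>))"
  have s [measurable_cong]: "sets \<gamma> = sets (?N \<Otimes>\<^sub>M ?N)"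
    using assms \<gamma> by (simp add: nonneg_measures_def sets_borel_of_prod)
  have [measurable]: "(\<lambda>p. HK_cost \<kappa> (fst p) (snd p)) \<in> borel_measurable (?N \<Otimes>\<^sub>M ?N)" by (rule measurable_HK_cost)
  define \<gamma>' where "\<gamma>' = distr \<gamma> (?N \<Otimes>\<^sub>M ?N) (\<lambda>p. (snd p, fst p))"
  have \<gamma>': "\<gamma>' \<in> nonneg_measures (top_of_set (\<Omega> \<times> \<Omega>))"
    using assms \<gamma> by (auto simp: nonneg_measures_def sets_borel_of_prod \<gamma>'_def intro!: finite_measure.finite_measure_distr)
  have "(\<integral>\<^sup>+ (x, y). HK_cost \<kappa> x y \<partial>\<gamma>') = (\<integral>\<^sup>+ (x, y). HK_cost \<kappa> x y \<partial>\<gamma>)"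
    unfolding \<gamma>'_def case_prod_unfold by (subst nn_integral_distr) (auto simp: HK_cost_commute)
  moreover have "distr \<gamma>' ?N fst = distr \<gamma> ?N snd" "distr \<gamma>' ?N snd = distr \<gamma> ?N fst"
    unfolding \<gamma>'_def by (simp_all add: distr_distr comp_def)
  ultimately show "HK_sq \<kappa> \<Omega> \<nu> \<mu> \<le> (\<integral>\<^sup>+ (x, y). HK_cost \<kappa> x y \<partial>\<gamma>) + KL (distr \<gamma> ?N fst) \<mu> + KL (distr \<gamma> ?N snd) \<nu>"
    using HK_sq_le[OF \<gamma>', of \<kappa> \<nu> \<mu>] by (simp add: ac_simps)
qed

lemma HK_sq_commute:
  fixes \<Omega> :: "'a::euclidean_space set"
  assumes "\<Omega> \<in> sets borel"
  shows "HK_sq \<kappa> \<Omega> \<mu> \<nu> = HK_sq \<kappa> \<Omega> \<nu> \<mu>"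
  using HK_sq_commute_le[OF assms] by (intro antisym)

text \<open>Logarithms are compared only if both integrals are positive, so that for fixed \<nu> the
  condition holds near \<nu> even if some of its integrals vanish. The remaining case, one integral
  zero and the other small, is that of the bad cells. The symmetric form lets one neighbourhood
  serve both directions.\<close>

definition test_close :: "'i set \<Rightarrow> ('i \<Rightarrow> 'a \<Rightarrow> real) \<Rightarrow> real \<Rightarrow> 'a measure \<Rightarrow> 'a measure \<Rightarrow> bool" where
  "test_close J \<theta> \<tau> \<nu> \<nu>' \<longleftrightarrow> (\<forall>j\<in>J. let n = \<integral>x. \<theta> j x \<partial>\<nu>; n' = \<integral>x. \<theta> j x \<partial>\<nu>' in
     \<bar>n - n'\<bar> \<le> \<tau> \<and> (0 < n \<longrightarrow> 0 < n' \<longrightarrow> \<bar>ln n - ln n'\<bar> \<le> \<tau>))"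

lemma test_close_commute: "test_close J \<theta> \<tau> \<nu> \<nu>' \<longleftrightarrow> test_close J \<theta> \<tau> \<nu>' \<nu>"
  by (auto simp: test_close_def Let_def abs_minus_commute)

lemma mass_ball_D:
  assumes "\<mu> \<in> mass_ball \<Omega> M"
  shows "\<mu> \<in> nonneg_measures (top_of_set \<Omega>)" "emeasure \<mu> \<Omega> \<le> ennreal M"
  using assms by (auto simp: mass_ball_def nonneg_measures_def finite_measure.emeasure_eq_measure ennreal_leI)

text \<open>The six error terms of \<open>HK_transfer\<close> are made at most \<open>d\<close>
  each, and the plan misses the infimum by at most another \<open>d\<close>; \<open>e / 8\<close>
  leaves room for all of them. Every constant depends on earlier ones only.\<close>

lemma HK_uniform:
  fixes \<Omega> :: "'a::euclidean_space set"
  assumes "compact \<Omega>" "\<kappa> > 0" "M \<ge> 0" "e > 0"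
  obtains J :: "'a set" and \<theta> \<tau> where "finite J" "\<forall>j\<in>J. continuous_on \<Omega> (\<theta> j)" "\<tau> > 0"
    "\<forall>\<mu>\<in>mass_ball \<Omega> M. \<forall>\<nu>\<in>mass_ball \<Omega> M. \<forall>\<nu>'\<in>mass_ball \<Omega> M.
      test_close J \<theta> \<tau> \<nu> \<nu>' \<longrightarrow> HK_sq \<kappa> \<Omega> \<mu> \<nu>' \<le> HK_sq \<kappa> \<Omega> \<mu> \<nu> + ennreal e"
proof -
  let ?N = "borel_of (top_of_set \<Omega>)"
  have \<Omega>: "\<Omega> \<in> sets borel" using assms by (simp add: borel_compact)
  define d where "d = min 1 (e / 8)"
  have d: "0 < d" "d \<le> 1" "8 * d \<le> e" using assms by (auto simp: d_def)
  \<comment> \<open>The zero plan bounds the squared distance by twice \<open>M\<close>, and the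
    summand 1 absorbs the excess \<open>d\<close> of a nearly optimal plan.\<close>
  define E where "E = 2 * M + 1"
  define B where "B = E + 2 * M"
  have E: "E > 0" and B: "B > 0" using assms by (auto simp: E_def B_def)
  define \<epsilon> where "\<epsilon> = d / B"
  have \<epsilon>: "\<epsilon> > 0" "\<epsilon> * B = d" using d B by (auto simp: \<epsilon>_def)
  \<comment> \<open>As \<open>exp K \<ge> K\<^sup>2 / 2\<close>, \<eta> is at most
    \<open>4 / K\<close>, so \<open>K \<ge> 8 * M / d\<close> gives
    \<open>2 * \<eta> * M \<le> d\<close>.\<close>
  define K where "K = max 1 (8 * M / d)"
  have K: "K \<ge> 1" "8 * M \<le> d * K" using d by (auto simp: K_def max_def field_simps)
  define \<eta> where "\<eta> = (1 + K) * exp (- K)"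
  have \<eta>0: "\<eta> \<ge> 0" using K by (simp add: \<eta>_def)
  have \<eta>M: "2 * \<eta> * M \<le> d"
  proof -
    have "K\<^sup>2 / 2 \<le> exp K" using exp_lower_Taylor_quadratic[of K] K by linarith
    moreover have "K \<le> K\<^sup>2" using K by (simp add: power2_eq_square)
    moreover have "(1 + K) * K = K + K\<^sup>2" by (simp add: power2_eq_square algebra_simps)
    ultimately have "(1 + K) * K \<le> 4 * exp K" by linarith
    then have "\<eta> * K \<le> 4" by (simp add: \<eta>_def exp_minus field_simps)
    then have "\<eta> * K * (2 * M) \<le> 4 * (2 * M)" using assms by (intro mult_right_mono) auto
    also have "\<dots> \<le> d * K" using K by simp
    finally have "K * (2 * \<eta> * M) \<le> K * d" by (simp add: mult_ac)
    then show ?thesis using K by simp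
  qed
  define L where "L = 2 * K * E / d"
  have L: "L > 0" "2 * K * (E / L) = d" using K E d by (auto simp: L_def)
  \<comment> \<open>\<open>E + 3\<close> bounds the numerator of the bad-cell term, and
    \<open>ln b\<close> is chosen such that \<open>K * (E + 3) / ln b\<close> equals
    \<open>d\<close>.\<close>
  define b where "b = exp (K * (E + 3) / d)"
  have b: "b > 1" "ln b = K * (E + 3) / d" using K E d by (auto simp: b_def)
  obtain \<delta> where \<delta>: "\<delta> > 0" "\<And>x y y' :: 'a. HK_cost \<kappa> x y \<le> ennreal L \<Longrightarrow> norm (y - y') < \<delta> \<Longrightarrow>
      HK_cost \<kappa> x y' \<le> HK_cost \<kappa> x y + ennreal \<epsilon>"
    using HK_cost_modulus[OF assms(2) L(1) \<epsilon>(1)] by metis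
  obtain J \<theta> where "small_partition \<Omega> (\<delta> / 2) J \<theta>"
    using small_partition_exists[OF assms(1) half_gt_zero[OF \<delta>(1)]] .
  note J = small_partition_D[OF this]
  define k where "k = real (card J) + 1"
  have k: "k > 0" "card J \<le> k" by (auto simp: k_def)
  \<comment> \<open>Only now are \<open>b\<close> and the number of cells known. The three entries
    handle the bad cells, the change of the cell masses and the change of their logarithms.
    \<open>k\<close> exceeds the number of cells by 1, which keeps the divisor positive.\<close>
  define \<tau> where "\<tau> = min (1 / ((b - 1) * k)) (min (d / k) (d / B))"
  have \<tau>: "\<tau> > 0" "(b - 1) * (\<tau> * k) \<le> 1" "\<tau> * k \<le> d" "\<tau> * B \<le> d"
  proof -
    show "\<tau> > 0" using b k d B by (simp add: \<tau>_def)
    have "\<tau> \<le> 1 / ((b - 1) * k)" "\<tau> \<le> d / k" "\<tau> \<le> d / B" by (auto simp: \<tau>_def)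
    moreover have "0 < (b - 1) * k" using b(1) k(1) by simp
    ultimately have "\<tau> * ((b - 1) * k) \<le> 1" "\<tau> * k \<le> d" "\<tau> * B \<le> d"
      using k(1) B by (simp_all only: pos_le_divide_eq)
    then show "(b - 1) * (\<tau> * k) \<le> 1" "\<tau> * k \<le> d" "\<tau> * B \<le> d"
      by (simp_all only: mult.left_commute)
  qed
  have \<tau>J: "(b - 1) * (\<tau> * card J) \<le> 1" "\<tau> * card J \<le> d"
  proof -
    have "\<tau> * card J \<le> \<tau> * k" using \<tau> k by (intro mult_left_mono) auto
    then show "\<tau> * card J \<le> d" using \<tau> by linarith
    have "(b - 1) * (\<tau> * card J) \<le> (b - 1) * (\<tau> * k)"
      by (rule mult_left_mono[OF \<open>\<tau> * card J \<le> \<tau> * k\<close>]) (use b in simp)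
    with \<tau> show "(b - 1) * (\<tau> * card J) \<le> 1" by linarith
  qed
  define R where "R = \<epsilon> * B + 2 * \<eta> * M + 2 * K * (E / L)
      + K * ((E + \<eta> * M + K * (E / L) + (b - 1) * (\<tau> * card J)) / ln b) + \<tau> * card J + \<tau> * B"
  have "R \<le> 7 * d"
  proof -
    have "E + \<eta> * M + K * (E / L) + (b - 1) * (\<tau> * card J) \<le> E + 3"
    proof -
      have "0 \<le> \<eta> * M" using \<eta>0 assms by simp
      moreover have "2 * (\<eta> * M) \<le> d" using \<eta>M by (simp only: mult.assoc)
      moreover have "2 * (K * (E / L)) = d" using L(2) by (simp only: mult.assoc)
      moreover have "E + x + y + z \<le> E + 3" if "0 \<le> x" "2 * x \<le> d" "2 * y = d" "z \<le> 1" for x y z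
        using that d by linarith
      ultimately show ?thesis using \<tau>J(1) by blast
    qed
    then have "K * ((E + \<eta> * M + K * (E / L) + (b - 1) * (\<tau> * card J)) / ln b) \<le> K * ((E + 3) / ln b)"
      using K ln_gt_zero[OF b(1)] by (intro mult_left_mono divide_right_mono) linarith+
    also have "\<dots> = d" using K E d by (simp add: b)
    finally have "R \<le> d + d + d + d + d + d"
      unfolding R_def using \<epsilon>(2) \<eta>M L(2) \<tau>J(2) \<tau>(4) by (intro add_mono) (simp_all only: order.refl)
    then show ?thesis using d by linarith
  qed
  show ?thesis
  proof (rule that[of J \<theta> \<tau>]; (intro ballI impI)?)
    fix \<mu> \<nu> \<nu>' assume \<mu>: "\<mu> \<in> mass_ball \<Omega> M" and \<nu>: "\<nu> \<in> mass_ball \<Omega> M" and \<nu>': "\<nu>' \<in> mass_ball \<Omega> M"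
      and close: "test_close J \<theta> \<tau> \<nu> \<nu>'"
    have "HK_sq \<kappa> \<Omega> \<mu> \<nu> \<le> emeasure \<mu> \<Omega> + emeasure \<nu> \<Omega>"
      by (rule HK_sq_le_mass[OF \<Omega> mass_ball_D(1)[OF \<mu>] mass_ball_D(1)[OF \<nu>]])
    also have "\<dots> \<le> ennreal M + ennreal M"
      by (intro add_mono mass_ball_D \<mu> \<nu>)
    finally have HKM: "HK_sq \<kappa> \<Omega> \<mu> \<nu> \<le> ennreal (2 * M)"
      using assms by (simp flip: ennreal_plus)
    then have "HK_sq \<kappa> \<Omega> \<mu> \<nu> < \<infinity>" by (simp add: order_le_less_trans)
    then have "HK_sq \<kappa> \<Omega> \<mu> \<nu> < HK_sq \<kappa> \<Omega> \<mu> \<nu> + ennreal d"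
      using d by (simp add: ennreal_add_left_cancel_less[of _ 0, simplified])
    then obtain \<gamma> where \<gamma>: "\<gamma> \<in> nonneg_measures (top_of_set (\<Omega> \<times> \<Omega>))"
      and F: "(\<integral>\<^sup>+ (x, y). HK_cost \<kappa> x y \<partial>\<gamma>) + KL (distr \<gamma> ?N fst) \<mu> + KL (distr \<gamma> ?N snd) \<nu>
        < HK_sq \<kappa> \<Omega> \<mu> \<nu> + ennreal d" (is "?F < _")
      unfolding HK_sq_def[of \<kappa> \<Omega> \<mu> \<nu>] INF_less_iff by auto
    have FE: "?F \<le> ennreal E"
    proof -
      have "?F \<le> ennreal (2 * M) + ennreal d"
        using F HKM by (meson add_right_mono less_imp_le order_trans)
      also have "\<dots> \<le> ennreal E"
        using assms d by (simp add: E_def ennreal_leI flip: ennreal_plus)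
      finally show ?thesis .
    qed
    have "HK_sq \<kappa> \<Omega> \<mu> \<nu>' \<le> ?F + ennreal R"
      unfolding R_def
    proof (rule HK_transfer[OF \<Omega> \<mu> \<nu> mass_ball_D(1)[OF \<nu>'] \<gamma> FE _ J(1), of \<theta> L \<epsilon> "\<lambda>j. \<integral>x. \<theta> j x \<partial>\<nu>" "\<lambda>j. \<integral>x. \<theta> j x \<partial>\<nu>'"])
      fix x y y' j assume *: "HK_cost \<kappa> x y \<le> ennreal L" "\<theta> j y > 0" "\<theta> j y' > 0"
      have "dist j y < \<delta> / 2" "dist j y' < \<delta> / 2" using J(6) * by auto
      then have "dist y y' < \<delta>" by (metis dist_commute dist_triangle_half_l)
      with * show "HK_cost \<kappa> x y' \<le> HK_cost \<kappa> x y + ennreal \<epsilon>"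
        by (intro \<delta>(2)) (auto simp: dist_norm)
    qed (use J E L K b \<tau> \<epsilon> close in
        \<open>auto simp: test_close_def Let_def \<eta>_def B_def intro!: measurable_borel_of_continuous_on\<close>)
    also have "\<dots> \<le> (HK_sq \<kappa> \<Omega> \<mu> \<nu> + ennreal d) + ennreal (7 * d)"
      by (rule add_mono[OF less_imp_le[OF F] ennreal_leI[OF \<open>R \<le> 7 * d\<close>]])
    also have "\<dots> = HK_sq \<kappa> \<Omega> \<mu> \<nu> + ennreal (8 * d)"
      using d by (simp add: add.assoc flip: ennreal_plus)
    also have "\<dots> \<le> HK_sq \<kappa> \<Omega> \<mu> \<nu> + ennreal e"
      using d by (intro add_left_mono ennreal_leI) auto
    finally show "HK_sq \<kappa> \<Omega> \<mu> \<nu>' \<le> HK_sq \<kappa> \<Omega> \<mu> \<nu> + ennreal e" .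
  qed (use J \<tau> in auto)
qed

section \<open>Weak* neighbourhoods from finitely many integrals\<close>

lemma continuous_map_integral_weak_star:
  assumes "continuous_map X euclideanreal f"
  shows "continuous_map (weak_star X) euclideanreal (\<lambda>\<mu>. \<integral>x. f x \<partial>\<mu>)"
  unfolding continuous_map_def
proof (intro conjI allI impI)
  fix U :: "real set" assume "openin euclideanreal U"
  then have "open U" by simp
  with assms show "openin (weak_star X) {\<mu> \<in> topspace (weak_star X). (\<integral>x. f x \<partial>\<mu>) \<in> U}"
    unfolding topspace_weak_star unfolding weak_star_def
    by (intro topology_generated_by_Basis) blast
qed auto

lemma measurable_borel_of_continuous_map:
  assumes "continuous_map X euclideanreal f"
  shows "f \<in> borel_measurable (borel_of X)"
proof (rule borel_measurableI)
  fix S :: "real set" assume "open S"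
  with assms have "openin X {x \<in> topspace X. f x \<in> S}" by (auto simp: continuous_map_def)
  then show "f -` S \<inter> space (borel_of X) \<in> sets (borel_of X)"
    unfolding sets_borel_of space_borel_of
    by (intro sigma_sets.Basic) (auto simp: vimage_def Int_def conj_commute)
qed

text \<open>Each of the finitely many conditions holds near the value of its integral at \<nu>:
  \<open>ln\<close> is continuous at a positive value, and at value 0 the logarithmic part is
  void.\<close>

lemma test_close_neighbourhood:
  fixes \<Omega> :: "'a::euclidean_space set"
  assumes J: "finite J" and c: "\<forall>j\<in>J. continuous_on \<Omega> (\<theta> j)" and \<tau>: "\<tau> > 0"
    and \<nu>: "\<nu> \<in> nonneg_measures (top_of_set \<Omega>)"
  obtains U where "openin (weak_star (top_of_set \<Omega>)) U" "\<nu> \<in> U" "\<forall>\<nu>'\<in>U. test_close J \<theta> \<tau> \<nu> \<nu>'"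
proof -
  let ?T = "weak_star (top_of_set \<Omega>)"
  have "\<exists>V. open V \<and> (\<integral>x. \<theta> j x \<partial>\<nu>) \<in> V \<and> (\<forall>t\<in>V. \<bar>(\<integral>x. \<theta> j x \<partial>\<nu>) - t\<bar> \<le> \<tau> \<and>
      (0 < (\<integral>x. \<theta> j x \<partial>\<nu>) \<longrightarrow> 0 < t \<longrightarrow> \<bar>ln (\<integral>x. \<theta> j x \<partial>\<nu>) - ln t\<bar> \<le> \<tau>))" for j
  proof -
    define n where "n = (\<integral>x. \<theta> j x \<partial>\<nu>)"
    have id: "((\<lambda>t. t) \<longlongrightarrow> n) (nhds n)" by (simp add: filterlim_ident)
    have 1: "\<forall>\<^sub>F t in nhds n. \<bar>n - t\<bar> \<le> \<tau>"
      using tendstoD[OF id \<tau>] by eventually_elim (simp add: dist_real_def)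
    have 2: "\<forall>\<^sub>F t in nhds n. 0 < n \<longrightarrow> 0 < t \<longrightarrow> \<bar>ln n - ln t\<bar> \<le> \<tau>"
    proof (cases "n > 0")
      case True
      then have "(ln \<longlongrightarrow> ln n) (nhds n)" using tendsto_ln[OF id] by simp
      from tendstoD[OF this \<tau>] show ?thesis by eventually_elim (simp add: dist_real_def abs_minus_commute)
    qed simp
    show ?thesis using eventually_conj[OF 1 2] unfolding eventually_nhds n_def by blast
  qed
  then obtain V where V: "\<And>j. open (V j)" "\<And>j. (\<integral>x. \<theta> j x \<partial>\<nu>) \<in> V j"
    "\<And>j t. t \<in> V j \<Longrightarrow> \<bar>(\<integral>x. \<theta> j x \<partial>\<nu>) - t\<bar> \<le> \<tau> \<and>
      (0 < (\<integral>x. \<theta> j x \<partial>\<nu>) \<longrightarrow> 0 < t \<longrightarrow> \<bar>ln (\<integral>x. \<theta> j x \<partial>\<nu>) - ln t\<bar> \<le> \<tau>)"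
    by metis
  \<comment> \<open>The last intersection keeps \<open>U\<close> inside the space, and hence open,
    when \<open>J\<close> is empty.\<close>
  define U where "U = (\<Inter>j\<in>J. {\<mu> \<in> topspace ?T. (\<integral>x. \<theta> j x \<partial>\<mu>) \<in> V j}) \<inter> topspace ?T"
  show ?thesis
  proof (rule that)
    show "openin ?T U"
      unfolding U_def
    proof (rule openin_INT[OF J])
      fix j assume "j \<in> J"
      then have "continuous_map (top_of_set \<Omega>) euclideanreal (\<theta> j)" using c by simp
      from continuous_map_integral_weak_star[OF this]
      show "openin ?T {\<mu> \<in> topspace ?T. (\<integral>x. \<theta> j x \<partial>\<mu>) \<in> V j}"
        using V(1) by (auto simp: continuous_map_def)
    qed
    show "\<nu> \<in> U" using V(2) \<nu> by (simp add: U_def)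
    show "\<forall>\<nu>'\<in>U. test_close J \<theta> \<tau> \<nu> \<nu>'"
      using V(3) by (auto simp: test_close_def Let_def U_def)
  qed
qed

lemma topspace_mass_ball_topology [simp]: "topspace (mass_ball_topology \<Omega> M) = mass_ball \<Omega> M"
  by (auto simp: mass_ball_topology_def mass_ball_def)

lemma mass_ball_mono: "M \<le> M' \<Longrightarrow> mass_ball \<Omega> M \<subseteq> mass_ball \<Omega> M'"
  by (auto simp: mass_ball_def)

lemma nonneg_measures_mass_ball:
  "\<nu> \<in> nonneg_measures (top_of_set \<Omega>) \<Longrightarrow> measure \<nu> \<Omega> \<le> M \<Longrightarrow> \<nu> \<in> mass_ball \<Omega> M"
  by (simp add: mass_ball_def)

lemma HK_neighbourhood:
  fixes \<Omega> :: "'a::euclidean_space set"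
  assumes "compact \<Omega>" "\<kappa> > 0" "M \<ge> 0" "e > 0" "\<nu> \<in> mass_ball \<Omega> M"
  obtains U where "openin (weak_star (top_of_set \<Omega>)) U" "\<nu> \<in> U"
    "\<forall>\<nu>'\<in>U \<inter> mass_ball \<Omega> M. \<forall>\<mu>\<in>mass_ball \<Omega> M. HK_sq \<kappa> \<Omega> \<mu> \<nu> \<le> HK_sq \<kappa> \<Omega> \<mu> \<nu>' + ennreal e"
    "\<forall>\<nu>'\<in>U \<inter> mass_ball \<Omega> M. \<forall>\<mu>\<in>mass_ball \<Omega> M. HK_sq \<kappa> \<Omega> \<mu> \<nu>' \<le> HK_sq \<kappa> \<Omega> \<mu> \<nu> + ennreal e"
proof -
  obtain J :: "'a set" and \<theta> \<tau> where J: "finite J" "\<forall>j\<in>J. continuous_on \<Omega> (\<theta> j)" "\<tau> > 0"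
    and H: "\<forall>\<mu>\<in>mass_ball \<Omega> M. \<forall>\<nu>\<in>mass_ball \<Omega> M. \<forall>\<nu>'\<in>mass_ball \<Omega> M.
      test_close J \<theta> \<tau> \<nu> \<nu>' \<longrightarrow> HK_sq \<kappa> \<Omega> \<mu> \<nu>' \<le> HK_sq \<kappa> \<Omega> \<mu> \<nu> + ennreal e"
    using HK_uniform[OF assms(1-4)] .
  obtain U where U: "openin (weak_star (top_of_set \<Omega>)) U" "\<nu> \<in> U" "\<forall>\<nu>'\<in>U. test_close J \<theta> \<tau> \<nu> \<nu>'"
    using test_close_neighbourhood[OF J mass_ball_D(1)[OF assms(5)]] .
  show ?thesis
    by (rule that[OF U(1,2)]) (use H U(3) assms(5) test_close_commute in blast)+
qed

section \<open>The functional as the integral of a bounded continuous function\<close>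

definition HK_real :: "real \<Rightarrow> 'a::euclidean_space set \<Rightarrow> 'a measure \<Rightarrow> 'a measure \<Rightarrow> real" where
  "HK_real \<kappa> \<Omega> \<mu> \<nu> = enn2real (HK_sq \<kappa> \<Omega> \<mu> \<nu>)"

lemma HK_sq_eq_real:
  fixes \<Omega> :: "'a::euclidean_space set"
  assumes "compact \<Omega>" "\<mu> \<in> nonneg_measures (top_of_set \<Omega>)" "\<nu> \<in> nonneg_measures (top_of_set \<Omega>)"
  shows "HK_sq \<kappa> \<Omega> \<mu> \<nu> = ennreal (HK_real \<kappa> \<Omega> \<mu> \<nu>)" "0 \<le> HK_real \<kappa> \<Omega> \<mu> \<nu>"
    "HK_real \<kappa> \<Omega> \<mu> \<nu> \<le> measure \<mu> \<Omega> + measure \<nu> \<Omega>"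
proof -
  have "HK_sq \<kappa> \<Omega> \<mu> \<nu> \<le> emeasure \<mu> \<Omega> + emeasure \<nu> \<Omega>"
    using assms by (intro HK_sq_le_mass) (auto simp: borel_compact)
  also have "\<dots> = ennreal (measure \<mu> \<Omega> + measure \<nu> \<Omega>)"
    using assms by (auto simp: nonneg_measures_def finite_measure.emeasure_eq_measure)
  finally have le: "HK_sq \<kappa> \<Omega> \<mu> \<nu> \<le> ennreal (measure \<mu> \<Omega> + measure \<nu> \<Omega>)" .
  then have "HK_sq \<kappa> \<Omega> \<mu> \<nu> < \<top>" by (simp add: order_le_less_trans)
  then show "HK_sq \<kappa> \<Omega> \<mu> \<nu> = ennreal (HK_real \<kappa> \<Omega> \<mu> \<nu>)" by (simp add: HK_real_def)
  show "0 \<le> HK_real \<kappa> \<Omega> \<mu> \<nu>" by (simp add: HK_real_def)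
  show "HK_real \<kappa> \<Omega> \<mu> \<nu> \<le> measure \<mu> \<Omega> + measure \<nu> \<Omega>"
    using enn2real_mono[OF le] by (simp add: HK_real_def del: ennreal_plus)
qed

text \<open>This serves two purposes: it makes the integrand of the functional Borel measurable, and
  it turns the integrand into a test function for weak* convergence of the
  \<open>\<Lambda>s\<close>.\<close>

lemma continuous_map_HK_real:
  fixes \<Omega> :: "'a::euclidean_space set"
  assumes \<Omega>: "compact \<Omega>" and \<kappa>: "\<kappa> > 0" and \<nu>: "\<nu> \<in> nonneg_measures (top_of_set \<Omega>)"
  shows "continuous_map (mass_ball_topology \<Omega> M) euclideanreal (\<lambda>\<mu>. HK_real \<kappa> \<Omega> \<mu> \<nu>)"
  unfolding continuous_map_def
proof (intro conjI allI impI)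
  let ?X = "mass_ball_topology \<Omega> M"
  fix V :: "real set" assume "openin euclideanreal V"
  then have V: "open V" by simp
  show "openin ?X {\<mu> \<in> topspace ?X. HK_real \<kappa> \<Omega> \<mu> \<nu> \<in> V}"
  proof (subst openin_subopen, safe)
    fix \<mu>0 assume \<mu>0: "\<mu>0 \<in> topspace ?X" "HK_real \<kappa> \<Omega> \<mu>0 \<nu> \<in> V"
    \<comment> \<open>\<nu> may be heavier than \<open>M\<close>, so the uniform estimate is applied
      in a ball that contains both arguments. The absolute value makes its radius non-negative
      whatever the sign of \<open>M\<close>.\<close>
    define M' where "M' = max \<bar>M\<bar> (measure \<nu> \<Omega>)"
    have ball: "mass_ball \<Omega> M \<subseteq> mass_ball \<Omega> M'" by (rule mass_ball_mono) (auto simp: M'_def)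
    have \<nu>M': "\<nu> \<in> mass_ball \<Omega> M'" using \<nu> by (simp add: mass_ball_def M'_def)
    have M': "M' \<ge> 0" by (simp add: M'_def)
    obtain e where e: "e > 0" "\<And>t. \<bar>t - HK_real \<kappa> \<Omega> \<mu>0 \<nu>\<bar> \<le> e \<Longrightarrow> t \<in> V"
    proof -
      obtain e where "e > 0" "cball (HK_real \<kappa> \<Omega> \<mu>0 \<nu>) e \<subseteq> V"
        using V \<mu>0(2) unfolding open_contains_cball by blast
      then show ?thesis
        by (intro that[of e]) (auto simp: subset_iff dist_real_def abs_minus_commute)
    qed
    have \<mu>0': "\<mu>0 \<in> mass_ball \<Omega> M'" using \<mu>0 ball by auto
    obtain U where U: "openin (weak_star (top_of_set \<Omega>)) U" "\<mu>0 \<in> U"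
      and U1: "\<forall>\<nu>'\<in>U \<inter> mass_ball \<Omega> M'. \<forall>\<mu>\<in>mass_ball \<Omega> M'. HK_sq \<kappa> \<Omega> \<mu> \<mu>0 \<le> HK_sq \<kappa> \<Omega> \<mu> \<nu>' + ennreal e"
      and U2: "\<forall>\<nu>'\<in>U \<inter> mass_ball \<Omega> M'. \<forall>\<mu>\<in>mass_ball \<Omega> M'. HK_sq \<kappa> \<Omega> \<mu> \<nu>' \<le> HK_sq \<kappa> \<Omega> \<mu> \<mu>0 + ennreal e"
      using HK_neighbourhood[OF \<Omega> \<kappa> M' e(1) \<mu>0'] .
    have "HK_real \<kappa> \<Omega> \<mu> \<nu> \<in> V" if \<mu>: "\<mu> \<in> U" "\<mu> \<in> mass_ball \<Omega> M" for \<mu>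
    proof (rule e(2))
      have \<mu>': "\<mu> \<in> mass_ball \<Omega> M'" using \<mu> ball by auto
      have "HK_sq \<kappa> \<Omega> \<nu> \<mu>0 \<le> HK_sq \<kappa> \<Omega> \<nu> \<mu> + ennreal e" "HK_sq \<kappa> \<Omega> \<nu> \<mu> \<le> HK_sq \<kappa> \<Omega> \<nu> \<mu>0 + ennreal e"
        using U1 U2 \<mu>(1) \<mu>' \<nu>M' by auto
      then have *: "HK_sq \<kappa> \<Omega> \<mu>0 \<nu> \<le> HK_sq \<kappa> \<Omega> \<mu> \<nu> + ennreal e" "HK_sq \<kappa> \<Omega> \<mu> \<nu> \<le> HK_sq \<kappa> \<Omega> \<mu>0 \<nu> + ennreal e"
        using HK_sq_commute[of \<Omega> \<kappa> \<nu>] \<Omega> by (auto simp: borel_compact)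
      have "HK_real \<kappa> \<Omega> \<mu>0 \<nu> \<le> HK_real \<kappa> \<Omega> \<mu> \<nu> + e" "HK_real \<kappa> \<Omega> \<mu> \<nu> \<le> HK_real \<kappa> \<Omega> \<mu>0 \<nu> + e"
        using * e(1) HK_sq_eq_real[OF \<Omega> mass_ball_D(1)[OF \<mu>'] \<nu>, of \<kappa>] HK_sq_eq_real[OF \<Omega> mass_ball_D(1)[OF \<mu>0'] \<nu>, of \<kappa>]
        by (simp_all flip: ennreal_plus)
      then show "\<bar>HK_real \<kappa> \<Omega> \<mu> \<nu> - HK_real \<kappa> \<Omega> \<mu>0 \<nu>\<bar> \<le> e" by linarith
    qed
    moreover have "openin ?X (U \<inter> mass_ball \<Omega> M)"
      using U(1) unfolding mass_ball_topology_def openin_subtopology by blast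
    ultimately show "\<exists>T. openin ?X T \<and> \<mu>0 \<in> T \<and> T \<subseteq> {\<mu> \<in> topspace ?X. HK_real \<kappa> \<Omega> \<mu> \<nu> \<in> V}"
      using U(2) \<mu>0 by (intro exI[of _ "U \<inter> mass_ball \<Omega> M"]) auto
  qed
qed auto

lemma prob_measures_D:
  assumes "\<Lambda> \<in> prob_measures X"
  shows "sets \<Lambda> = sets (borel_of X)" "prob_space \<Lambda>" "space \<Lambda> = topspace X"
  using assms sets_eq_imp_space_eq[of \<Lambda> "borel_of X"]
  by (auto simp: prob_measures_def nonneg_measures_def)

lemma HK_functional_eq_integral:
  fixes \<Omega> :: "'a::euclidean_space set"
  assumes \<Omega>: "compact \<Omega>" and \<kappa>: "\<kappa> > 0" and \<nu>: "\<nu> \<in> nonneg_measures (top_of_set \<Omega>)"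
    and \<Lambda>: "\<Lambda> \<in> prob_measures (mass_ball_topology \<Omega> M)"
  shows "integrable \<Lambda> (\<lambda>\<mu>. HK_real \<kappa> \<Omega> \<mu> \<nu>)"
    and "HK_functional \<kappa> \<Omega> \<Lambda> \<nu> = ennreal (\<integral>\<mu>. HK_real \<kappa> \<Omega> \<mu> \<nu> \<partial>\<Lambda>)"
    and "0 \<le> (\<integral>\<mu>. HK_real \<kappa> \<Omega> \<mu> \<nu> \<partial>\<Lambda>)"
proof -
  note P = prob_measures_D[OF \<Lambda>]
  interpret prob_space \<Lambda> by (rule P)
  have bound: "0 \<le> HK_real \<kappa> \<Omega> \<mu> \<nu>" "HK_real \<kappa> \<Omega> \<mu> \<nu> \<le> M + measure \<nu> \<Omega>" if "\<mu> \<in> space \<Lambda>" for \<mu>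
    using HK_sq_eq_real[OF \<Omega> _ \<nu>, of \<mu> \<kappa>] that by (auto simp: P mass_ball_def)
  have m: "(\<lambda>\<mu>. HK_real \<kappa> \<Omega> \<mu> \<nu>) \<in> borel_measurable \<Lambda>"
    using measurable_borel_of_continuous_map[OF continuous_map_HK_real[OF \<Omega> \<kappa> \<nu>, of M]]
    by (simp add: measurable_cong_sets[OF P(1) refl])
  show int: "integrable \<Lambda> (\<lambda>\<mu>. HK_real \<kappa> \<Omega> \<mu> \<nu>)"
    by (rule integrable_const_bound[of _ "M + measure \<nu> \<Omega>"]) (use bound m in auto)
  have "HK_functional \<kappa> \<Omega> \<Lambda> \<nu> = (\<integral>\<^sup>+\<mu>. ennreal (HK_real \<kappa> \<Omega> \<mu> \<nu>) \<partial>\<Lambda>)"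
    unfolding HK_functional_def
    by (intro nn_integral_cong HK_sq_eq_real[OF \<Omega> _ \<nu>]) (auto simp: P mass_ball_def)
  also have "\<dots> = ennreal (\<integral>\<mu>. HK_real \<kappa> \<Omega> \<mu> \<nu> \<partial>\<Lambda>)"
    using int bound by (intro nn_integral_eq_integral) auto
  finally show "HK_functional \<kappa> \<Omega> \<Lambda> \<nu> = ennreal (\<integral>\<mu>. HK_real \<kappa> \<Omega> \<mu> \<nu> \<partial>\<Lambda>)" .
  show "0 \<le> (\<integral>\<mu>. HK_real \<kappa> \<Omega> \<mu> \<nu> \<partial>\<Lambda>)" using bound by (intro integral_nonneg_AE) auto
qed

lemma HK_minimizer_iff:
  fixes \<Omega> :: "'a::euclidean_space set"
  assumes \<Omega>: "compact \<Omega>" and \<kappa>: "\<kappa> > 0" and \<Lambda>: "\<Lambda> \<in> prob_measures (mass_ball_topology \<Omega> M)"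
  shows "HK_minimizer \<kappa> \<Omega> \<Lambda> \<nu> \<longleftrightarrow> \<nu> \<in> nonneg_measures (top_of_set \<Omega>) \<and>
    (\<forall>\<nu>' \<in> nonneg_measures (top_of_set \<Omega>). (\<integral>\<mu>. HK_real \<kappa> \<Omega> \<mu> \<nu> \<partial>\<Lambda>) \<le> (\<integral>\<mu>. HK_real \<kappa> \<Omega> \<mu> \<nu>' \<partial>\<Lambda>))"
  unfolding HK_minimizer_def using HK_functional_eq_integral[OF \<Omega> \<kappa> _ \<Lambda>] by auto

section \<open>The mass of a minimizer\<close>

text \<open>The scaled density is \<open>s / t * f\<close>, and
  \<open>t * KL_fun (s / t * f x)\<close> expands into
  \<open>s * KL_fun (f x) + s * ln (s / t) * f x + (t - s)\<close>. The sign of \<open>k\<close> is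
  recorded because \<open>ennreal\<close> would truncate a negative value, and such values are added
  later.\<close>

lemma KL_scale:
  assumes fin: "finite_measure \<mu>" "finite_measure \<alpha>" "sets \<alpha> = sets \<mu>" "KL \<alpha> \<mu> < \<infinity>"
    and st: "s > 0" "t > 0"
  defines "k \<equiv> s * enn2real (KL \<alpha> \<mu>) + s * ln (s / t) * measure \<alpha> (space \<alpha>) + (t - s) * measure \<mu> (space \<mu>)"
  shows "KL (scale_measure (ennreal s) \<alpha>) (scale_measure (ennreal t) \<mu>) = ennreal k" and "k \<ge> 0"
proof -
  interpret finite_measure \<mu> by fact
  obtain f where f [measurable]: "f \<in> borel_measurable \<mu>" and f0: "\<And>x. 0 \<le> f x"
    and \<alpha>: "\<alpha> = density \<mu> (\<lambda>x. ennreal (f x))"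
    using KL_finite_density[OF fin] by metis
  have KL: "KL \<alpha> \<mu> = (\<integral>\<^sup>+x. ennreal (KL_fun (f x)) \<partial>\<mu>)"
    unfolding \<alpha> by (rule KL_density_eq) (use fin f0 in auto)
  have m\<alpha>: "(\<integral>\<^sup>+x. ennreal (f x) \<partial>\<mu>) = emeasure \<alpha> (space \<alpha>)"
    by (simp add: \<alpha> emeasure_density cong: nn_integral_cong)
  have intf: "integrable \<mu> f"
    using f0 finite_measure.emeasure_finite[OF fin(2)]
    by (intro integrableI_nonneg) (auto simp: m\<alpha> top.not_eq_extremum)
  have intK: "integrable \<mu> (\<lambda>x. KL_fun (f x))"
    using fin(4) f0 by (intro integrableI_nonneg) (auto simp: KL KL_fun_nonneg)
  have If: "(\<integral>x. f x \<partial>\<mu>) = measure \<alpha> (space \<alpha>)"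
    using m\<alpha> f0 by (simp add: integral_eq_nn_integral measure_def)
  have IK: "(\<integral>x. KL_fun (f x) \<partial>\<mu>) = enn2real (KL \<alpha> \<mu>)"
    using f0 by (simp add: integral_eq_nn_integral KL KL_fun_nonneg)
  have scaled: "scale_measure (ennreal s) \<alpha> = density (scale_measure (ennreal t) \<mu>) (\<lambda>x. ennreal (s / t * f x))"
  proof (rule measure_eqI)
    fix A assume "A \<in> sets (scale_measure (ennreal s) \<alpha>)"
    then have [measurable]: "A \<in> sets \<mu>" by (simp add: fin)
    have "emeasure (density (scale_measure (ennreal t) \<mu>) (\<lambda>x. ennreal (s / t * f x))) A
        = ennreal t * (\<integral>\<^sup>+x. ennreal (s / t * f x) * indicator A x \<partial>\<mu>)"
      by (subst emeasure_density) (auto simp: nn_integral_scale_measure)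
    also have "\<dots> = (\<integral>\<^sup>+x. ennreal t * (ennreal (s / t * f x) * indicator A x) \<partial>\<mu>)"
      by (simp add: nn_integral_cmult)
    also have "\<dots> = (\<integral>\<^sup>+x. ennreal s * (ennreal (f x) * indicator A x) \<partial>\<mu>)"
      using st f0 by (intro nn_integral_cong) (simp add: indicator_def flip: ennreal_mult)
    also have "\<dots> = ennreal s * emeasure \<alpha> A"
      by (simp add: \<alpha> emeasure_density nn_integral_cmult)
    finally show "emeasure (scale_measure (ennreal s) \<alpha>) A
      = emeasure (density (scale_measure (ennreal t) \<mu>) (\<lambda>x. ennreal (s / t * f x))) A" by simp
  qed (simp add: fin)
  have id: "t * KL_fun (s / t * f x) = s * KL_fun (f x) + s * ln (s / t) * f x + (t - s)" for x
  proof (cases "f x = 0")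
    case False
    then have "f x > 0" using f0[of x] by simp
    then have "ln (s / t * f x) = ln (s / t) + ln (f x)" using st by (subst ln_mult) auto
    then show ?thesis using st by (simp add: KL_fun_eq field_simps)
  qed (simp add: KL_fun_def)
  have "KL (scale_measure (ennreal s) \<alpha>) (scale_measure (ennreal t) \<mu>)
      = (\<integral>\<^sup>+x. ennreal (KL_fun (s / t * f x)) \<partial>scale_measure (ennreal t) \<mu>)"
    unfolding scaled using st f0
    by (intro KL_density_eq) (auto intro!: finite_measureI simp: ennreal_mult_eq_top_iff)
  also have "\<dots> = ennreal t * (\<integral>\<^sup>+x. ennreal (KL_fun (s / t * f x)) \<partial>\<mu>)"
    by (simp add: nn_integral_scale_measure)
  also have "\<dots> = (\<integral>\<^sup>+x. ennreal (t * KL_fun (s / t * f x)) \<partial>\<mu>)"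
    using st f0 by (simp add: ennreal_mult KL_fun_nonneg flip: nn_integral_cmult)
  also have "\<dots> = ennreal (\<integral>x. t * KL_fun (s / t * f x) \<partial>\<mu>)"
  proof (rule nn_integral_eq_integral)
    show "integrable \<mu> (\<lambda>x. t * KL_fun (s / t * f x))" unfolding id using intf intK by auto
  qed (use st f0 in \<open>auto simp: KL_fun_nonneg\<close>)
  also have I: "(\<integral>x. t * KL_fun (s / t * f x) \<partial>\<mu>) = k"
    unfolding id using intf intK by (simp add: If IK k_def)
  finally show "KL (scale_measure (ennreal s) \<alpha>) (scale_measure (ennreal t) \<mu>) = ennreal k" .
  show "k \<ge> 0" unfolding I[symmetric] using st f0 by (auto intro!: integral_nonneg_AE simp: KL_fun_nonneg)
qed

lemma scale_nonneg_measures: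
  "\<mu> \<in> nonneg_measures X \<Longrightarrow> scale_measure (ennreal s) \<mu> \<in> nonneg_measures X"
  unfolding nonneg_measures_def
  by (auto intro!: finite_measureI simp: ennreal_mult_eq_top_iff finite_measure.emeasure_finite)

lemma distr_scale_measure:
  assumes "f \<in> measurable M N"
  shows "distr (scale_measure r M) N f = scale_measure r (distr M N f)"
proof (rule measure_eqI)
  fix A assume A: "A \<in> sets (distr (scale_measure r M) N f)"
  moreover have "f \<in> measurable (scale_measure r M) N" using assms by simp
  ultimately show "emeasure (distr (scale_measure r M) N f) A = emeasure (scale_measure r (distr M N f)) A"
    using assms by (simp add: emeasure_distr space_scale_measure)
qed simp

text \<open>The competitor is \<open>s \<gamma>\<close>: its two marginals are compared with \<open>\<mu>\<close> and \<open>s\<^sup>2 \<nu>\<close>, so the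
  terms containing \<open>ln s\<close> cancel.\<close>

lemma HK_sq_scale:
  fixes \<Omega> :: "'a::euclidean_space set"
  assumes \<Omega>: "compact \<Omega>" and \<mu>: "\<mu> \<in> nonneg_measures (top_of_set \<Omega>)" and \<nu>: "\<nu> \<in> nonneg_measures (top_of_set \<Omega>)"
    and s: "s > 0"
  shows "HK_real \<kappa> \<Omega> \<mu> (scale_measure (ennreal (s\<^sup>2)) \<nu>)
    \<le> s * HK_real \<kappa> \<Omega> \<mu> \<nu> + (1 - s) * measure \<mu> \<Omega> + (s\<^sup>2 - s) * measure \<nu> \<Omega>"
proof -
  let ?N = "borel_of (top_of_set \<Omega>)"
  have \<Omega>b: "\<Omega> \<in> sets borel" using \<Omega> by (simp add: borel_compact)
  define \<nu>s where "\<nu>s = scale_measure (ennreal (s\<^sup>2)) \<nu>"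
  have \<nu>s: "\<nu>s \<in> nonneg_measures (top_of_set \<Omega>)" unfolding \<nu>s_def by (rule scale_nonneg_measures[OF \<nu>])
  define m where "m = (1 - s) * measure \<mu> \<Omega> + (s\<^sup>2 - s) * measure \<nu> \<Omega>"
  note R = HK_sq_eq_real[OF \<Omega> \<mu> \<nu>s, of \<kappa>] HK_sq_eq_real[OF \<Omega> \<mu> \<nu>, of \<kappa>]
  have f\<mu>: "finite_measure \<mu>" "sets \<mu> = sets ?N" and f\<nu>: "finite_measure \<nu>" "sets \<nu> = sets ?N"
    using \<mu> \<nu> by (auto simp: nonneg_measures_def)
  have sp: "space \<mu> = \<Omega>" "space \<nu> = \<Omega>"
    using f\<mu> f\<nu> sets_eq_imp_space_eq[of \<mu> ?N] sets_eq_imp_space_eq[of \<nu> ?N] by auto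
  \<comment> \<open>The claim is solved for the distance of \<mu> and \<nu>. It thus becomes a lower
    bound of the infimum and can be checked plan by plan.\<close>
  have "ennreal ((HK_real \<kappa> \<Omega> \<mu> \<nu>s - m) / s) \<le> HK_sq \<kappa> \<Omega> \<mu> \<nu>"
    unfolding HK_sq_def
  proof (rule INF_greatest)
    fix \<gamma> assume \<gamma>: "\<gamma> \<in> nonneg_measures (top_of_set (\<Omega> \<times> \<Omega>))"
    then have s\<gamma> [measurable_cong]: "sets \<gamma> = sets (?N \<Otimes>\<^sub>M ?N)" and f\<gamma>: "finite_measure \<gamma>"
      using \<Omega>b by (auto simp: nonneg_measures_def sets_borel_of_prod)
    have sp\<gamma>: "space \<gamma> = \<Omega> \<times> \<Omega>" using sets_eq_imp_space_eq[OF s\<gamma>] by (simp add: space_pair_measure)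
    have m1 [measurable]: "fst \<in> measurable \<gamma> ?N" and m2 [measurable]: "snd \<in> measurable \<gamma> ?N" by measurable
    have [measurable]: "(\<lambda>(x, y). HK_cost \<kappa> x y) \<in> borel_measurable (?N \<Otimes>\<^sub>M ?N)"
      using measurable_HK_cost[of \<kappa> \<Omega>] by (simp add: case_prod_unfold)
    define C where "C = (\<integral>\<^sup>+ (x, y). HK_cost \<kappa> x y \<partial>\<gamma>)"
    define \<alpha> where "\<alpha> = distr \<gamma> ?N fst"
    define \<beta> where "\<beta> = distr \<gamma> ?N snd"
    have f\<alpha>: "finite_measure \<alpha>" "sets \<alpha> = sets \<mu>" and f\<beta>: "finite_measure \<beta>" "sets \<beta> = sets \<nu>"
      using f\<gamma> f\<mu> f\<nu> by (auto simp: \<alpha>_def \<beta>_def intro: finite_measure.finite_measure_distr)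
    have "ennreal ((HK_real \<kappa> \<Omega> \<mu> \<nu>s - m) / s) \<le> C + KL \<alpha> \<mu> + KL \<beta> \<nu>"
    proof (cases "C + KL \<alpha> \<mu> + KL \<beta> \<nu> < \<infinity>")
      case True
      then have fin: "C < \<infinity>" "KL \<alpha> \<mu> < \<infinity>" "KL \<beta> \<nu> < \<infinity>" by auto
      define c where "c = enn2real C"
      have C: "C = ennreal c" "c \<ge> 0" using fin by (auto simp: c_def)
      define a where "a = enn2real (KL \<alpha> \<mu>)"
      have a: "KL \<alpha> \<mu> = ennreal a" "a \<ge> 0" using fin by (auto simp: a_def)
      define b where "b = enn2real (KL \<beta> \<nu>)"
      have b: "KL \<beta> \<nu> = ennreal b" "b \<ge> 0" using fin by (auto simp: b_def)
      \<comment> \<open>Both marginals carry the mass of \<gamma>; with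
        \<open>ln (s / s\<^sup>2) = - ln s\<close> this makes the two logarithmic terms
        opposite.\<close>
      have mass: "measure \<alpha> (space \<alpha>) = measure \<gamma> (space \<gamma>)" "measure \<beta> (space \<beta>) = measure \<gamma> (space \<gamma>)"
      proof -
        have "fst -` \<Omega> \<inter> space \<gamma> = space \<gamma>" "snd -` \<Omega> \<inter> space \<gamma> = space \<gamma>" "\<Omega> \<in> sets ?N"
          using sets.top[of ?N] by (auto simp: sp\<gamma>)
        then show "measure \<alpha> (space \<alpha>) = measure \<gamma> (space \<gamma>)" "measure \<beta> (space \<beta>) = measure \<gamma> (space \<gamma>)"
          by (simp_all add: \<alpha>_def \<beta>_def measure_distr)
      qed
      define g where "g = measure \<gamma> (space \<gamma>)"
      note K1 = KL_scale[OF f\<mu>(1) f\<alpha> fin(2) s zero_less_one, unfolded mass sp, folded a_def g_def]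
      note K2 = KL_scale[OF f\<nu>(1) f\<beta> fin(3) s, of "s\<^sup>2", unfolded mass sp, folded b_def g_def]
      have s2: "s\<^sup>2 > 0" using s by simp
      have ln: "ln (s / s\<^sup>2) = - ln s" using s by (simp add: ln_div ln_realpow)
      define \<gamma>s where "\<gamma>s = scale_measure (ennreal s) \<gamma>"
      have "HK_sq \<kappa> \<Omega> \<mu> \<nu>s \<le> (\<integral>\<^sup>+ (x, y). HK_cost \<kappa> x y \<partial>\<gamma>s) + KL (distr \<gamma>s ?N fst) \<mu> + KL (distr \<gamma>s ?N snd) \<nu>s"
        unfolding \<gamma>s_def by (rule HK_sq_le[OF scale_nonneg_measures[OF \<gamma>]])
      also have "(\<integral>\<^sup>+ (x, y). HK_cost \<kappa> x y \<partial>\<gamma>s) = ennreal (s * c)"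
        using s C unfolding \<gamma>s_def by (simp add: nn_integral_scale_measure ennreal_mult flip: C_def)
      also have "KL (distr \<gamma>s ?N fst) \<mu> = ennreal (s * a + s * ln (s / 1) * g + (1 - s) * measure \<mu> \<Omega>)"
        using K1(1) by (simp add: \<gamma>s_def distr_scale_measure \<alpha>_def[symmetric])
      also have "KL (distr \<gamma>s ?N snd) \<nu>s = ennreal (s * b + s * ln (s / s\<^sup>2) * g + (s\<^sup>2 - s) * measure \<nu> \<Omega>)"
        using K2(1)[OF s2] by (simp add: \<gamma>s_def \<nu>s_def distr_scale_measure \<beta>_def[symmetric])
      also have "ennreal (s * c) + ennreal (s * a + s * ln (s / 1) * g + (1 - s) * measure \<mu> \<Omega>)
          + ennreal (s * b + s * ln (s / s\<^sup>2) * g + (s\<^sup>2 - s) * measure \<nu> \<Omega>)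
          = ennreal (s * c + (s * a + s * ln (s / 1) * g + (1 - s) * measure \<mu> \<Omega>)
          + (s * b + s * ln (s / s\<^sup>2) * g + (s\<^sup>2 - s) * measure \<nu> \<Omega>))"
        using K1(2) K2(2)[OF s2] s C by (simp only: ennreal_plus add_nonneg_nonneg mult_nonneg_nonneg less_imp_le)
      also have sum_eq: "s * c + (s * a + s * ln (s / 1) * g + (1 - s) * measure \<mu> \<Omega>)
          + (s * b + s * ln (s / s\<^sup>2) * g + (s\<^sup>2 - s) * measure \<nu> \<Omega>) = s * (c + a + b) + m"
        unfolding ln m_def by (simp add: algebra_simps)
      finally have le: "ennreal (HK_real \<kappa> \<Omega> \<mu> \<nu>s) \<le> ennreal (s * (c + a + b) + m)"
        by (simp add: R(1))
      moreover have "0 \<le> s * (c + a + b) + m"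
      proof -
        have "0 \<le> s * c + (s * a + s * ln (s / 1) * g + (1 - s) * measure \<mu> \<Omega>)
          + (s * b + s * ln (s / s\<^sup>2) * g + (s\<^sup>2 - s) * measure \<nu> \<Omega>)"
          by (rule add_nonneg_nonneg[OF add_nonneg_nonneg[OF _ K1(2)] K2(2)[OF s2]]) (use s C in simp)
        then show ?thesis by (simp only: sum_eq)
      qed
      ultimately have "HK_real \<kappa> \<Omega> \<mu> \<nu>s \<le> s * (c + a + b) + m"
        by (simp only: ennreal_le_iff)
      then have "(HK_real \<kappa> \<Omega> \<mu> \<nu>s - m) / s \<le> c + a + b" using s by (simp add: field_simps)
      then have "ennreal ((HK_real \<kappa> \<Omega> \<mu> \<nu>s - m) / s) \<le> ennreal (c + a + b)" by (rule ennreal_leI)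
      then show ?thesis using C a b by simp
    qed (auto simp: not_less top_unique)
    then show "ennreal ((HK_real \<kappa> \<Omega> \<mu> \<nu>s - m) / s)
      \<le> (\<integral>\<^sup>+ (x, y). HK_cost \<kappa> x y \<partial>\<gamma>) + KL (distr \<gamma> ?N fst) \<mu> + KL (distr \<gamma> ?N snd) \<nu>"
      by (simp add: C_def \<alpha>_def \<beta>_def)
  qed
  then have "(HK_real \<kappa> \<Omega> \<mu> \<nu>s - m) / s \<le> HK_real \<kappa> \<Omega> \<mu> \<nu>"
    using R(4,5) by (simp add: ennreal_le_iff)
  then show ?thesis using s by (simp add: field_simps m_def \<nu>s_def)
qed

text \<open>Integrating \<open>HK_sq_scale\<close> against \<Lambda> and comparing with the minimal
  value \<open>j\<close> gives
  \<open>(1 - s) * (j + s * measure \<nu> \<Omega>) \<le> (1 - s) * M\<close>. The factor cancels,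
  \<open>j\<close> is non-negative, and \<open>s\<close> is arbitrary in the unit interval.\<close>

lemma HK_minimizer_mass:
  fixes \<Omega> :: "'a::euclidean_space set"
  assumes \<Omega>: "compact \<Omega>" and \<kappa>: "\<kappa> > 0" and \<Lambda>: "\<Lambda> \<in> prob_measures (mass_ball_topology \<Omega> M)"
    and min: "HK_minimizer \<kappa> \<Omega> \<Lambda> \<nu>"
  shows "\<nu> \<in> mass_ball \<Omega> M"
proof -
  note P = prob_measures_D[OF \<Lambda>]
  interpret prob_space \<Lambda> by (rule P)
  have \<nu>: "\<nu> \<in> nonneg_measures (top_of_set \<Omega>)" using min by (simp add: HK_minimizer_def)
  define j where "j = (\<integral>\<mu>. HK_real \<kappa> \<Omega> \<mu> \<nu> \<partial>\<Lambda>)"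
  note I = HK_functional_eq_integral[OF \<Omega> \<kappa> \<nu> \<Lambda>, folded j_def]
  have "s * measure \<nu> \<Omega> \<le> M" if s: "0 < s" "s < 1" for s
  proof -
    define \<nu>s where "\<nu>s = scale_measure (ennreal (s\<^sup>2)) \<nu>"
    have \<nu>s: "\<nu>s \<in> nonneg_measures (top_of_set \<Omega>)" unfolding \<nu>s_def by (rule scale_nonneg_measures[OF \<nu>])
    have "j \<le> (\<integral>\<mu>. HK_real \<kappa> \<Omega> \<mu> \<nu>s \<partial>\<Lambda>)"
      using min \<nu>s unfolding HK_minimizer_iff[OF \<Omega> \<kappa> \<Lambda>] j_def by blast
    also have "\<dots> \<le> (\<integral>\<mu>. s * HK_real \<kappa> \<Omega> \<mu> \<nu> + ((1 - s) * M + (s\<^sup>2 - s) * measure \<nu> \<Omega>) \<partial>\<Lambda>)"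
    proof (rule integral_mono)
      fix \<mu> assume "\<mu> \<in> space \<Lambda>"
      then have \<mu>: "\<mu> \<in> nonneg_measures (top_of_set \<Omega>)" "measure \<mu> \<Omega> \<le> M" by (auto simp: P mass_ball_def)
      have "(1 - s) * measure \<mu> \<Omega> \<le> (1 - s) * M" using \<mu> s by (intro mult_left_mono) auto
      then show "HK_real \<kappa> \<Omega> \<mu> \<nu>s \<le> s * HK_real \<kappa> \<Omega> \<mu> \<nu> + ((1 - s) * M + (s\<^sup>2 - s) * measure \<nu> \<Omega>)"
        using HK_sq_scale[OF \<Omega> \<mu>(1) \<nu> s(1), of \<kappa>, folded \<nu>s_def] by linarith
    qed (use I HK_functional_eq_integral[OF \<Omega> \<kappa> \<nu>s \<Lambda>] in auto)
    also have "\<dots> = s * j + ((1 - s) * M + (s\<^sup>2 - s) * measure \<nu> \<Omega>)"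
      using I by (simp add: j_def prob_space)
    also have "(s\<^sup>2 - s) * measure \<nu> \<Omega> = - ((1 - s) * (s * measure \<nu> \<Omega>))"
      by (simp add: power2_eq_square left_diff_distrib)
    finally have "j - s * j + (1 - s) * (s * measure \<nu> \<Omega>) \<le> (1 - s) * M" by linarith
    moreover have "(1 - s) * (j + s * measure \<nu> \<Omega>) = j - s * j + (1 - s) * (s * measure \<nu> \<Omega>)"
      by (simp only: distrib_left left_diff_distrib mult_1)
    ultimately have "(1 - s) * (j + s * measure \<nu> \<Omega>) \<le> (1 - s) * M" by linarith
    moreover have "0 < 1 - s" using s by simp
    ultimately have "j + s * measure \<nu> \<Omega> \<le> M" by (simp only: mult_le_cancel_left_pos)
    then show ?thesis using I(3) by linarith
  qed
  then have "measure \<nu> \<Omega> \<le> M"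
    by (rule field_le_mult_one_interval)
  with \<nu> show ?thesis by (rule nonneg_measures_mass_ball)
qed

section \<open>Weak* compactness of the mass ball\<close>

definition digit_sum :: "(nat \<Rightarrow> real) \<Rightarrow> (nat \<Rightarrow> bool) \<Rightarrow> real" where
  "digit_sum a b = (\<Sum>i. of_bool (b i) * a i)"

lemma continuous_on_digit_sum:
  assumes "summable a" "\<And>i. a i \<ge> 0"
  shows "continuous_on S (digit_sum a)"
proof -
  have ul: "uniform_limit S (\<lambda>n b. \<Sum>i<n. of_bool (b i) * a i) (digit_sum a) sequentially"
    unfolding digit_sum_def[abs_def]
    by (rule Weierstrass_m_test[OF _ assms(1)]) (use assms(2) in \<open>simp add: of_bool_def\<close>)
  have cont: "continuous_on S (\<lambda>b. \<Sum>i<n. of_bool (b i) * a i)" for n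
  proof (intro continuous_intros)
    fix i :: nat
    have "continuous_on S (\<lambda>b. b i :: bool)"
      by (rule continuous_on_product_then_coordinatewise) (rule continuous_on_id)
    from continuous_on_compose2[OF Topological_Spaces.continuous_on_discrete[of UNIV "of_bool :: bool \<Rightarrow> real"] this subset_UNIV]
    show "continuous_on S (\<lambda>b. of_bool (b i) :: real)" .
  qed
  show ?thesis
    by (rule uniform_limit_theorem[OF always_eventually[OF allI[OF cont]] ul]) simp
qed

lemma summable_digits: "summable a \<Longrightarrow> (\<And>i. a i \<ge> 0) \<Longrightarrow> summable (\<lambda>i. of_bool (b i) * (a i :: real))"
  by (rule summable_comparison_test[of _ a]) (auto simp: of_bool_def)

text \<open>Base 3 with digits 0 and 2: the range is the Cantor set, and its gaps make expansions
  unique.\<close>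

abbreviation cantor :: "(nat \<Rightarrow> bool) \<Rightarrow> real" where
  "cantor \<equiv> digit_sum (\<lambda>i. 2 / 3 ^ Suc i)"

text \<open>Base 2 reaches every point of the interval, at the price of ambiguous
  expansions.\<close>

abbreviation binary :: "(nat \<Rightarrow> bool) \<Rightarrow> real" where
  "binary \<equiv> digit_sum (\<lambda>i. 1 / 2 ^ Suc i)"

lemma summable_cantor: "summable (\<lambda>i. 2 / 3 ^ Suc i :: real)"
  using summable_mult[OF summable_geometric[of "1/3 :: real"], of "2/3"] by (simp add: power_divide)

lemma summable_binary: "summable (\<lambda>i. 1 / 2 ^ Suc i :: real)"
  using power_half_series by (simp add: power_divide sums_iff)

lemma cantor_Suc: "cantor b = of_bool (b 0) * (2 / 3) + cantor (b \<circ> Suc) / 3"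
proof -
  have s: "summable (\<lambda>i. of_bool (b i) * (2 / 3 ^ Suc i :: real))"
    by (rule summable_digits[OF summable_cantor]) simp
  have s': "summable (\<lambda>i. of_bool ((b \<circ> Suc) i) * (2 / 3 ^ Suc i :: real))"
    by (rule summable_digits[OF summable_cantor]) simp
  have "cantor b = (\<Sum>i. of_bool (b (Suc i)) * (2 / 3 ^ Suc (Suc i))) + of_bool (b 0) * (2 / 3)"
    unfolding digit_sum_def using suminf_split_head[OF s] by simp
  also have "(\<Sum>i. of_bool (b (Suc i)) * (2 / 3 ^ Suc (Suc i))) = (\<Sum>i. (of_bool ((b \<circ> Suc) i) * (2 / 3 ^ Suc i)) / 3 :: real)"
    by (intro suminf_cong) simp
  also have "\<dots> = cantor (b \<circ> Suc) / 3"
    unfolding digit_sum_def by (rule suminf_divide[OF s'])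
  finally show ?thesis by simp
qed

lemma cantor_bounds: "0 \<le> cantor b" "cantor b \<le> 1"
proof -
  have s: "summable (\<lambda>i. of_bool (b i) * (2 / 3 ^ Suc i :: real))"
    by (rule summable_digits[OF summable_cantor]) simp
  show "0 \<le> cantor b" unfolding digit_sum_def by (rule suminf_nonneg[OF s]) simp
  have "cantor b \<le> (\<Sum>i. 2 / 3 ^ Suc i)"
    unfolding digit_sum_def by (rule suminf_le[OF _ s summable_cantor]) (simp add: of_bool_def)
  also have "\<dots> = (\<Sum>i. 2 / 3 * (1 / 3) ^ i)" by (simp add: power_divide)
  also have "\<dots> = 1" by (subst suminf_mult) (auto simp: suminf_geometric)
  finally show "cantor b \<le> 1" .
qed

lemma inj_cantor: "inj cantor"
proof (rule injI)
  \<comment> \<open>By \<open>cantor_Suc\<close> a first digit 0 gives a value of at most 1/3 and a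
    first digit 2 a value of at least 2/3, so equal sums share the first digit and hence the sum of
    the tail.\<close>
  have head: "b 0 = b' 0 \<and> cantor (b \<circ> Suc) = cantor (b' \<circ> Suc)" if "cantor b = cantor b'" for b b'
    using that cantor_bounds[of "b \<circ> Suc"] cantor_bounds[of "b' \<circ> Suc"]
    unfolding cantor_Suc[of b] cantor_Suc[of b'] by (cases "b 0"; cases "b' 0") auto
  have "b i = b' i" if "cantor b = cantor b'" for b b' i
    using that
  proof (induction i arbitrary: b b')
    case 0 then show ?case using head by blast
  next
    case (Suc i)
    then have "(b \<circ> Suc) i = (b' \<circ> Suc) i" using head by blast
    then show ?case by simp
  qed
  then show "b = b'" if "cantor b = cantor b'" for b b' using that by blast
qed

lemma binary_surj:
  assumes "0 \<le> x" "x < 1"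
  obtains b where "binary b = x"
proof -
  \<comment> \<open>These digits make the partial sums equal to \<open>x\<close> rounded down to a
    multiple of \<open>1 / 2 ^ n\<close>; \<open>0 \<le> x < 1\<close> makes the empty sum
    correct.\<close>
  define b where "b = (\<lambda>i. odd \<lfloor>x * 2 ^ Suc i\<rfloor>)"
  have partial: "(\<Sum>i<n. of_bool (b i) * (1 / 2 ^ Suc i) :: real) = of_int \<lfloor>x * 2 ^ n\<rfloor> / 2 ^ n" for n
  proof (induction n)
    case 0
    have "\<lfloor>x\<rfloor> = 0" using assms by (simp add: floor_eq_iff)
    then show ?case by simp
  next
    case (Suc n)
    define k where "k = \<lfloor>x * 2 ^ Suc n\<rfloor>"
    have "\<lfloor>x * 2 ^ n\<rfloor> = \<lfloor>x * 2 ^ Suc n / of_int 2\<rfloor>" by simp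
    also have "\<dots> = k div 2" unfolding k_def by (rule floor_divide_real_eq_div) simp
    finally have "\<lfloor>x * 2 ^ n\<rfloor> = k div 2" .
    moreover have "real_of_int k = 2 * real_of_int (k div 2) + of_bool (odd k)"
    proof -
      have "k = 2 * (k div 2) + of_bool (odd k)" by (simp add: odd_iff_mod_2_eq_one of_bool_def) presburger
      then show ?thesis by (metis of_int_add of_int_mult of_int_numeral of_int_of_bool)
    qed
    moreover have "b n = odd k" by (simp only: b_def k_def)
    ultimately have "(\<Sum>i<Suc n. of_bool (b i) * (1 / 2 ^ Suc i) :: real)
        = of_int (k div 2) / 2 ^ n + of_bool (odd k) * (1 / 2 ^ Suc n)"
      by (simp only: sum.lessThan_Suc Suc.IH)
    also have "\<dots> = (2 * of_int (k div 2) + of_bool (odd k)) / 2 ^ Suc n"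
      by (simp add: field_simps)
    also have "\<dots> = of_int k / 2 ^ Suc n"
      using \<open>real_of_int k = 2 * real_of_int (k div 2) + of_bool (odd k)\<close> by simp
    finally show ?case unfolding k_def .
  qed
  have "(\<lambda>n. of_int \<lfloor>x * 2 ^ n\<rfloor> / 2 ^ n) \<longlonglongrightarrow> x"
  proof (rule tendsto_sandwich[of "\<lambda>n. x - 1 / 2 ^ n" _ _ "\<lambda>n. x"])
    show "\<forall>\<^sub>F n in sequentially. x - 1 / 2 ^ n \<le> of_int \<lfloor>x * 2 ^ n\<rfloor> / 2 ^ n"
    proof (rule always_eventually, rule allI)
      fix n
      have "x * 2 ^ n - 1 \<le> of_int \<lfloor>x * 2 ^ n\<rfloor>" by linarith
      then have "(x * 2 ^ n - 1) / 2 ^ n \<le> of_int \<lfloor>x * 2 ^ n\<rfloor> / 2 ^ n" by (rule divide_right_mono) simp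
      then show "x - 1 / 2 ^ n \<le> of_int \<lfloor>x * 2 ^ n\<rfloor> / 2 ^ n" by (simp add: diff_divide_distrib)
    qed
    show "\<forall>\<^sub>F n in sequentially. of_int \<lfloor>x * 2 ^ n\<rfloor> / 2 ^ n \<le> x"
      by (rule always_eventually) (simp add: divide_le_eq)
    have "(\<lambda>n. (1 / 2 :: real) ^ n) \<longlonglongrightarrow> 0" by (rule LIMSEQ_power_zero) simp
    from tendsto_diff[OF tendsto_const[of x] this] show "(\<lambda>n. x - 1 / 2 ^ n) \<longlonglongrightarrow> x" by (simp add: power_divide)
  qed simp
  then have "(\<lambda>i. of_bool (b i) * (1 / 2 ^ Suc i)) sums x"
    unfolding sums_def partial .
  then have "binary b = x" unfolding digit_sum_def by (rule sums_unique[symmetric])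
  then show ?thesis by (rule that)
qed

lemma compact_bool_sequences: "compact (UNIV :: (nat \<Rightarrow> bool) set)"
proof -
  have "compact_space (euclidean :: bool topology)"
    by (simp add: compact_space_def finite_imp_compact)
  then have "compact_space (product_topology (\<lambda>_. euclidean :: bool topology) (UNIV :: nat set))"
    by (subst compact_space_product_topology) auto
  then show ?thesis unfolding euclidean_product_topology by (simp add: compact_space_def)
qed

text \<open>The Hausdorff-Alexandroff construction: interleaving binary digits maps the Cantor set onto a cube.\<close>

lemma cantor_surjection:
  fixes \<Omega> :: "'a::euclidean_space set"
  assumes "bounded \<Omega>"
  obtains K :: "real set" and g :: "real \<Rightarrow> 'a" where "compact K" "continuous_on K g" "\<Omega> \<subseteq> g ` K"
proof -
  obtain R where R: "R > 0" "\<And>x. x \<in> \<Omega> \<Longrightarrow> norm x < R"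
    using assms unfolding bounded_pos_less by blast
  define ix where "ix = to_nat_on (Basis :: 'a set)"
  have ix: "inj_on ix Basis" unfolding ix_def by (intro inj_on_to_nat_on countable_finite) simp
  \<comment> \<open>\<open>prod_encode\<close> gives every coordinate a digit sequence of its own,
    and the affine map carries the unit interval to the interval from \<open>- R\<close> to
    \<open>R\<close>.\<close>
  define P where "P = (\<lambda>b. \<Sum>k\<in>Basis. (2 * R * binary (\<lambda>i. b (prod_encode (ix k, i))) - R) *\<^sub>R k :: 'a)"
  have contP: "continuous_on UNIV P"
    unfolding P_def
  proof (intro continuous_intros)
    fix k :: 'a
    have "continuous_on UNIV (\<lambda>b i. b (prod_encode (ix k, i)) :: bool)"
      by (rule continuous_on_coordinatewise_then_product, rule continuous_on_product_then_coordinatewise, rule continuous_on_id)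
    then show "continuous_on UNIV (\<lambda>b. binary (\<lambda>i. b (prod_encode (ix k, i))))"
      by (rule continuous_on_compose2[OF continuous_on_digit_sum[OF summable_binary, of UNIV], rotated]) auto
  qed
  have surj: "x \<in> range P" if "x \<in> \<Omega>" for x
  proof -
    have "\<exists>c. binary c = (x \<bullet> k + R) / (2 * R)" if "k \<in> Basis" for k
    proof -
      have "\<bar>x \<bullet> k\<bar> < R" using Basis_le_norm[OF that, of x] R(2)[OF \<open>x \<in> \<Omega>\<close>] by linarith
      then have "0 \<le> x \<bullet> k + R" "x \<bullet> k + R < 1 * (2 * R)" by linarith+
      then have "0 \<le> (x \<bullet> k + R) / (2 * R)" "(x \<bullet> k + R) / (2 * R) < 1"
        using R(1) by (simp_all only: pos_divide_less_eq zero_le_divide_iff) auto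
      then show ?thesis by (rule binary_surj) (rule exI)
    qed
    then obtain c where c: "\<And>k. k \<in> Basis \<Longrightarrow> binary (c k) = (x \<bullet> k + R) / (2 * R)" by metis
    define b where "b = (\<lambda>n. c (the_inv_into Basis ix (fst (prod_decode n))) (snd (prod_decode n)))"
    have "(\<lambda>i. b (prod_encode (ix k, i))) = c k" if "k \<in> Basis" for k
      using the_inv_into_f_f[OF ix that] by (simp add: b_def)
    then have "P b = (\<Sum>k\<in>Basis. (x \<bullet> k) *\<^sub>R k)"
      unfolding P_def using R c by (intro sum.cong) auto
    then show ?thesis by (simp add: euclidean_representation) (metis rangeI)
  qed
  have contC: "continuous_on UNIV cantor" by (rule continuous_on_digit_sum[OF summable_cantor]) simp
  show ?thesis
  proof (rule that)
    show "compact (range cantor)" by (rule compact_continuous_image[OF contC compact_bool_sequences])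
    \<comment> \<open>A continuous injection of a compact space into a Hausdorff space is a
      homeomorphism onto its image.\<close>
    have "continuous_on (range cantor) (inv cantor)"
      by (rule continuous_on_inv[OF contC compact_bool_sequences]) (use inj_cantor in auto)
    then show "continuous_on (range cantor) (P \<circ> inv cantor)"
      using contP by (intro continuous_on_compose) (auto intro: continuous_on_subset)
    show "\<Omega> \<subseteq> (P \<circ> inv cantor) ` range cantor"
      using surj inj_cantor by (auto simp: image_comp)
  qed
qed

text \<open>Dugundji's theorem extends the map from the Cantor set to the whole line; the
  closest-point projection, continuous as \<Omega> is convex, brings its values back to \<Omega> and
  fixes those already there. Test functions on \<Omega> thereby pull back to bounded continuous
  functions on the line.\<close>

lemma convex_compact_surjection:
  fixes \<Omega> :: "'a::euclidean_space set"
  assumes "compact \<Omega>" "convex \<Omega>" "\<Omega> \<noteq> {}"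
  obtains K :: "real set" and g :: "real \<Rightarrow> 'a" where "compact K" "continuous_on UNIV g" "range g \<subseteq> \<Omega>" "g ` K = \<Omega>"
proof -
  obtain K :: "real set" and g :: "real \<Rightarrow> 'a" where K: "compact K" and g: "continuous_on K g" "\<Omega> \<subseteq> g ` K"
    using cantor_surjection[OF compact_imp_bounded[OF assms(1)]] .
  have "closedin (top_of_set UNIV) K" using K by (simp add: compact_imp_closed)
  then have "\<exists>h. continuous_on UNIV h \<and> (\<forall>x\<in>K. h x = g x)"
    by (rule Dugundji[OF convex_UNIV UNIV_not_empty _ g(1) subset_UNIV]) (intro exI conjI ballI)
  then obtain h where h: "continuous_on UNIV h" "\<forall>x\<in>K. h x = g x" by blast
  have cl: "closed \<Omega>" using assms by (simp add: compact_imp_closed)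
  define f where "f = closest_point \<Omega> \<circ> h"
  show ?thesis
  proof (rule that[OF K])
    show "continuous_on UNIV f" unfolding f_def
      by (intro continuous_on_compose h continuous_on_closest_point assms cl)
    show "range f \<subseteq> \<Omega>" using closest_point_in_set[OF cl assms(3)] by (auto simp: f_def)
    show "f ` K = \<Omega>"
    proof
      show "f ` K \<subseteq> \<Omega>" using \<open>range f \<subseteq> \<Omega>\<close> by auto
      show "\<Omega> \<subseteq> f ` K"
      proof
        fix x assume x: "x \<in> \<Omega>"
        then obtain t where "t \<in> K" "x = g t" using g by auto
        then have "f t = x" using h(2) x by (simp add: f_def closest_point_self)
        with \<open>t \<in> K\<close> show "x \<in> f ` K" by blast
      qed
    qed
  qed
qed

text \<open>The section picks the smallest preimage in \<open>K\<close>. It is at most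
  \<open>a\<close> exactly on the image of the part of \<open>K\<close> up to \<open>a\<close>, a
  compact set, which yields measurability.\<close>

lemma measurable_section:
  fixes \<Omega> :: "'a::euclidean_space set" and g :: "real \<Rightarrow> 'a"
  assumes K: "compact K" and g: "continuous_on UNIV g" and surj: "g ` K = \<Omega>"
  obtains \<sigma> where "\<sigma> \<in> borel_measurable (borel_of (top_of_set \<Omega>))" "\<forall>x\<in>\<Omega>. \<sigma> x \<in> K \<and> g (\<sigma> x) = x"
proof -
  define F where "F = (\<lambda>x. {t \<in> K. g t = x})"
  have gK: "continuous_on K g" using g continuous_on_subset by blast
  have F: "compact (F x)" for x
  proof -
    have "closed (g -` {x})" using g by (simp add: continuous_closed_vimage continuous_on_eq_continuous_at)
    then have "compact (K \<inter> g -` {x})" using K by blast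
    moreover have "F x = K \<inter> g -` {x}" by (auto simp: F_def)
    ultimately show ?thesis by simp
  qed
  define \<sigma> where "\<sigma> = (\<lambda>x. Inf (F x))"
  have \<sigma>F: "\<sigma> x \<in> F x" if "x \<in> \<Omega>" for x
  proof -
    have "F x \<noteq> {}" using that surj by (auto simp: F_def)
    then show ?thesis unfolding \<sigma>_def
      by (intro closed_contains_Inf) (use F[of x] in \<open>auto simp: compact_imp_closed bounded_imp_bdd_below compact_imp_bounded\<close>)
  qed
  have le: "\<sigma> x \<le> t" if "t \<in> F x" for x t
    unfolding \<sigma>_def using that F[of x] by (intro cInf_lower) (auto simp: bounded_imp_bdd_below compact_imp_bounded)
  show ?thesis
  proof (rule that)
    show "\<sigma> \<in> borel_measurable (borel_of (top_of_set \<Omega>))"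
      unfolding borel_measurable_iff_le
    proof
      fix a
      have eq: "{x \<in> space (borel_of (top_of_set \<Omega>)). \<sigma> x \<le> a} = g ` (K \<inter> {..a})"
      proof safe
        fix x assume "x \<in> space (borel_of (top_of_set \<Omega>))" "\<sigma> x \<le> a"
        then have "\<sigma> x \<in> K \<inter> {..a}" "g (\<sigma> x) = x" using \<sigma>F[of x] by (auto simp: F_def)
        then show "x \<in> g ` (K \<inter> {..a})" by (metis imageI)
      next
        fix t assume t: "t \<in> K" "t \<le> a"
        then show "g t \<in> space (borel_of (top_of_set \<Omega>))" using surj by auto
        have "t \<in> F (g t)" using t by (simp add: F_def)
        then show "\<sigma> (g t) \<le> a" using le t order_trans by blast
      qed
      have "compact (g ` (K \<inter> {..a}))"
        using K gK by (intro compact_continuous_image) (auto intro: continuous_on_subset)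
      then have "g ` (K \<inter> {..a}) \<in> sets borel" by (rule borel_compact)
      moreover have "g ` (K \<inter> {..a}) = \<Omega> \<inter> g ` (K \<inter> {..a})" using surj by auto
      ultimately show "{x \<in> space (borel_of (top_of_set \<Omega>)). \<sigma> x \<le> a} \<in> sets (borel_of (top_of_set \<Omega>))"
        unfolding eq sets_borel_of_top_of_set sets_restrict_space by blast
    qed
    show "\<forall>x\<in>\<Omega>. \<sigma> x \<in> K \<and> g (\<sigma> x) = x" using \<sigma>F by (auto simp: F_def)
  qed
qed

text \<open>The measures are lifted to the real line along a Borel section of a continuous surjection, where
  Helly's theorem applies.\<close>

lemma prob_measures_seq_compact:
  fixes \<Omega> :: "'a::euclidean_space set" and p :: "nat \<Rightarrow> 'a measure"
  assumes \<Omega>: "compact \<Omega>" "convex \<Omega>" "\<Omega> \<noteq> {}"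
    and p: "\<And>n. prob_space (p n)" "\<And>n. sets (p n) = sets (borel_of (top_of_set \<Omega>))"
  obtains r q where "strict_mono (r :: nat \<Rightarrow> nat)" "prob_space q" "sets q = sets (borel_of (top_of_set \<Omega>))"
    "\<forall>f. continuous_on \<Omega> f \<longrightarrow> (\<lambda>n. \<integral>x. f x \<partial>p (r n)) \<longlonglongrightarrow> (\<integral>x. f x \<partial>q :: real)"
proof -
  let ?N = "borel_of (top_of_set \<Omega>)"
  obtain K :: "real set" and g :: "real \<Rightarrow> 'a" where K: "compact K" and g: "continuous_on UNIV g" "range g \<subseteq> \<Omega>" "g ` K = \<Omega>"
    using convex_compact_surjection[OF \<Omega>] .
  obtain \<sigma> where \<sigma>: "\<sigma> \<in> borel_measurable ?N" "\<forall>x\<in>\<Omega>. \<sigma> x \<in> K \<and> g (\<sigma> x) = x"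
    using measurable_section[OF K g(1,3)] .
  have sp: "space (p n) = \<Omega>" for n using sets_eq_imp_space_eq[OF p(2)[of n]] by simp
  have \<sigma>p: "\<sigma> \<in> borel_measurable (p n)" for n using \<sigma>(1) by (simp add: measurable_cong_sets[OF p(2) refl])
  have gm: "g \<in> measurable borel ?N"
  proof -
    have "g \<in> measurable borel (restrict_space borel \<Omega>)"
      using g by (intro measurable_restrict_space2) (auto intro: borel_measurable_continuous_onI)
    then show ?thesis by (simp add: measurable_cong_sets[OF refl sets_borel_of_top_of_set])
  qed
  define \<rho> where "\<rho> = (\<lambda>n. distr (p n) borel \<sigma>)"
  have \<rho>: "real_distribution (\<rho> n)" for n
  proof -
    interpret prob_space "p n" by (rule p)
    have "prob_space (\<rho> n)" unfolding \<rho>_def by (rule prob_space_distr[OF \<sigma>p])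
    then show ?thesis by (simp add: real_distribution_def real_distribution_axioms_def \<rho>_def)
  qed
  \<comment> \<open>The section takes its values in \<open>K\<close>, so all lifted measures are
    carried by one bounded interval.\<close>
  have "tight \<rho>"
    unfolding tight_def
  proof (intro conjI allI impI)
    fix \<epsilon> :: real assume "\<epsilon> > 0"
    obtain B where B: "B > 0" "\<And>t. t \<in> K \<Longrightarrow> norm t < B"
      using compact_imp_bounded[OF K] unfolding bounded_pos_less by blast
    have "measure (\<rho> n) {- B<..B} = 1" for n
    proof -
      interpret prob_space "p n" by (rule p)
      have "\<sigma> -` {- B<..B} \<inter> space (p n) = space (p n)"
        using \<sigma>(2) B by (force simp: sp abs_less_iff)
      then show ?thesis unfolding \<rho>_def by (simp add: measure_distr[OF \<sigma>p] prob_space)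
    qed
    with \<open>\<epsilon> > 0\<close> B show "\<exists>a b. a < b \<and> (\<forall>n. 1 - \<epsilon> < measure (\<rho> n) {a<..b})"
      by (intro exI[of _ "- B"] exI[of _ B]) auto
  qed (rule \<rho>)
  from tight_imp_convergent_subsubsequence[OF this strict_mono_id]
  obtain r \<rho>' where r: "strict_mono (r :: nat \<Rightarrow> nat)" and \<rho>': "real_distribution \<rho>'" and w: "weak_conv_m (\<rho> \<circ> r) \<rho>'"
    by (auto simp: id_def comp_def)
  interpret \<rho>': real_distribution \<rho>' by fact
  \<comment> \<open>\<open>g\<close> maps the whole line into \<Omega>, so the push-forward is
    defined wherever the limit is carried. The identity \<open>g (\<sigma> x) = x\<close> recovers
    the original integrals.\<close>
  define q where "q = distr \<rho>' ?N g"
  have gm': "g \<in> measurable \<rho>' ?N" using gm by (simp add: measurable_cong_sets[OF \<rho>'.events_eq_borel refl])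
  show ?thesis
  proof (rule that[OF r])
    show "prob_space q" unfolding q_def by (rule \<rho>'.prob_space_distr[OF gm'])
    show "sets q = sets ?N" by (simp add: q_def)
    show "\<forall>f. continuous_on \<Omega> f \<longrightarrow> (\<lambda>n. \<integral>x. f x \<partial>p (r n)) \<longlonglongrightarrow> (\<integral>x. f x \<partial>q :: real)"
    proof (intro allI impI)
      fix f :: "'a \<Rightarrow> real" assume f: "continuous_on \<Omega> f"
      have fm: "f \<in> borel_measurable ?N" by (rule measurable_borel_of_continuous_on[OF f])
      have cont: "continuous_on UNIV (\<lambda>t. f (g t))"
        using g by (intro continuous_on_compose2[OF f]) auto
      obtain B where B: "\<And>x. x \<in> \<Omega> \<Longrightarrow> norm (f x) \<le> B"
        using compact_imp_bounded[OF compact_continuous_image[OF f \<Omega>(1)]] unfolding bounded_iff by blast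
      have "(\<lambda>n. \<integral>t. f (g t) \<partial>(\<rho> \<circ> r) n) \<longlonglongrightarrow> (\<integral>t. f (g t) \<partial>\<rho>')"
      proof (rule weak_conv_imp_integral_bdd_continuous_conv[OF _ \<rho>' w])
        show "isCont (\<lambda>t. f (g t)) x" for x using cont by (simp add: continuous_on_eq_continuous_at)
        show "norm (f (g t)) \<le> B" for t using B g(2) by auto
      qed (use \<rho> in auto)
      moreover have "(\<integral>t. f (g t) \<partial>(\<rho> \<circ> r) n) = (\<integral>x. f x \<partial>p (r n))" for n
      proof -
        have "(\<integral>t. f (g t) \<partial>(\<rho> \<circ> r) n) = (\<integral>x. f (g (\<sigma> x)) \<partial>p (r n))"
          unfolding \<rho>_def comp_def
          by (rule integral_distr[OF \<sigma>p]) (rule measurable_compose[OF gm fm])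
        also have "\<dots> = (\<integral>x. f x \<partial>p (r n))"
          using \<sigma>(2) by (intro Bochner_Integration.integral_cong) (auto simp: sp)
        finally show ?thesis .
      qed
      moreover have "(\<integral>t. f (g t) \<partial>\<rho>') = (\<integral>x. f x \<partial>q)"
        unfolding q_def by (rule integral_distr[OF gm' fm, symmetric])
      ultimately show "(\<lambda>n. \<integral>x. f x \<partial>p (r n)) \<longlonglongrightarrow> (\<integral>x. f x \<partial>q)" by simp
    qed
  qed
qed

section \<open>From probability measures to the mass ball\<close>

lemma integral_scale_measure:
  fixes f :: "'a \<Rightarrow> real"
  assumes "f \<in> borel_measurable M" "0 \<le> r"
  shows "(\<integral>x. f x \<partial>scale_measure (ennreal r) M) = r * (\<integral>x. f x \<partial>M)"
proof -
  have "scale_measure (ennreal r) M = density M (\<lambda>_. ennreal r)"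
    by (rule measure_eqI) (auto simp: emeasure_density_const)
  then show ?thesis using assms by (simp add: integral_density)
qed

lemma limitin_weak_star_top_of_set:
  assumes "\<And>i. \<mu> i \<in> nonneg_measures (top_of_set \<Omega>)"
  shows "limitin (weak_star (top_of_set \<Omega>)) \<mu> \<nu> F \<longleftrightarrow> \<nu> \<in> nonneg_measures (top_of_set \<Omega>) \<and>
    (\<forall>f. continuous_on \<Omega> f \<longrightarrow> ((\<lambda>i. \<integral>x. f x \<partial>\<mu> i) \<longlongrightarrow> (\<integral>x. f x \<partial>\<nu> :: real)) F)"
  using limitin_weak_star_iff[of \<mu>, OF assms] by simp

text \<open>Total masses and normalised measures converge along successive subsequences, and their
  limits are multiplied.\<close>

lemma mass_ball_seq_compact:
  fixes \<Omega> :: "'a::euclidean_space set" and \<mu> :: "nat \<Rightarrow> 'a measure"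
  assumes \<Omega>: "compact \<Omega>" "convex \<Omega>" "\<Omega> \<noteq> {}" and \<mu>: "\<And>n. \<mu> n \<in> mass_ball \<Omega> M"
  obtains r \<nu> where "strict_mono (r :: nat \<Rightarrow> nat)" "\<nu> \<in> mass_ball \<Omega> M"
    "limitin (weak_star (top_of_set \<Omega>)) (\<mu> \<circ> r) \<nu> sequentially"
proof -
  let ?N = "borel_of (top_of_set \<Omega>)"
  obtain x0 where x0: "x0 \<in> \<Omega>" using \<Omega> by blast
  define m where "m = (\<lambda>n. measure (\<mu> n) \<Omega>)"
  have m: "0 \<le> m n" "m n \<le> M" for n using \<mu>[of n] by (auto simp: m_def mass_ball_def)
  have s: "sets (\<mu> n) = sets ?N" and f: "finite_measure (\<mu> n)" for n
    using \<mu>[of n] by (auto simp: mass_ball_def nonneg_measures_def)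
  have sp: "space (\<mu> n) = \<Omega>" for n using sets_eq_imp_space_eq[OF s[of n]] by simp
  have em: "emeasure (\<mu> n) \<Omega> = ennreal (m n)" for n
    using finite_measure.emeasure_eq_measure[OF f] by (simp add: m_def)
  have "compact {0..M}" by simp
  then obtain l r1 where l: "l \<in> {0..M}" and r1: "strict_mono (r1 :: nat \<Rightarrow> nat)" "(m \<circ> r1) \<longlonglongrightarrow> l"
    using m unfolding compact_def by (metis atLeastAtMost_iff)
  \<comment> \<open>A measure of mass 0 cannot be normalised; a point mass takes its place, and the
    factor \<open>m n = 0\<close> cancels its contribution in \<open>int\<close>.\<close>
  define p where "p = (\<lambda>n. if m n = 0 then return ?N x0 else scale_measure (ennreal (1 / m n)) (\<mu> n))"
  have p: "prob_space (p n)" "sets (p n) = sets ?N" for n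
  proof -
    show "prob_space (p n)"
    proof (cases "m n = 0")
      case True
      then show ?thesis using x0 by (simp add: p_def prob_space_return)
    next
      case False
      then show ?thesis using m(1)[of n]
        by (intro prob_spaceI) (simp add: p_def space_scale_measure sp em flip: ennreal_mult)
    qed
    show "sets (p n) = sets ?N" by (simp add: p_def s)
  qed
  have int: "(\<integral>x. f x \<partial>\<mu> n) = m n * (\<integral>x. f x \<partial>p n)" if f: "continuous_on \<Omega> f" for f n
  proof (cases "m n = 0")
    case True
    have "AE x in \<mu> n. f x = 0"
      by (rule AE_I[of _ _ \<Omega>]) (use True em[of n] sets.top[of "\<mu> n"] in \<open>auto simp: sp\<close>)
    then have "(\<integral>x. f x \<partial>\<mu> n) = 0" by (rule integral_eq_zero_AE)
    with True show ?thesis by simp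
  next
    case False
    have "f \<in> borel_measurable (\<mu> n)"
      using measurable_borel_of_continuous_on[OF f] by (simp add: measurable_cong_sets[OF s refl])
    with False m(1)[of n] show ?thesis by (simp add: p_def integral_scale_measure)
  qed
  obtain r2 q where r2: "strict_mono (r2 :: nat \<Rightarrow> nat)" and q: "prob_space q" "sets q = sets ?N"
    and lim: "\<forall>f. continuous_on \<Omega> f \<longrightarrow> (\<lambda>n. \<integral>x. f x \<partial>p (r1 (r2 n))) \<longlonglongrightarrow> (\<integral>x. f x \<partial>q :: real)"
    using prob_measures_seq_compact[OF \<Omega>, of "\<lambda>n. p (r1 n)"] p by metis
  interpret q: prob_space q by (rule q)
  have spq: "space q = \<Omega>" using sets_eq_imp_space_eq[OF q(2)] by simp
  define \<nu> where "\<nu> = scale_measure (ennreal l) q"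
  have "q \<in> nonneg_measures (top_of_set \<Omega>)" using q by (simp add: nonneg_measures_def q.finite_measure_axioms)
  then have \<nu>0: "\<nu> \<in> nonneg_measures (top_of_set \<Omega>)" unfolding \<nu>_def by (rule scale_nonneg_measures)
  have "emeasure \<nu> \<Omega> = ennreal l" using q.emeasure_space_1 by (simp add: \<nu>_def spq)
  then have "measure \<nu> \<Omega> = l" using l by (simp add: measure_def)
  with l \<nu>0 have \<nu>: "\<nu> \<in> mass_ball \<Omega> M" by (simp add: mass_ball_def)
  show ?thesis
  proof (rule that[of "r1 \<circ> r2"])
    show "strict_mono (r1 \<circ> r2)" using r1 r2 by (simp add: strict_mono_o)
    show "limitin (weak_star (top_of_set \<Omega>)) (\<mu> \<circ> (r1 \<circ> r2)) \<nu> sequentially"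
    proof (rule limitin_weak_star_top_of_set[THEN iffD2])
      show "(\<mu> \<circ> (r1 \<circ> r2)) i \<in> nonneg_measures (top_of_set \<Omega>)" for i
        using mass_ball_D(1)[OF \<mu>] by simp
      show "\<nu> \<in> nonneg_measures (top_of_set \<Omega>) \<and> (\<forall>f. continuous_on \<Omega> f \<longrightarrow>
          (\<lambda>i. \<integral>x. f x \<partial>(\<mu> \<circ> (r1 \<circ> r2)) i) \<longlonglongrightarrow> (\<integral>x. f x \<partial>\<nu> :: real))"
      proof (intro conjI allI impI \<nu>0)
        fix f :: "'a \<Rightarrow> real" assume f: "continuous_on \<Omega> f"
        have "(m \<circ> r1 \<circ> r2) \<longlonglongrightarrow> l" by (rule LIMSEQ_subseq_LIMSEQ[OF r1(2) r2])
        then have "(\<lambda>i. m (r1 (r2 i)) * (\<integral>x. f x \<partial>p (r1 (r2 i)))) \<longlonglongrightarrow> l * (\<integral>x. f x \<partial>q)"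
          using lim f by (intro tendsto_mult) (auto simp: comp_def)
        moreover have "f \<in> borel_measurable q"
          using measurable_borel_of_continuous_on[OF f] by (simp add: measurable_cong_sets[OF q(2) refl])
        ultimately show "(\<lambda>i. \<integral>x. f x \<partial>(\<mu> \<circ> (r1 \<circ> r2)) i) \<longlonglongrightarrow> (\<integral>x. f x \<partial>\<nu>)"
          using l by (simp add: int[OF f] \<nu>_def integral_scale_measure)
      qed
    qed
  qed (rule \<nu>)
qed

text \<open>A function with oscillation at most \<open>e\<close> at scale \<delta> is within
  \<open>e\<close> of the combination of the \<open>\<theta> j\<close> weighted by its samples.
  After integration the error is uniform on the mass ball, so integrals of ever finer partitions
  determine weak* limits.\<close>

lemma integral_partition_approx:
  fixes \<Omega> :: "'a::euclidean_space set"
  assumes \<Omega>: "compact \<Omega>" and \<mu>: "\<mu> \<in> mass_ball \<Omega> M" and \<theta>: "small_partition \<Omega> \<delta> J \<theta>"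
    and f: "continuous_on \<Omega> f" and osc: "\<forall>x\<in>\<Omega>. \<forall>y\<in>\<Omega>. dist x y < \<delta> \<longrightarrow> \<bar>f x - f y\<bar> \<le> e" and e: "e \<ge> 0"
  shows "\<bar>(\<integral>x. f x \<partial>\<mu>) - (\<Sum>j\<in>J. f j * (\<integral>x. \<theta> j x \<partial>\<mu>))\<bar> \<le> e * M"
proof -
  let ?N = "borel_of (top_of_set \<Omega>)"
  note \<theta> = small_partition_D[OF \<theta>]
  have s: "sets \<mu> = sets ?N" "finite_measure \<mu>" "measure \<mu> \<Omega> \<le> M"
    using \<mu> by (auto simp: mass_ball_def nonneg_measures_def)
  interpret finite_measure \<mu> by (rule s)
  have sp: "space \<mu> = \<Omega>" using sets_eq_imp_space_eq[OF s(1)] by simp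
  have int: "integrable \<mu> h" if h: "continuous_on \<Omega> h" for h :: "'a \<Rightarrow> real"
  proof -
    obtain B where "\<And>x. x \<in> \<Omega> \<Longrightarrow> norm (h x) \<le> B"
      using compact_imp_bounded[OF compact_continuous_image[OF h \<Omega>]] unfolding bounded_iff by blast
    moreover have "h \<in> borel_measurable \<mu>"
      using measurable_borel_of_continuous_on[OF h] by (simp add: measurable_cong_sets[OF s(1) refl])
    ultimately show ?thesis by (intro integrable_const_bound[of _ B]) (auto simp: sp)
  qed
  have I: "integrable \<mu> f" "\<And>j. j \<in> J \<Longrightarrow> integrable \<mu> (\<theta> j)" using int f \<theta> by auto
  then have I': "integrable \<mu> (\<lambda>x. \<Sum>j\<in>J. f j * \<theta> j x)" by auto
  have "(\<integral>x. f x \<partial>\<mu>) - (\<Sum>j\<in>J. f j * (\<integral>x. \<theta> j x \<partial>\<mu>)) = (\<integral>x. f x - (\<Sum>j\<in>J. f j * \<theta> j x) \<partial>\<mu>)"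
    using I I' by simp
  also have "\<bar>\<dots>\<bar> \<le> (\<integral>x. \<bar>f x - (\<Sum>j\<in>J. f j * \<theta> j x)\<bar> \<partial>\<mu>)"
    by (rule integral_abs_bound)
  also have "\<dots> \<le> (\<integral>x. e \<partial>\<mu>)"
  proof (rule integral_mono)
    show "integrable \<mu> (\<lambda>x. \<bar>f x - (\<Sum>j\<in>J. f j * \<theta> j x)\<bar>)" using I I' by auto
    fix x assume "x \<in> space \<mu>"
    then have x: "x \<in> \<Omega>" by (simp add: sp)
    have "f x - (\<Sum>j\<in>J. f j * \<theta> j x) = (\<Sum>j\<in>J. (f x - f j) * \<theta> j x)"
      using \<theta>(5)[OF x] by (simp add: left_diff_distrib sum_subtractf flip: sum_distrib_left)
    also have "\<bar>\<dots>\<bar> \<le> (\<Sum>j\<in>J. e * \<theta> j x)"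
    proof (rule order_trans[OF sum_abs sum_mono])
      fix j assume j: "j \<in> J"
      show "\<bar>(f x - f j) * \<theta> j x\<bar> \<le> e * \<theta> j x"
      proof (cases "\<theta> j x = 0")
        case False
        then have "\<theta> j x > 0" using \<theta>(4)[of j x] by simp
        then have "dist x j < \<delta>" using \<theta>(6) by (simp add: dist_commute)
        then have "\<bar>f x - f j\<bar> \<le> e" using osc x j \<theta>(2) by blast
        then show ?thesis using \<theta>(4)[of j x] by (simp add: abs_mult mult_right_mono)
      qed simp
    qed
    also have "\<dots> = e" using \<theta>(5)[OF x] by (simp flip: sum_distrib_left)
    finally show "\<bar>f x - (\<Sum>j\<in>J. f j * \<theta> j x)\<bar> \<le> e" .
  qed simp
  also have "\<dots> = e * measure \<mu> \<Omega>" by (simp add: sp)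
  also have "\<dots> \<le> e * M" using s e by (intro mult_left_mono) auto
  finally show ?thesis .
qed

lemma tendsto_fun_iff:
  fixes f :: "'c \<Rightarrow> 'a \<Rightarrow> 'b::topological_space"
  shows "(f \<longlongrightarrow> l) F \<longleftrightarrow> (\<forall>i. ((\<lambda>c. f c i) \<longlongrightarrow> l i) F)"
  using limitin_componentwise[of "\<lambda>_. euclidean :: 'b topology" UNIV f l F]
  by (simp add: euclidean_product_topology)

text \<open>Integrals against countably many partitions of unity embed the mass ball into \<open>\<nat> \<times> \<nat> \<Rightarrow> \<real>\<close>,
  a metric space, in which compactness is sequential compactness.\<close>

lemma compactin_mass_ball:
  fixes \<Omega> :: "'a::euclidean_space set"
  assumes \<Omega>: "compact \<Omega>" "convex \<Omega>" "\<Omega> \<noteq> {}" and M: "M > 0"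
  shows "compactin (weak_star (top_of_set \<Omega>)) (mass_ball \<Omega> M)"
proof -
  let ?W = "weak_star (top_of_set \<Omega>)"
  have "\<exists>J \<theta>. small_partition \<Omega> (1 / Suc n) J \<theta>" for n
    using small_partition_exists[OF \<Omega>(1), of "1 / Suc n"] by (metis zero_less_divide_1_iff of_nat_0_less_iff zero_less_Suc)
  then obtain J \<theta> where \<theta>: "\<And>n. small_partition \<Omega> (1 / Suc n) (J n) (\<theta> n)" by metis
  have fin: "finite (J n)" for n using small_partition_D(1)[OF \<theta>] .
  have ne: "J n \<noteq> {}" for n
  proof
    assume "J n = {}"
    moreover obtain x where "x \<in> \<Omega>" using \<Omega> by blast
    ultimately show False using small_partition_D(5)[OF \<theta>, of x n] by simp
  qed
  \<comment> \<open>Each finite index set is enumerated with repetitions, so that all integrals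
    share the countable index type \<open>nat \<times> nat\<close>.\<close>
  define idx where "idx = (\<lambda>n. from_nat_into (J n))"
  define T where "T = (\<lambda>\<mu> (n, i). \<integral>x. \<theta> n (idx n i) x \<partial>\<mu> :: real)"
  have idx: "idx n i \<in> J n" for n i unfolding idx_def by (rule from_nat_into[OF ne])
  have surj: "\<exists>i. idx n i = j" if "j \<in> J n" for n j
    using from_nat_into_surj[OF countable_finite[OF fin] that] by (auto simp: idx_def)
  \<comment> \<open>For a given test function a partition finer than its modulus of continuity is
    fixed first; then finitely many components of \<open>T\<close> decide.\<close>
  have conv: "limitin ?W \<mu> \<nu> sequentially"
    if \<mu>: "\<And>k. \<mu> k \<in> mass_ball \<Omega> M" and \<nu>: "\<nu> \<in> mass_ball \<Omega> M" and T: "(\<lambda>k. T (\<mu> k)) \<longlonglongrightarrow> T \<nu>" for \<mu> \<nu>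
  proof (rule limitin_weak_star_top_of_set[THEN iffD2])
    show "\<mu> k \<in> nonneg_measures (top_of_set \<Omega>)" for k using mass_ball_D(1)[OF \<mu>] .
    show "\<nu> \<in> nonneg_measures (top_of_set \<Omega>) \<and> (\<forall>f. continuous_on \<Omega> f \<longrightarrow> (\<lambda>k. \<integral>x. f x \<partial>\<mu> k) \<longlonglongrightarrow> (\<integral>x. f x \<partial>\<nu> :: real))"
    proof (intro conjI allI impI mass_ball_D(1)[OF \<nu>])
      fix f :: "'a \<Rightarrow> real" assume f: "continuous_on \<Omega> f"
      show "(\<lambda>k. \<integral>x. f x \<partial>\<mu> k) \<longlonglongrightarrow> (\<integral>x. f x \<partial>\<nu>)"
      proof (rule tendstoI)
        fix e :: real assume e: "e > 0"
        define d where "d = e / (3 * M)"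
        have d: "d > 0" "d * M = e / 3" using e M by (auto simp: d_def)
        obtain \<delta> where \<delta>: "\<delta> > 0" "\<forall>x\<in>\<Omega>. \<forall>y\<in>\<Omega>. dist y x < \<delta> \<longrightarrow> dist (f y) (f x) < d"
          using compact_uniformly_continuous[OF f \<Omega>(1)] d(1) unfolding uniformly_continuous_on_def by blast
        obtain n where n: "1 / Suc n < \<delta>" using \<delta>(1) by (metis nat_approx_posE)
        have osc: "\<forall>x\<in>\<Omega>. \<forall>y\<in>\<Omega>. dist x y < 1 / Suc n \<longrightarrow> \<bar>f x - f y\<bar> \<le> d"
          using \<delta>(2) n by (force simp: dist_real_def)
        define S where "S = (\<lambda>\<mu>. \<Sum>j\<in>J n. f j * (\<integral>x. \<theta> n j x \<partial>\<mu>))"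
        have approx: "\<bar>(\<integral>x. f x \<partial>\<rho>) - S \<rho>\<bar> \<le> e / 3" if "\<rho> \<in> mass_ball \<Omega> M" for \<rho>
          using integral_partition_approx[OF \<Omega>(1) that \<theta> f osc] d by (simp add: S_def)
        have "(\<lambda>k. S (\<mu> k)) \<longlonglongrightarrow> S \<nu>"
          unfolding S_def
        proof (intro tendsto_sum tendsto_mult tendsto_const)
          fix j assume "j \<in> J n"
          then obtain i where i: "idx n i = j" using surj by blast
          have "(\<lambda>k. T (\<mu> k) (n, i)) \<longlonglongrightarrow> T \<nu> (n, i)" using T unfolding tendsto_fun_iff by blast
          then show "(\<lambda>k. \<integral>x. \<theta> n j x \<partial>\<mu> k) \<longlonglongrightarrow> (\<integral>x. \<theta> n j x \<partial>\<nu>)" by (simp add: T_def i)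
        qed
        then have "\<forall>\<^sub>F k in sequentially. dist (S (\<mu> k)) (S \<nu>) < e / 3" using e by (intro tendstoD) auto
        then show "\<forall>\<^sub>F k in sequentially. dist (\<integral>x. f x \<partial>\<mu> k) (\<integral>x. f x \<partial>\<nu>) < e"
        proof eventually_elim
          case (elim k)
          then show ?case using approx[OF \<mu>[of k]] approx[OF \<nu>] unfolding dist_real_def by linarith
        qed
      qed
    qed
  qed
  have compT: "compact (T ` mass_ball \<Omega> M)"
    unfolding compact_def
  proof (intro allI impI)
    fix s :: "nat \<Rightarrow> nat \<times> nat \<Rightarrow> real" assume "\<forall>k. s k \<in> T ` mass_ball \<Omega> M"
    then have "\<forall>k. \<exists>\<mu>. \<mu> \<in> mass_ball \<Omega> M \<and> s k = T \<mu>" by blast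
    from choice[OF this] obtain \<mu> where \<mu>: "\<And>k. \<mu> k \<in> mass_ball \<Omega> M" "\<And>k. s k = T (\<mu> k)" by blast
    obtain r \<nu> where r: "strict_mono (r :: nat \<Rightarrow> nat)" and \<nu>: "\<nu> \<in> mass_ball \<Omega> M"
      and lim: "limitin ?W (\<mu> \<circ> r) \<nu> sequentially"
      using mass_ball_seq_compact[OF \<Omega> \<mu>(1)] .
    have "\<And>k. (\<mu> \<circ> r) k \<in> nonneg_measures (top_of_set \<Omega>)" using mass_ball_D(1)[OF \<mu>(1)] by simp
    note L = lim[unfolded limitin_weak_star_top_of_set[OF this]]
    have "(\<lambda>k. T (\<mu> (r k)) (n, i)) \<longlonglongrightarrow> T \<nu> (n, i)" for n i
      using L small_partition_D(3)[OF \<theta> idx, of n i] by (simp add: T_def)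
    then have "(\<lambda>k. T (\<mu> (r k))) \<longlonglongrightarrow> T \<nu>" unfolding tendsto_fun_iff by auto
    then show "\<exists>l\<in>T ` mass_ball \<Omega> M. \<exists>r. strict_mono r \<and> (s \<circ> r) \<longlonglongrightarrow> l"
      using \<nu> r by (auto simp: comp_def \<mu>(2))
  qed
  \<comment> \<open>Continuity of the inverse of \<open>T\<close>, phrased without injectivity:
    failure for all balls of radius \<open>1 / Suc k\<close> would give a sequence outside
    \<open>U\<close> that converges to \<nu> by \<open>conv\<close>.\<close>
  have nbhd: "\<exists>V. open V \<and> T \<nu> \<in> V \<and> (\<forall>\<mu>\<in>mass_ball \<Omega> M. T \<mu> \<in> V \<longrightarrow> \<mu> \<in> U)"
    if U: "openin ?W U" "\<nu> \<in> U" and \<nu>: "\<nu> \<in> mass_ball \<Omega> M" for U \<nu>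
  proof (rule ccontr)
    assume contr: "\<not> ?thesis"
    have ex: "\<forall>k. \<exists>\<mu>. \<mu> \<in> mass_ball \<Omega> M \<and> dist (T \<nu>) (T \<mu>) < 1 / Suc k \<and> \<mu> \<notin> U"
    proof (rule ccontr)
      assume "\<not> ?thesis"
      then obtain k where "\<not> (\<exists>\<mu>. \<mu> \<in> mass_ball \<Omega> M \<and> dist (T \<nu>) (T \<mu>) < 1 / Suc k \<and> \<mu> \<notin> U)" by blast
      then have "open (ball (T \<nu>) (1 / Suc k)) \<and> T \<nu> \<in> ball (T \<nu>) (1 / Suc k) \<and>
          (\<forall>\<mu>\<in>mass_ball \<Omega> M. T \<mu> \<in> ball (T \<nu>) (1 / Suc k) \<longrightarrow> \<mu> \<in> U)" by auto
      with contr show False by blast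
    qed
    from choice[OF ex] obtain \<mu> where \<mu>: "\<And>k. \<mu> k \<in> mass_ball \<Omega> M" "\<And>k. dist (T \<nu>) (T (\<mu> k)) < 1 / Suc k" "\<And>k. \<mu> k \<notin> U"
      by blast
    have "(\<lambda>k. dist (T (\<mu> k)) (T \<nu>)) \<longlonglongrightarrow> 0"
      by (rule tendsto_sandwich[OF _ _ tendsto_const LIMSEQ_Suc[OF lim_1_over_n]])
        (use \<mu>(2) in \<open>auto simp: dist_commute less_imp_le intro!: always_eventually\<close>)
    then have "(\<lambda>k. T (\<mu> k)) \<longlonglongrightarrow> T \<nu>" by (rule tendsto_dist_iff[THEN iffD2])
    then have "limitin ?W \<mu> \<nu> sequentially" using conv \<mu>(1) \<nu> by blast
    from limitinD[OF this U] have "\<forall>\<^sub>F k in sequentially. \<mu> k \<in> U" .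
    with \<mu>(3) show False by simp
  qed
  show ?thesis
    unfolding compactin_def
  proof (intro conjI allI impI)
    show "mass_ball \<Omega> M \<subseteq> topspace ?W" by (auto simp: mass_ball_def)
    fix \<U> assume \<U>: "Ball \<U> (openin ?W) \<and> mass_ball \<Omega> M \<subseteq> \<Union>\<U>"
    then have "\<forall>\<nu>\<in>mass_ball \<Omega> M. \<exists>U V. U \<in> \<U> \<and> open V \<and> T \<nu> \<in> V \<and> (\<forall>\<mu>\<in>mass_ball \<Omega> M. T \<mu> \<in> V \<longrightarrow> \<mu> \<in> U)"
      using nbhd by (meson UnionE subsetD)
    then obtain U V where UV: "\<And>\<nu>. \<nu> \<in> mass_ball \<Omega> M \<Longrightarrow> U \<nu> \<in> \<U> \<and> open (V \<nu>) \<and> T \<nu> \<in> V \<nu> \<and>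
        (\<forall>\<mu>\<in>mass_ball \<Omega> M. T \<mu> \<in> V \<nu> \<longrightarrow> \<mu> \<in> U \<nu>)"
      by metis
    \<comment> \<open>The cover has been carried over to the compact image of \<open>T\<close>; a
      finite subcover there selects a finite subcover of the mass ball.\<close>
    obtain C where C: "C \<subseteq> mass_ball \<Omega> M" "finite C" "T ` mass_ball \<Omega> M \<subseteq> (\<Union>\<nu>\<in>C. V \<nu>)"
      using compactE_image[OF compT, of "mass_ball \<Omega> M" V] UV by blast
    show "\<exists>\<F>. finite \<F> \<and> \<F> \<subseteq> \<U> \<and> mass_ball \<Omega> M \<subseteq> \<Union>\<F>"
    proof (intro exI conjI)
      show "finite (U ` C)" using C by simp
      show "U ` C \<subseteq> \<U>" using C UV by blast
      show "mass_ball \<Omega> M \<subseteq> \<Union>(U ` C)"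
      proof
        fix \<mu> assume \<mu>: "\<mu> \<in> mass_ball \<Omega> M"
        then obtain \<nu> where "\<nu> \<in> C" "T \<mu> \<in> V \<nu>" using C(3) by blast
        then show "\<mu> \<in> \<Union>(U ` C)" using UV C(1) \<mu> by blast
      qed
    qed
  qed
qed

text \<open>The total mass is the integral of the continuous function 1. Closedness confines the
  closure of the minimizers, and thus every cluster point, to the compact ball.\<close>

lemma closedin_mass_ball: "closedin (weak_star (top_of_set \<Omega>)) (mass_ball \<Omega> M)"
proof -
  let ?W = "weak_star (top_of_set \<Omega>)"
  have "continuous_map ?W euclideanreal (\<lambda>\<mu>. \<integral>x. 1 \<partial>\<mu>)"
    by (rule continuous_map_integral_weak_star) simp
  then have "closedin ?W {\<mu> \<in> topspace ?W. (\<integral>x. 1 \<partial>\<mu>) \<in> {..M}}"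
    by (rule closedin_continuous_map_preimage) (simp add: closed_closedin[symmetric])
  also have "{\<mu> \<in> topspace ?W. (\<integral>x. 1 \<partial>\<mu>) \<in> {..M}} = mass_ball \<Omega> M"
    using sets_eq_imp_space_eq[of _ "borel_of (top_of_set \<Omega>)"] by (auto simp: mass_ball_def nonneg_measures_def)
  finally show ?thesis .
qed

section \<open>Stability of minimizers\<close>

theorem corollary3p3:
  fixes \<Omega> :: "'a::euclidean_space set"
    and \<kappa> M :: real
    and \<Lambda>s :: "nat \<Rightarrow> 'a measure measure"
    and \<Lambda> :: "'a measure measure"
    and \<nu>s :: "nat \<Rightarrow> 'a measure"
  assumes "compact \<Omega>" and "convex \<Omega>" and "interior \<Omega> \<noteq> {}"
    and "\<kappa> > 0" and "M > 0"
    and "\<And>n. \<Lambda>s n \<in> prob_measures (mass_ball_topology \<Omega> M)"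
    and "\<Lambda> \<in> prob_measures (mass_ball_topology \<Omega> M)"
    and "limitin (weak_star (mass_ball_topology \<Omega> M)) \<Lambda>s \<Lambda> sequentially"
    and "\<And>n. HK_minimizer \<kappa> \<Omega> (\<Lambda>s n) (\<nu>s n)"
  shows "precompact_seq (weak_star (top_of_set \<Omega>)) \<nu>s \<and>
    (\<forall>\<nu>. cluster_point (weak_star (top_of_set \<Omega>)) \<nu>s \<nu> \<longrightarrow>
      \<nu> \<in> mass_ball \<Omega> M \<and> HK_minimizer \<kappa> \<Omega> \<Lambda> \<nu>)"
proof -
  let ?W = "weak_star (top_of_set \<Omega>)"
  let ?X = "mass_ball_topology \<Omega> M"
  let ?J = "\<lambda>\<Lambda> \<nu>. \<integral>\<mu>. HK_real \<kappa> \<Omega> \<mu> \<nu> \<partial>\<Lambda>"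
  note \<Omega> = assms(1) and \<kappa> = assms(4)
  have ne: "\<Omega> \<noteq> {}" using assms(3) interior_subset by blast
  have \<nu>s: "\<nu>s n \<in> mass_ball \<Omega> M" for n
    by (rule HK_minimizer_mass[OF \<Omega> \<kappa> assms(6) assms(9)])
  have closure: "?W closure_of range \<nu>s \<subseteq> mass_ball \<Omega> M"
    using \<nu>s by (intro closure_of_minimal closedin_mass_ball) auto
  have "precompact_seq ?W \<nu>s"
    unfolding precompact_seq_def
  proof
    show "range \<nu>s \<subseteq> topspace ?W" using \<nu>s by (auto simp: mass_ball_def)
    show "compactin ?W (?W closure_of range \<nu>s)"
      by (rule closed_compactin[OF compactin_mass_ball[OF \<Omega> assms(2) ne assms(5)] closure]) simp
  qed
  moreover have "\<nu> \<in> mass_ball \<Omega> M \<and> HK_minimizer \<kappa> \<Omega> \<Lambda> \<nu>" if cl: "cluster_point ?W \<nu>s \<nu>" for \<nu>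
  proof -
    have freq: "\<exists>\<^sub>F n in sequentially. \<nu>s n \<in> U" if "openin ?W U" "\<nu> \<in> U" for U
      using cl that by (auto simp: cluster_point_def)
    have "\<nu> \<in> ?W closure_of range \<nu>s"
      unfolding in_closure_of
    proof (intro conjI allI impI)
      show "\<nu> \<in> topspace ?W" using cl by (simp add: cluster_point_def)
      fix U assume "\<nu> \<in> U \<and> openin ?W U"
      then have "\<exists>n. \<nu>s n \<in> U" using freq[of U] frequently_ex by blast
      then show "\<exists>y. y \<in> range \<nu>s \<and> y \<in> U" by blast
    qed
    then have \<nu>M: "\<nu> \<in> mass_ball \<Omega> M" using closure by blast
    have \<nu>: "\<nu> \<in> nonneg_measures (top_of_set \<Omega>)" by (rule mass_ball_D(1)[OF \<nu>M])
    \<comment> \<open>With a fixed second argument the integrand is a test function on the mass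
      ball, so weak* convergence applies directly. For the moving \<open>\<nu>s n\<close> it does
      not.\<close>
    have lim: "(\<lambda>n. ?J (\<Lambda>s n) \<rho>) \<longlonglongrightarrow> ?J \<Lambda> \<rho>" if "\<rho> \<in> nonneg_measures (top_of_set \<Omega>)" for \<rho>
    proof -
      have "\<And>n. \<Lambda>s n \<in> nonneg_measures ?X" using assms(6) by (simp add: prob_measures_def)
      from assms(8)[unfolded limitin_weak_star_iff[OF this]] show ?thesis
        using continuous_map_HK_real[OF \<Omega> \<kappa> that] by blast
    qed
    have "?J \<Lambda> \<nu> \<le> ?J \<Lambda> \<rho>" if \<rho>: "\<rho> \<in> nonneg_measures (top_of_set \<Omega>)" for \<rho>
    proof (rule field_le_epsilon)
      fix e :: real assume e: "e > 0"
      have M0: "M \<ge> 0" using assms(5) by simp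
      have e3: "e / 3 > 0" using e by simp
      obtain U where U: "openin ?W U" "\<nu> \<in> U"
        and H: "\<forall>\<nu>'\<in>U \<inter> mass_ball \<Omega> M. \<forall>\<mu>\<in>mass_ball \<Omega> M. HK_sq \<kappa> \<Omega> \<mu> \<nu> \<le> HK_sq \<kappa> \<Omega> \<mu> \<nu>' + ennreal (e / 3)"
        using HK_neighbourhood[OF \<Omega> \<kappa> M0 e3 \<nu>M] .
      have ev1: "\<forall>\<^sub>F n in sequentially. dist (?J (\<Lambda>s n) \<nu>) (?J \<Lambda> \<nu>) < e / 3"
        using e by (intro tendstoD[OF lim[OF \<nu>]]) simp
      have ev2: "\<forall>\<^sub>F n in sequentially. dist (?J (\<Lambda>s n) \<rho>) (?J \<Lambda> \<rho>) < e / 3"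
        using e by (intro tendstoD[OF lim[OF \<rho>]]) simp
      \<comment> \<open>Cluster points are given by neighbourhoods, so no subsequence is extracted:
        for each \<open>e\<close> a single index suffices at which the frequent and the two eventual
        properties hold together.\<close>
      obtain n where n: "\<nu>s n \<in> U" "dist (?J (\<Lambda>s n) \<nu>) (?J \<Lambda> \<nu>) < e / 3"
          "dist (?J (\<Lambda>s n) \<rho>) (?J \<Lambda> \<rho>) < e / 3"
        using frequently_ex[OF frequently_eventually_conj[OF freq[OF U] eventually_conj[OF ev1 ev2]]] by blast
      note P = prob_measures_D[OF assms(6)[of n]]
      interpret prob_space "\<Lambda>s n" by (rule P)
      have \<nu>n: "\<nu>s n \<in> nonneg_measures (top_of_set \<Omega>)" by (rule mass_ball_D(1)[OF \<nu>s])
      have "?J (\<Lambda>s n) \<nu> \<le> (\<integral>\<mu>. HK_real \<kappa> \<Omega> \<mu> (\<nu>s n) + e / 3 \<partial>\<Lambda>s n)"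
      proof (rule integral_mono)
        fix \<mu> assume "\<mu> \<in> space (\<Lambda>s n)"
        then have \<mu>: "\<mu> \<in> mass_ball \<Omega> M" by (simp add: P)
        have "HK_sq \<kappa> \<Omega> \<mu> \<nu> \<le> HK_sq \<kappa> \<Omega> \<mu> (\<nu>s n) + ennreal (e / 3)" using H n(1) \<nu>s \<mu> by blast
        then show "HK_real \<kappa> \<Omega> \<mu> \<nu> \<le> HK_real \<kappa> \<Omega> \<mu> (\<nu>s n) + e / 3"
          using e HK_sq_eq_real[OF \<Omega> mass_ball_D(1)[OF \<mu>] \<nu>, of \<kappa>] HK_sq_eq_real[OF \<Omega> mass_ball_D(1)[OF \<mu>] \<nu>n, of \<kappa>]
          by (simp flip: ennreal_plus)
      qed (use HK_functional_eq_integral(1)[OF \<Omega> \<kappa> \<nu> assms(6)] HK_functional_eq_integral(1)[OF \<Omega> \<kappa> \<nu>n assms(6)] in auto)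
      also have "\<dots> = ?J (\<Lambda>s n) (\<nu>s n) + e / 3"
        using HK_functional_eq_integral(1)[OF \<Omega> \<kappa> \<nu>n assms(6)] by (simp add: prob_space)
      also have "?J (\<Lambda>s n) (\<nu>s n) \<le> ?J (\<Lambda>s n) \<rho>"
        using assms(9)[of n] \<rho> unfolding HK_minimizer_iff[OF \<Omega> \<kappa> assms(6)] by blast
      \<comment> \<open>Two thirds of \<open>e\<close> pay for replacing \<Lambda> by
        \<open>\<Lambda>s n\<close> at \<nu> and at \<rho>, and one for replacing \<nu> by
        \<open>\<nu>s n\<close>.\<close>
      finally show "?J \<Lambda> \<nu> \<le> ?J \<Lambda> \<rho> + e" using n(2,3) unfolding dist_real_def by linarith
    qed
    with \<nu>M \<nu> show ?thesis unfolding HK_minimizer_iff[OF \<Omega> \<kappa> assms(7)] by blast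
  qed
  ultimately show ?thesis by blast
qed

end
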